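(* Let $X$ be an infinite dimensional complex Banach space, $L$ a complex nilpotent finite dimensional Lie algebra with $n=\dim L$, and $\rho\colon L\to L(X)$ a representation of $L$ in $X$ such that $\rho(l)\in K(X)$ for each $l\in L$. Then, for every $k=0,\ldots,n$, the sets $\sigma(\rho)$, $\sigma_{\delta,k}(\rho)\cup\{0\}$ and $\sigma_{\pi,k}(\rho)\cup\{0\}$ all coincide with the set $$\{0\}\cup\{f\in L^*: f(L^2)=0, \text{ and there is } x\in X,\ x\neq 0, \text{ such that } \rho(l)(x)=f(l)x \text{ for all } l\in L\}.$$
   Context: $L(X)$ is the algebra of all bounded linear operators on the complex Banach space $X$, and $K(X)$ is the ideal of compact operators. $L^*$ is the (linear) dual of the Lie algebra $L$, and $L^2=\{[x,y]: x,y\in L\}$. A representation $\rho\colon L\to L(X)$ is a Lie algebra homomorphism (with $L(X)$ carrying the commutator bracket). $R(T)$ denotes the range of an operator $T$. Koszul complex: for a representation $\rho$ of a complex solvable finite dimensional Lie algebra $L$, $n=\dim L$, the complex $(X\otimes\wedge L,d(\rho))$ has spaces $X\otimes\wedge^pL$ (with the Banach space topology of a finite direct sum of copies of $X$) and maps $d_p(\rho)\colon X\otimes\wedge^pL\to X\otimes\wedge^{p-1}L$, $$d_p(\rho)(x\otimes\langle l_1\wedge\dots\wedge l_p\rangle)=\sum_{k=1}^p(-1)^{k+1}\rho(l_k)(x)\otimes\langle l_1\wedge\ldots\wedge\hat{l_k}\wedge\ldots\wedge l_p\rangle+\sum_{1\le i<j\le p}(-1)^{i+j-1}x\otimes\langle[l_i,l_j]\wedge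 l_1\wedge\ldots\wedge\hat{l_i}\wedge\ldots\wedge\hat{l_j}\wedge\ldots\wedge l_p\rangle,$$ where $\hat{\ }$ means deletion, and $d_p(\rho)=0$ for $p\le 0$ or $p\ge n+1$. For a character $f$ of $L$ (i.e. $f\in L^*$ with $f(L^2)=0$), $\rho-f$ denotes the representation $l\mapsto\rho(l)-f(l)I$, $I$ being the identity of $X$. $H_p(X\otimes\wedge L,d(\rho-f))$ is the $p$-th homology of the corresponding Koszul complex (purely algebraic: kernel of $d_p(\rho-f)$ modulo range of $d_{p+1}(\rho-f)$). Set $\sigma_p(\rho)=\{f\in L^*: f(L^2)=0,\ H_p(X\otimes\wedge L,d(\rho-f))\neq 0\}$. Taylor joint spectrum: $\sigma(\rho)=\bigcup_{p=0}^n\sigma_p(\rho)$. Słodkowski joint spectra, for $k=0,\ldots,n$: $\sigma_{\delta,k}(\rho)=\bigcup_{p=0}^k\sigma_p(\rho)$ and $\sigma_{\pi,k}(\rho)=\bigcup_{p=n-k}^n\sigma_p(\rho)\cup\{f\in L^*: f(L^2)=0,\ R(d_{n-k}(\rho-f))\text{ is not closed}\}$. *)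

theory Defs
  imports "HOL-Analysis.Analysis"
begin

section \<open>Complex vector spaces and complex Banach spaces\<close>

class complex_vector = ab_group_add +
  fixes scaleC :: "complex \<Rightarrow> 'a \<Rightarrow> 'a"  (infixr \<open>*\<^sub>C\<close> 75)
  assumes scaleC_add_right: "a *\<^sub>C (x + y) = a *\<^sub>C x + a *\<^sub>C y"
    and scaleC_add_left: "(a + b) *\<^sub>C x = a *\<^sub>C x + b *\<^sub>C x"
    and scaleC_scaleC: "a *\<^sub>C b *\<^sub>C x = (a * b) *\<^sub>C x"
    and scaleC_one: "1 *\<^sub>C x = x"

global_interpretation cvec: vector_space "scaleC :: complex \<Rightarrow> 'a \<Rightarrow> 'a::complex_vector"
  by standard (rule scaleC_add_right scaleC_add_left scaleC_scaleC scaleC_one)+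

class complex_banach = complex_vector + banach +
  assumes scaleR_scaleC: "r *\<^sub>R x = complex_of_real r *\<^sub>C x"
    and norm_scaleC: "norm (a *\<^sub>C x) = cmod a * norm x"

instantiation complex :: complex_banach
begin

definition scaleC_complex :: "complex \<Rightarrow> complex \<Rightarrow> complex"
  where "scaleC_complex a x = a * x"

instance
  by standard
    (simp_all add: scaleC_complex_def algebra_simps norm_mult scaleR_conv_of_real)

end

abbreviation clinear :: "('a::complex_vector \<Rightarrow> 'b::complex_vector) \<Rightarrow> bool"
  where "clinear \<equiv> Vector_Spaces.linear scaleC scaleC"

definition cfinite_dim :: "'a::complex_vector itself \<Rightarrow> bool"
  where "cfinite_dim _ \<longleftrightarrow> (\<exists>B::'a set. finite B \<and> cvec.span B = UNIV)"

definition cdim :: "'a::complex_vector itself \<Rightarrow> nat"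
  where "cdim _ = cvec.dim (UNIV :: 'a set)"

definition bounded_clinear :: "('a::complex_banach \<Rightarrow> 'b::complex_banach) \<Rightarrow> bool"
  where "bounded_clinear T \<longleftrightarrow> clinear T \<and> (\<exists>K. \<forall>x. norm (T x) \<le> norm x * K)"

definition compact_operator :: "('a::complex_banach \<Rightarrow> 'b::complex_banach) \<Rightarrow> bool"
  where "compact_operator T \<longleftrightarrow> bounded_clinear T \<and> compact (closure (T ` cball 0 1))"

section \<open>Complex Lie algebras and their representations\<close>

locale lie_algebra =
  fixes br :: "'l::complex_vector \<Rightarrow> 'l \<Rightarrow> 'l"
  assumes br_linear_right: "clinear (\<lambda>y. br x y)"
    and br_linear_left: "clinear (\<lambda>x. br x y)"
    and br_self: "br x x = 0"
    and jacobi: "br x (br y z) + br y (br z x) + br z (br x y) = 0"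

primrec lower_central :: "('l::complex_vector \<Rightarrow> 'l \<Rightarrow> 'l) \<Rightarrow> nat \<Rightarrow> 'l set"
  where
    "lower_central br 0 = UNIV"
  | "lower_central br (Suc k) = cvec.span {br x y | x y. y \<in> lower_central br k}"

definition lie_nilpotent :: "('l::complex_vector \<Rightarrow> 'l \<Rightarrow> 'l) \<Rightarrow> bool"
  where "lie_nilpotent br \<longleftrightarrow> (\<exists>k. lower_central br k = {0})"

locale lie_representation = lie_algebra br
  for br :: "'l::complex_vector \<Rightarrow> 'l \<Rightarrow> 'l" +
  fixes \<rho> :: "'l \<Rightarrow> 'x::complex_banach \<Rightarrow> 'x"
  assumes rep_bounded: "bounded_clinear (\<rho> l)"
    and rep_add: "\<rho> (l + m) x = \<rho> l x + \<rho> m x"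
    and rep_scale: "\<rho> (c *\<^sub>C l) x = c *\<^sub>C \<rho> l x"
    and rep_br: "\<rho> (br l m) x = \<rho> l (\<rho> m x) - \<rho> m (\<rho> l x)"

text \<open>Characters: the linear functionals on \<open>L\<close> that vanish on \<open>L\<^sup>2\<close>.\<close>

definition characters :: "('l::complex_vector \<Rightarrow> 'l \<Rightarrow> 'l) \<Rightarrow> ('l \<Rightarrow> complex) set"
  where "characters br = {f. clinear f \<and> (\<forall>x y. f (br x y) = 0)}"

definition rep_minus :: "('l \<Rightarrow> 'x::complex_vector \<Rightarrow> 'x) \<Rightarrow> ('l \<Rightarrow> complex) \<Rightarrow> 'l \<Rightarrow> 'x \<Rightarrow> 'x"
  where "rep_minus \<rho> f = (\<lambda>l x. \<rho> l x - f l *\<^sub>C x)"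

section \<open>The Koszul complex\<close>

text \<open>
  Fix an ordered basis \<open>e 0, \<dots>, e (n - 1)\<close> of \<open>L\<close>. Every element of \<open>X \<otimes> \<And>\<^sup>p L\<close> is uniquely
  \<open>\<Sum>\<^sub>S u S \<otimes> e\<^sub>S\<close>, where \<open>S\<close> runs through the \<open>p\<close>-element subsets of \<open>{..<n}\<close> and
  \<open>e\<^sub>S\<close> is the wedge product of the \<open>e i\<close> with \<open>i \<in> S\<close>, in increasing order. It is represented by
  the function \<open>u\<close>, extended by \<open>0\<close> to all other sets. On these functions, the product topology
  of \<open>nat set \<Rightarrow> 'x\<close> induces the topology of the finite direct sum of copies of \<open>X\<close>; they form a
  closed set, so a subset of \<open>X \<otimes> \<And>\<^sup>p L\<close> is closed there iff it is closed in \<open>nat set \<Rightarrow> 'x\<close>.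

  The homology and the closedness of ranges do not depend on the choice of the basis.
\<close>

definition lie_basis :: "nat \<Rightarrow> 'l::complex_vector"
  where "lie_basis = (SOME e. inj_on e {..<cdim TYPE('l)} \<and>
           cvec.independent (e ` {..<cdim TYPE('l)}) \<and> cvec.span (e ` {..<cdim TYPE('l)}) = UNIV)"

lemma lie_basis:
  assumes "cfinite_dim TYPE('l::complex_vector)"
  shows "inj_on (lie_basis :: nat \<Rightarrow> 'l) {..<cdim TYPE('l)}"
    and "cvec.independent ((lie_basis :: nat \<Rightarrow> 'l) ` {..<cdim TYPE('l)})"
    and "cvec.span ((lie_basis :: nat \<Rightarrow> 'l) ` {..<cdim TYPE('l)}) = UNIV"
proof -
  obtain F :: "'l set" where F: "finite F" "cvec.span F = UNIV"
    using assms unfolding cfinite_dim_def by blast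
  obtain B :: "'l set" where B: "cvec.independent B" "UNIV \<subseteq> cvec.span B" "card B = cdim TYPE('l)"
    using cvec.basis_exists[of "UNIV :: 'l set"] unfolding cdim_def by metis
  have "finite B"
    using cvec.independent_span_bound[OF F(1) B(1)] F(2) by simp
  then obtain e where "bij_betw e {..<cdim TYPE('l)} B"
    using ex_bij_betw_nat_finite B(3) by (metis atLeast0LessThan)
  then have "\<exists>e. inj_on e {..<cdim TYPE('l)} \<and>
      cvec.independent (e ` {..<cdim TYPE('l)}) \<and> cvec.span (e ` {..<cdim TYPE('l)}) = (UNIV :: 'l set)"
    using B unfolding bij_betw_def by (intro exI[of _ e]) auto
  from someI_ex[OF this, folded lie_basis_def]
  show "inj_on (lie_basis :: nat \<Rightarrow> 'l) {..<cdim TYPE('l)}"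
    and "cvec.independent ((lie_basis :: nat \<Rightarrow> 'l) ` {..<cdim TYPE('l)})"
    and "cvec.span ((lie_basis :: nat \<Rightarrow> 'l) ` {..<cdim TYPE('l)}) = UNIV"
    by blast+
qed

definition lie_coord :: "nat \<Rightarrow> 'l::complex_vector \<Rightarrow> complex"
  where "lie_coord i l =
           cvec.representation (lie_basis ` {..<cdim TYPE('l)}) l (lie_basis i)"

definition basis_list :: "nat set \<Rightarrow> 'l::complex_vector list"
  where "basis_list S = map lie_basis (sorted_list_of_set S)"

definition wedge_index :: "'l::complex_vector itself \<Rightarrow> nat \<Rightarrow> nat set set"
  where "wedge_index _ p = {S. S \<subseteq> {..<cdim TYPE('l)} \<and> card S = p}"

definition koszul_space :: "'l::complex_vector itself \<Rightarrow> nat \<Rightarrow> (nat set \<Rightarrow> 'x::complex_banach) set"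
  where "koszul_space _ p = {u. \<forall>S. S \<notin> wedge_index TYPE('l) p \<longrightarrow> u S = 0}"

text \<open>
  \<open>wedge x [l\<^sub>1, \<dots>, l\<^sub>p]\<close> is the element \<open>x \<otimes> \<langle>l\<^sub>1 \<and> \<dots> \<and> l\<^sub>p\<rangle>\<close>: the coefficient of
  \<open>l\<^sub>1 \<and> \<dots> \<and> l\<^sub>p\<close> at \<open>e\<^sub>S\<close> is the minor with rows \<open>S\<close> of the coordinate matrix of \<open>l\<^sub>1, \<dots>, l\<^sub>p\<close>.
\<close>

definition wedge :: "'x::complex_banach \<Rightarrow> 'l::complex_vector list \<Rightarrow> nat set \<Rightarrow> 'x"
  where "wedge x ls S =
    (if S \<in> wedge_index TYPE('l) (length ls)
     then (\<Sum>\<pi> | \<pi> permutes {..<length ls}.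
             of_int (sign \<pi>) *
               (\<Prod>j<length ls. lie_coord (sorted_list_of_set S ! \<pi> j) (ls ! j))) *\<^sub>C x
     else 0)"

definition omit :: "nat set \<Rightarrow> 'a list \<Rightarrow> 'a list"
  where "omit I ls = nths ls (- I)"

text \<open>
  The value of the boundary at \<open>x \<otimes> \<langle>l\<^sub>1 \<and> \<dots> \<and> l\<^sub>p\<rangle>\<close>. List positions start at \<open>0\<close>, so the signs
  \<open>(-1)\<^bsup>k+1\<^esup>\<close> and \<open>(-1)\<^bsup>i+j-1\<^esup>\<close> of the usual formula become \<open>(-1)\<^bsup>k\<^esup>\<close> and \<open>(-1)\<^bsup>i+j+1\<^esup>\<close>.
\<close>

definition koszul_formula ::
  "('l::complex_vector \<Rightarrow> 'l \<Rightarrow> 'l) \<Rightarrow> ('l \<Rightarrow> 'x::complex_banach \<Rightarrow> 'x) \<Rightarrow> 'x \<Rightarrow> 'l list \<Rightarrow> nat set \<Rightarrow> 'x"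
  where "koszul_formula br \<rho> x ls T =
    (\<Sum>k<length ls. (-1) ^ k *\<^sub>C wedge (\<rho> (ls ! k) x) (omit {k} ls) T) +
    (\<Sum>j<length ls. \<Sum>i<j.
       (-1) ^ (i + j + 1) *\<^sub>C wedge x (br (ls ! i) (ls ! j) # omit {i, j} ls) T)"

text \<open>
  The linear extension from the elements \<open>x \<otimes> e\<^sub>S\<close>. It vanishes for \<open>p = 0\<close> and, the index set
  being empty, for \<open>p > n\<close>.
\<close>

definition koszul_d ::
  "('l::complex_vector \<Rightarrow> 'l \<Rightarrow> 'l) \<Rightarrow> ('l \<Rightarrow> 'x::complex_banach \<Rightarrow> 'x) \<Rightarrow> nat \<Rightarrow>
     (nat set \<Rightarrow> 'x) \<Rightarrow> nat set \<Rightarrow> 'x"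
  where "koszul_d br \<rho> p u T =
    (\<Sum>S\<in>wedge_index TYPE('l) p. koszul_formula br \<rho> (u S) (basis_list S) T)"

definition koszul_range ::
  "('l::complex_vector \<Rightarrow> 'l \<Rightarrow> 'l) \<Rightarrow> ('l \<Rightarrow> 'x::complex_banach \<Rightarrow> 'x) \<Rightarrow> nat \<Rightarrow> (nat set \<Rightarrow> 'x) set"
  where "koszul_range br \<rho> p = koszul_d br \<rho> p ` koszul_space TYPE('l) p"

definition koszul_kernel ::
  "('l::complex_vector \<Rightarrow> 'l \<Rightarrow> 'l) \<Rightarrow> ('l \<Rightarrow> 'x::complex_banach \<Rightarrow> 'x) \<Rightarrow> nat \<Rightarrow> (nat set \<Rightarrow> 'x) set"
  where "koszul_kernel br \<rho> p = {u \<in> koszul_space TYPE('l) p. koszul_d br \<rho> p u = (\<lambda>_. 0)}"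

text \<open>The homology is the set of cosets \<open>u + R(d\<^bsub>p+1\<^esub>)\<close> with \<open>u\<close> in the kernel of \<open>d\<^sub>p\<close>;
  its zero element is the coset \<open>R(d\<^bsub>p+1\<^esub>)\<close>.\<close>

definition koszul_homology ::
  "('l::complex_vector \<Rightarrow> 'l \<Rightarrow> 'l) \<Rightarrow> ('l \<Rightarrow> 'x::complex_banach \<Rightarrow> 'x) \<Rightarrow> nat \<Rightarrow>
     (nat set \<Rightarrow> 'x) set set"
  where "koszul_homology br \<rho> p =
    (\<lambda>u. (\<lambda>v S. u S + v S) ` koszul_range br \<rho> (Suc p)) ` koszul_kernel br \<rho> p"

definition homology_nonzero ::
  "('l::complex_vector \<Rightarrow> 'l \<Rightarrow> 'l) \<Rightarrow> ('l \<Rightarrow> 'x::complex_banach \<Rightarrow> 'x) \<Rightarrow> nat \<Rightarrow> bool"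
  where "homology_nonzero br \<rho> p \<longleftrightarrow> koszul_homology br \<rho> p \<noteq> {koszul_range br \<rho> (Suc p)}"

section \<open>Joint spectra\<close>

definition sigma_p ::
  "('l::complex_vector \<Rightarrow> 'l \<Rightarrow> 'l) \<Rightarrow> ('l \<Rightarrow> 'x::complex_banach \<Rightarrow> 'x) \<Rightarrow> nat \<Rightarrow> ('l \<Rightarrow> complex) set"
  where "sigma_p br \<rho> p = {f \<in> characters br. homology_nonzero br (rep_minus \<rho> f) p}"

definition taylor_spectrum ::
  "('l::complex_vector \<Rightarrow> 'l \<Rightarrow> 'l) \<Rightarrow> ('l \<Rightarrow> 'x::complex_banach \<Rightarrow> 'x) \<Rightarrow> ('l \<Rightarrow> complex) set"
  where "taylor_spectrum br \<rho> = (\<Union>p\<in>{0..cdim TYPE('l)}. sigma_p br \<rho> p)"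

definition slodkowski_delta ::
  "('l::complex_vector \<Rightarrow> 'l \<Rightarrow> 'l) \<Rightarrow> ('l \<Rightarrow> 'x::complex_banach \<Rightarrow> 'x) \<Rightarrow> nat \<Rightarrow> ('l \<Rightarrow> complex) set"
  where "slodkowski_delta br \<rho> k = (\<Union>p\<in>{0..k}. sigma_p br \<rho> p)"

definition slodkowski_pi ::
  "('l::complex_vector \<Rightarrow> 'l \<Rightarrow> 'l) \<Rightarrow> ('l \<Rightarrow> 'x::complex_banach \<Rightarrow> 'x) \<Rightarrow> nat \<Rightarrow> ('l \<Rightarrow> complex) set"
  where "slodkowski_pi br \<rho> k =
    (\<Union>p\<in>{cdim TYPE('l) - k..cdim TYPE('l)}. sigma_p br \<rho> p) \<union>
    {f \<in> characters br. \<not> closed (koszul_range br (rep_minus \<rho> f) (cdim TYPE('l) - k))}"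

end

theory Submission
  imports Defs "Jordan_Normal_Form.Determinant" "HOL-Library.Function_Algebras"
begin

text \<open>
  Let \<open>f\<close> be a character and \<open>\<sigma> l = \<rho> l - f l\<close>. Whether \<open>f\<close> lies in the spectra is a question about the
  homology of the Koszul complex of \<open>\<sigma>\<close>, and the answer depends on whether \<open>f\<close> vanishes.

  If \<open>f = 0\<close>, the last boundary \<open>X \<otimes> L \<rightarrow> X\<close>, \<open>x \<otimes> l \<mapsto> \<rho> l x\<close>, is a finite sum of compact operators.
  Were it onto, Baire's theorem would give a compact set with interior points in \<open>X\<close>, and \<open>X\<close> would be
  finite dimensional. Hence \<open>0\<close> always belongs to \<open>\<sigma>\<^sub>0(\<rho>)\<close> (\<open>compact_bottom_homology_nonzero\<close>).

  If \<open>f l \<noteq> 0\<close>, then \<open>\<sigma> l\<close> is a compact operator minus a nonzero scalar. By Riesz theory \<open>X\<close> is the direct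
  sum of the generalised null space of \<open>\<sigma> l\<close> and a subspace on which \<open>\<sigma> l\<close> is bijective
  (\<open>fitting_decomposition\<close>). Since \<open>ad l\<close> is nilpotent, all of \<open>\<sigma> L\<close> preserves both summands. On the
  second one the Koszul complex is exact (\<open>exact_on_invertible_part\<close>): by Cartan's formula
  (\<open>boundary_ext_mult\<close>) the action \<open>\<sigma> l \<otimes> 1 + 1 \<otimes> ad l\<close> of \<open>l\<close> on \<open>X \<otimes> \<And>L\<close> is homotopic to zero, but it is
  also invertible there, as a nilpotent perturbation of an invertible operator. So every cycle is
  homologous to its projection onto the generalised null space. Repeating this for finitely many
  elements \<open>l\<close> with \<open>f l \<noteq> 0\<close> gives an operator \<open>Q\<close> that commutes with \<open>\<sigma> L\<close>, fixes all joint null vectors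
  of \<open>\<sigma> L\<close>, replaces cycles by homologous ones, and on whose range \<open>N\<close> each chosen \<open>\<sigma> l\<close> is nilpotent
  (\<open>joint_fitting_projection\<close>).

  If \<open>N = 0\<close>, the whole complex is exact and there is no joint null vector of \<open>\<sigma> L\<close>, that is, no joint
  eigenvector for \<open>f\<close>; moreover each range is then the kernel of a continuous map, hence closed.
  If \<open>N \<noteq> 0\<close>, Engel's argument, carried out along the lower central series, yields a nonzero vector of \<open>N\<close>
  killed by \<open>\<sigma> L\<close> and a proper subspace of \<open>N\<close> containing \<open>\<sigma> L N\<close>. The first is a joint eigenvector for \<open>f\<close> and
  gives a nonzero class in top degree, because the traces of the nilpotent maps \<open>ad l\<close> vanish; the
  second, pulled back along \<open>Q\<close>, gives a nonzero class in degree \<open>0\<close> (\<open>exact_or_eigenvector\<close>,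
  \<open>top_homology_nonzero\<close>). So a character \<open>f \<noteq> 0\<close> with a joint eigenvector lies in \<open>\<sigma>\<^sub>0(\<rho>)\<close> and in
  \<open>\<sigma>\<^sub>n(\<rho>)\<close>, and one without lies in none of the spectra. Either way all the spectra agree up to \<open>0\<close>.

  Computations in the Koszul complex are done with creation and annihilation operators on the
  coefficient families \<open>nat set \<Rightarrow> 'x\<close>. Cartan's formula determines the boundary on wedge products by
  recursion on the number of factors, and most identities below are inductions along it.
\<close>

section \<open>Linear maps on coefficient families\<close>

instantiation "fun" :: (type, complex_vector) complex_vector
begin
definition scaleC_fun :: "complex \<Rightarrow> ('a \<Rightarrow> 'b) \<Rightarrow> 'a \<Rightarrow> 'b"
  where "scaleC_fun a u = (\<lambda>x. a *\<^sub>C u x)"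
instance by standard (auto simp: scaleC_fun_def fun_eq_iff scaleC_add_left scaleC_add_right scaleC_scaleC scaleC_one)
end

lemma scaleC_fun_apply: "(a *\<^sub>C u) x = a *\<^sub>C u x"
  by (simp add: scaleC_fun_def)

global_interpretation clin: vector_space_pair
  "scaleC :: complex \<Rightarrow> 'a::complex_vector \<Rightarrow> 'a" "scaleC :: complex \<Rightarrow> 'b::complex_vector \<Rightarrow> 'b"
  by unfold_locales

lemma clinearI:
  assumes "\<And>x y. T (x + y) = T x + T y" and "\<And>c x. T (c *\<^sub>C x) = c *\<^sub>C T x"
  shows "clinear T"
  by (simp add: Vector_Spaces.linear_iff cvec.vector_space_axioms assms)

lemma clinear_funpow:
  fixes T :: "'v::complex_vector \<Rightarrow> 'v"
  assumes "clinear T"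
  shows "clinear (T ^^ k)"
proof (induction k)
  case 0
  show ?case unfolding funpow.simps by (rule clinearI) simp_all
next
  case (Suc k)
  then show ?case unfolding funpow.simps by (rule Vector_Spaces.linear_compose) (rule assms)
qed

lemma sum_fun_apply: "(\<Sum>a\<in>A. F a) x = (\<Sum>a\<in>A. F a x)" for F :: "'a \<Rightarrow> 'b \<Rightarrow> 'c::comm_monoid_add"
  by (induction A rule: infinite_finite_induct) simp_all

section \<open>Bounded complex-linear maps\<close>

lemma bounded_clinear_imp_bounded_linear:
  assumes "bounded_clinear T"
  shows "bounded_linear T"
proof -
  obtain K where "clinear T" "\<And>x. norm (T x) \<le> norm x * K"
    using assms unfolding bounded_clinear_def by blast
  then show ?thesis
    by (intro bounded_linear_intro[where K=K])
      (simp_all add: clin.linear_add clin.linear_scale scaleR_scaleC)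
qed

lemma bounded_clinear_scaleC: "bounded_clinear ((*\<^sub>C) a)"
  unfolding bounded_clinear_def
  by (auto simp: norm_scaleC scaleC_scaleC mult.commute cvec.scale_right_distrib intro!: clinearI exI[of _ "cmod a"])

lemma continuous_on_scaleC:
  fixes F :: "'a::topological_space \<Rightarrow> 'x::complex_banach"
  assumes "continuous_on A F"
  shows "continuous_on A (\<lambda>u. c *\<^sub>C F u)"
  by (rule bounded_linear.continuous_on[OF
        bounded_clinear_imp_bounded_linear[OF bounded_clinear_scaleC] assms])

lemmas pointwise = plus_fun_apply zero_fun_apply minus_apply uminus_apply scaleC_fun_apply sum_fun_apply

text \<open>
  Identities between operators are to be proved without descending to single coefficients, so the
  simplifier must not evaluate sums of families pointwise.
\<close>

declare plus_fun_apply [simp del] zero_fun_apply [simp del] minus_apply [simp del] uminus_apply [simp del]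

section \<open>Creation and annihilation operators on the exterior algebra\<close>

text \<open>
  The sign of moving \<open>e\<^sub>i\<close> past those factors of \<open>e\<^sub>S\<close> that precede it.
\<close>

definition wsign :: "nat \<Rightarrow> nat set \<Rightarrow> complex"
  where "wsign i S = (-1) ^ card {j \<in> S. j < i}"

text \<open>
  Exterior multiplication by \<open>e\<^sub>i\<close> from the left, in coordinates.
\<close>

definition create :: "nat \<Rightarrow> (nat set \<Rightarrow> 'x::complex_vector) \<Rightarrow> nat set \<Rightarrow> 'x"
  where "create i u S = (if i \<in> S then wsign i S *\<^sub>C u (S - {i}) else 0)"

text \<open>
  Contraction with the \<open>i\<close>-th vector of the dual basis, in coordinates.
\<close>

definition annihilate :: "nat \<Rightarrow> (nat set \<Rightarrow> 'x::complex_vector) \<Rightarrow> nat set \<Rightarrow> 'x"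
  where "annihilate i u S = (if i \<in> S then 0 else wsign i S *\<^sub>C u (insert i S))"

lemma wsign_insert: "i \<notin> S \<Longrightarrow> wsign j (insert i S) = (if i < j then - wsign j S else wsign j S)"
proof -
  assume i: "i \<notin> S"
  have "{k \<in> insert i S. k < j} = (if i < j then insert i {k \<in> S. k < j} else {k \<in> S. k < j})"
    by auto
  then show ?thesis
    using i by (simp add: wsign_def)
qed

lemma wsign_remove: "i \<in> S \<Longrightarrow> wsign j (S - {i}) = (if i < j then - wsign j S else wsign j S)"
  using wsign_insert[of i "S - {i}" j] by (auto simp: insert_absorb split: if_splits)

lemma wsign_square [simp]: "wsign i S * wsign i S = 1"
  by (simp add: wsign_def flip: power_add mult_2)

lemma clinear_create: "clinear (create i)"
  by (rule clinearI) (auto simp: create_def fun_eq_iff pointwise scaleC_add_right scaleC_scaleC mult.commute)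

lemma clinear_annihilate: "clinear (annihilate i)"
  by (rule clinearI) (auto simp: annihilate_def fun_eq_iff pointwise scaleC_add_right scaleC_scaleC mult.commute)

lemma create_create: "create i (create j u) = - create j (create i u)"
proof (rule ext)
  fix S
  have "T - {i} - {j} = T - {j} - {i}" for T by auto
  then show "create i (create j u) S = (- create j (create i u)) S"
    by (auto simp: pointwise create_def wsign_remove scaleC_scaleC mult.commute)
qed

text \<open>
  Together with \<open>create_create\<close> these are the canonical anticommutation relations, from which
  \<open>ext_mult_anticommute\<close> and \<open>annihilate_ext_mult\<close> follow by linearity.
\<close>

lemma annihilate_create:
  "annihilate i (create j u) = (if i = j then u else 0) - create j (annihilate i u)"
proof (rule ext)
  fix S
  have "i \<noteq> j \<Longrightarrow> insert i S - {j} = insert i (S - {j})" by auto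
  then show "annihilate i (create j u) S = ((if i = j then u else 0) - create j (annihilate i u)) S"
    by (auto simp: pointwise create_def annihilate_def wsign_remove wsign_insert scaleC_scaleC mult.commute insert_absorb scaleC_one)
qed

lemmas create_linear [simp] = clin.linear_0[OF clinear_create] clin.linear_add[OF clinear_create]
  clin.linear_diff[OF clinear_create] clin.linear_neg[OF clinear_create]
  clin.linear_scale[OF clinear_create] clin.linear_sum[OF clinear_create]

lemmas annihilate_linear [simp] = clin.linear_0[OF clinear_annihilate]
  clin.linear_add[OF clinear_annihilate] clin.linear_diff[OF clinear_annihilate]
  clin.linear_neg[OF clinear_annihilate] clin.linear_scale[OF clinear_annihilate]
  clin.linear_sum[OF clinear_annihilate]

section \<open>Coordinates and exterior multiplication\<close>

lemma clinear_lie_coord: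
  assumes "cfinite_dim TYPE('l::complex_vector)"
  shows "clinear (lie_coord i :: 'l \<Rightarrow> complex)"
  unfolding lie_coord_def
  by (rule clinearI)
    (use lie_basis[OF assms] in \<open>simp_all add: cvec.representation_add cvec.representation_scale scaleC_complex_def\<close>)

lemma lie_coord_basis:
  assumes "cfinite_dim TYPE('l::complex_vector)" "i < cdim TYPE('l)" "j < cdim TYPE('l)"
  shows "lie_coord i (lie_basis j :: 'l) = (if i = j then 1 else 0)"
proof -
  have "(lie_basis i :: 'l) = lie_basis j \<longleftrightarrow> i = j"
    using inj_onD[OF lie_basis(1)[OF assms(1)]] assms(2,3) by blast
  then show ?thesis
    using assms(3) lie_basis(2)[OF assms(1)] by (auto simp: lie_coord_def cvec.representation_basis)
qed

lemma lie_basis_expansion: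
  assumes "cfinite_dim TYPE('l::complex_vector)"
  shows "(\<Sum>i<cdim TYPE('l). lie_coord i l *\<^sub>C lie_basis i) = (l :: 'l)"
proof -
  have "(\<Sum>i<cdim TYPE('l). lie_coord i l *\<^sub>C lie_basis i)
      = (\<Sum>b\<in>lie_basis ` {..<cdim TYPE('l)}.
          cvec.representation (lie_basis ` {..<cdim TYPE('l)}) l b *\<^sub>C b)"
    by (simp add: lie_coord_def sum.reindex[OF lie_basis(1)[OF assms]])
  also have "\<dots> = l"
    using lie_basis[OF assms] by (intro cvec.sum_representation_eq) auto
  finally show ?thesis .
qed

definition ext_mult :: "'l::complex_vector \<Rightarrow> (nat set \<Rightarrow> 'x::complex_vector) \<Rightarrow> nat set \<Rightarrow> 'x"
  where "ext_mult l u = (\<Sum>i<cdim TYPE('l). lie_coord i l *\<^sub>C create i u)"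

lemma clinear_ext_mult: "clinear (ext_mult l)"
  by (rule clinearI)
    (simp_all add: ext_mult_def scaleC_add_right sum.distrib scaleC_scaleC mult.commute cvec.scale_sum_right)

lemmas ext_mult_linear [simp] = clin.linear_0[OF clinear_ext_mult]
  clin.linear_add[OF clinear_ext_mult] clin.linear_diff[OF clinear_ext_mult]
  clin.linear_neg[OF clinear_ext_mult] clin.linear_scale[OF clinear_ext_mult]
  clin.linear_sum[OF clinear_ext_mult]

lemma clinear_ext_mult_left:
  assumes "cfinite_dim TYPE('l::complex_vector)"
  shows "clinear (\<lambda>l :: 'l. ext_mult l u)"
  by (rule clinearI)
    (simp_all add: ext_mult_def clin.linear_add[OF clinear_lie_coord[OF assms]]
      clin.linear_scale[OF clinear_lie_coord[OF assms]] scaleC_complex_def scaleC_add_left sum.distrib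
      scaleC_scaleC cvec.scale_sum_right)

lemma ext_mult_anticommute: "ext_mult (l :: 'a::complex_vector) (ext_mult (m :: 'a) u) = - ext_mult m (ext_mult l u)"
proof -
  have "ext_mult l (ext_mult m u)
      = (\<Sum>i<cdim TYPE('a). \<Sum>j<cdim TYPE('a). (lie_coord i l * lie_coord j m) *\<^sub>C create i (create j u))"
    by (simp add: ext_mult_def cvec.scale_sum_right scaleC_scaleC)
  also have "\<dots> = - (\<Sum>i<cdim TYPE('a). \<Sum>j<cdim TYPE('a). (lie_coord i l * lie_coord j m) *\<^sub>C create j (create i u))"
    unfolding sum_negf[symmetric] by (intro sum.cong refl) (subst create_create, simp)
  also have "\<dots> = - ext_mult m (ext_mult l u)"
    by (subst sum.swap) (simp add: ext_mult_def cvec.scale_sum_right scaleC_scaleC mult.commute)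
  finally show ?thesis .
qed

lemma annihilate_ext_mult:
  assumes "i < cdim TYPE('l::complex_vector)"
  shows "annihilate i (ext_mult (l :: 'l) u) = lie_coord i l *\<^sub>C u - ext_mult l (annihilate i u)"
proof -
  have "annihilate i (ext_mult l u)
     = (\<Sum>j<cdim TYPE('l). (if i = j then lie_coord j l *\<^sub>C u else 0) - lie_coord j l *\<^sub>C create j (annihilate i u))"
    by (auto simp: ext_mult_def annihilate_create cvec.scale_right_diff_distrib intro!: sum.cong)
  also have "\<dots> = lie_coord i l *\<^sub>C u - ext_mult l (annihilate i u)"
    using assms by (simp add: sum_subtractf ext_mult_def)
  finally show ?thesis .
qed

definition coeffwise :: "('x \<Rightarrow> 'x) \<Rightarrow> (nat set \<Rightarrow> 'x) \<Rightarrow> nat set \<Rightarrow> 'x"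
  where "coeffwise T u = (\<lambda>S. T (u S))"

lemma coeffwise_apply: "coeffwise T u S = T (u S)"
  by (simp add: coeffwise_def)

lemma clinear_coeffwise: "clinear T \<Longrightarrow> clinear (coeffwise T)"
  by (rule clinearI) (simp_all add: fun_eq_iff pointwise coeffwise_apply clin.linear_add clin.linear_scale)

lemma coeffwise_create: "clinear T \<Longrightarrow> coeffwise T (create i u) = create i (coeffwise T u)"
  by (simp add: fun_eq_iff coeffwise_apply create_def clin.linear_scale clin.linear_0)

lemma coeffwise_annihilate:
  "clinear T \<Longrightarrow> coeffwise T (annihilate i u) = annihilate i (coeffwise T u)"
  by (simp add: fun_eq_iff coeffwise_apply annihilate_def clin.linear_scale clin.linear_0)

lemma coeffwise_ext_mult: "clinear T \<Longrightarrow> coeffwise T (ext_mult l u) = ext_mult l (coeffwise T u)"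
  by (simp add: ext_mult_def clin.linear_sum[OF clinear_coeffwise]
      clin.linear_scale[OF clinear_coeffwise] coeffwise_create)

section \<open>The action of the Lie algebra and the boundary\<close>

locale finite_lie_algebra = lie_algebra br for br :: "'l::complex_vector \<Rightarrow> 'l \<Rightarrow> 'l" +
  assumes finite_dim: "cfinite_dim TYPE('l)"
begin

lemmas br_simps = clin.linear_0[OF br_linear_left] clin.linear_0[OF br_linear_right]
  clin.linear_add[OF br_linear_left] clin.linear_add[OF br_linear_right]
  clin.linear_diff[OF br_linear_left] clin.linear_diff[OF br_linear_right]
  clin.linear_scale[OF br_linear_left] clin.linear_scale[OF br_linear_right]
  clin.linear_neg[OF br_linear_left] clin.linear_neg[OF br_linear_right]

lemma br_skew: "br x y = - br y x"
proof -
  have "br (x + y) (x + y) = 0" by (rule br_self)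
  then have "br x y + br y x = 0" by (simp only: br_simps) (simp add: br_self add.commute)
  then show ?thesis by (simp add: eq_neg_iff_add_eq_0)
qed

lemma br_br: "br (br l m) k = br l (br m k) - br m (br l k)"
proof -
  have "br l (br m k) + br m (br k l) = - br k (br l m)"
    using jacobi[of l m k] by (simp add: eq_neg_iff_add_eq_0)
  moreover have "br m (br k l) = - br m (br l k)"
    by (subst br_skew[of k l]) (simp add: br_simps)
  moreover have "br (br l m) k = - br k (br l m)"
    by (rule br_skew)
  ultimately show ?thesis by simp
qed

lemmas ext_left = clin.linear_0[OF clinear_ext_mult_left[OF finite_dim]]
   clin.linear_add[OF clinear_ext_mult_left[OF finite_dim]]
   clin.linear_diff[OF clinear_ext_mult_left[OF finite_dim]]
   clin.linear_scale[OF clinear_ext_mult_left[OF finite_dim]]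
   clin.linear_sum[OF clinear_ext_mult_left[OF finite_dim]]

text \<open>
  The derivation of \<open>\<And>L\<close> that extends \<open>ad l\<close>: each \<open>e\<^sub>j\<close> is removed and replaced by \<open>[l, e\<^sub>j]\<close>.
\<close>

definition ad_wedge :: "'l \<Rightarrow> (nat set \<Rightarrow> 'x::complex_vector) \<Rightarrow> nat set \<Rightarrow> 'x"
  where "ad_wedge l u = (\<Sum>j<cdim TYPE('l). ext_mult (br l (lie_basis j)) (annihilate j u))"

lemma clinear_ad_wedge: "clinear (ad_wedge l)"
  by (rule clinearI) (simp_all add: ad_wedge_def sum.distrib cvec.scale_sum_right)

lemmas ad_wedge_linear [simp] = clin.linear_0[OF clinear_ad_wedge]
  clin.linear_add[OF clinear_ad_wedge] clin.linear_diff[OF clinear_ad_wedge]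
  clin.linear_neg[OF clinear_ad_wedge] clin.linear_scale[OF clinear_ad_wedge]
  clin.linear_sum[OF clinear_ad_wedge]

lemma br_expansion: "(\<Sum>j<cdim TYPE('l). lie_coord j m *\<^sub>C br l (lie_basis j)) = br l m"
proof -
  have "br l m = br l (\<Sum>j<cdim TYPE('l). lie_coord j m *\<^sub>C lie_basis j)"
    by (simp add: lie_basis_expansion finite_dim)
  then show ?thesis
    by (simp add: clin.linear_sum[OF br_linear_right] br_simps)
qed

text \<open>
  The derivation rule. Moving \<open>annihilate j\<close> past \<open>ext_mult m\<close> leaves the \<open>j\<close>-th coordinate of \<open>m\<close>, and
  these coordinates assemble \<open>[l, m]\<close>.
\<close>

lemma ad_wedge_ext_mult:
  "ad_wedge l (ext_mult m u) = ext_mult (br l m) u + ext_mult m (ad_wedge l u)"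
proof -
  have "ad_wedge l (ext_mult m u)
    = (\<Sum>j<cdim TYPE('l). lie_coord j m *\<^sub>C ext_mult (br l (lie_basis j)) u
         + ext_mult m (ext_mult (br l (lie_basis j)) (annihilate j u)))"
    unfolding ad_wedge_def
    by (intro sum.cong refl, simp add: annihilate_ext_mult, subst ext_mult_anticommute, simp)
  also have "\<dots> = ext_mult (\<Sum>j<cdim TYPE('l). lie_coord j m *\<^sub>C br l (lie_basis j)) u + ext_mult m (ad_wedge l u)"
    by (simp add: sum.distrib ad_wedge_def ext_left)
  finally show ?thesis by (simp add: br_expansion)
qed

lemma coeffwise_ad_wedge: "clinear T \<Longrightarrow> coeffwise T (ad_wedge l u) = ad_wedge l (coeffwise T u)"
  by (simp add: ad_wedge_def clin.linear_sum[OF clinear_coeffwise] coeffwise_ext_mult coeffwise_annihilate)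

end

locale finite_lie_representation = lie_representation br \<rho> + finite_lie_algebra br
  for br :: "'l::complex_vector \<Rightarrow> 'l \<Rightarrow> 'l" and \<rho> :: "'l \<Rightarrow> 'x::complex_banach \<Rightarrow> 'x"
begin

lemma clinear_rep: "clinear (\<rho> l)"
  using rep_bounded unfolding bounded_clinear_def by blast

lemmas rep_simps = clin.linear_0[OF clinear_rep] clin.linear_add[OF clinear_rep]
  clin.linear_diff[OF clinear_rep] clin.linear_neg[OF clinear_rep]
  clin.linear_scale[OF clinear_rep] clin.linear_sum[OF clinear_rep]

lemmas coeffwise_rep [simp] = clin.linear_0[OF clinear_coeffwise[OF clinear_rep]]
  clin.linear_add[OF clinear_coeffwise[OF clinear_rep]]
  clin.linear_diff[OF clinear_coeffwise[OF clinear_rep]]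
  clin.linear_neg[OF clinear_coeffwise[OF clinear_rep]]
  clin.linear_scale[OF clinear_coeffwise[OF clinear_rep]]
  clin.linear_sum[OF clinear_coeffwise[OF clinear_rep]]

lemma clinear_rep_left: "clinear (\<lambda>l. \<rho> l x)"
  by (rule clinearI) (simp_all add: rep_add rep_scale)

text \<open>
  The Lie derivative, that is, the action of \<open>l\<close> on the tensor product of \<open>X\<close> with \<open>\<And>L\<close>.
\<close>

definition act :: "'l \<Rightarrow> (nat set \<Rightarrow> 'x) \<Rightarrow> nat set \<Rightarrow> 'x"
  where "act l u = coeffwise (\<rho> l) u + ad_wedge l u"

lemma clinear_act: "clinear (act l)"
  by (rule clinearI) (simp_all add: act_def algebra_simps cvec.scale_right_distrib)

lemmas act_linear [simp] = clin.linear_0[OF clinear_act]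
  clin.linear_add[OF clinear_act] clin.linear_diff[OF clinear_act]
  clin.linear_neg[OF clinear_act] clin.linear_scale[OF clinear_act]
  clin.linear_sum[OF clinear_act]

text \<open>
  The Koszul boundary in all degrees at once. The double sum runs over ordered pairs, so each bracket
  occurs twice with the same value, whence the factor \<open>1 / 2\<close>.
\<close>

definition boundary :: "(nat set \<Rightarrow> 'x) \<Rightarrow> nat set \<Rightarrow> 'x"
  where "boundary u = (\<Sum>i<cdim TYPE('l). coeffwise (\<rho> (lie_basis i)) (annihilate i u)) +
    (1 / 2) *\<^sub>C (\<Sum>i<cdim TYPE('l). \<Sum>j<cdim TYPE('l).
       ext_mult (br (lie_basis i) (lie_basis j)) (annihilate j (annihilate i u)))"

lemma clinear_boundary: "clinear boundary"
  by (rule clinearI)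
    (simp_all add: boundary_def sum.distrib cvec.scale_sum_right algebra_simps cvec.scale_right_distrib)

lemmas boundary_linear [simp] = clin.linear_0[OF clinear_boundary]
  clin.linear_add[OF clinear_boundary] clin.linear_diff[OF clinear_boundary]
  clin.linear_neg[OF clinear_boundary] clin.linear_scale[OF clinear_boundary]
  clin.linear_sum[OF clinear_boundary]

lemma act_ext_mult: "act l (ext_mult m u) = ext_mult (br l m) u + ext_mult m (act l u)"
  by (simp add: act_def ad_wedge_ext_mult coeffwise_ext_mult clinear_rep)

text \<open>
  Cartan's formula: exterior multiplication by \<open>l\<close> is a homotopy from the action of \<open>l\<close> to zero. In the
  quadratic part each of the two annihilation operators meets \<open>ext_mult l\<close> once and produces
  \<open>ad_wedge l\<close>, which the factor \<open>1 / 2\<close> reduces to a single copy.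
\<close>

lemma boundary_ext_mult: "boundary (ext_mult (l :: 'l) u) = act l u - ext_mult l (boundary u)"
proof -
  let ?e = "lie_basis :: nat \<Rightarrow> 'l"
  have 1: "(\<Sum>i<cdim TYPE('l). coeffwise (\<rho> (?e i)) (annihilate i (ext_mult l u)))
      = coeffwise (\<rho> l) u - ext_mult l (\<Sum>i<cdim TYPE('l). coeffwise (\<rho> (?e i)) (annihilate i u))"
  proof -
    have "(\<Sum>i<cdim TYPE('l). coeffwise (\<rho> (?e i)) (annihilate i (ext_mult l u)))
      = (\<Sum>i<cdim TYPE('l). lie_coord i l *\<^sub>C coeffwise (\<rho> (?e i)) u)
        - ext_mult l (\<Sum>i<cdim TYPE('l). coeffwise (\<rho> (?e i)) (annihilate i u))"
      by (simp add: annihilate_ext_mult coeffwise_ext_mult clinear_rep sum_subtractf)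
    also have "(\<Sum>i<cdim TYPE('l). lie_coord i l *\<^sub>C coeffwise (\<rho> (?e i)) u)
        = coeffwise (\<rho> (\<Sum>i<cdim TYPE('l). lie_coord i l *\<^sub>C ?e i)) u"
      by (simp add: fun_eq_iff pointwise coeffwise_apply clin.linear_sum[OF clinear_rep_left] rep_scale)
    finally show ?thesis unfolding lie_basis_expansion[OF finite_dim] .
  qed
  have 2: "ext_mult (br (?e i) (?e j)) (annihilate j (annihilate i (ext_mult l u)))
      = lie_coord i l *\<^sub>C ext_mult (br (?e i) (?e j)) (annihilate j u)
      + lie_coord j l *\<^sub>C ext_mult (br (?e j) (?e i)) (annihilate i u)
      - ext_mult l (ext_mult (br (?e i) (?e j)) (annihilate j (annihilate i u)))"
    if "i < cdim TYPE('l)" "j < cdim TYPE('l)" for i j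
  proof -
    have "ext_mult (br (?e j) (?e i)) (annihilate i u) = - ext_mult (br (?e i) (?e j)) (annihilate i u)"
      by (subst br_skew) (simp add: clin.linear_neg[OF clinear_ext_mult_left[OF finite_dim]])
    then show ?thesis
      using that by (simp add: annihilate_ext_mult ext_mult_anticommute[of "br (?e i) (?e j)" l])
  qed
  have 3: "(\<Sum>i<cdim TYPE('l). \<Sum>j<cdim TYPE('l). lie_coord i l *\<^sub>C ext_mult (br (?e i) (?e j)) (annihilate j u)) = ad_wedge l u"
  proof -
    have "(\<Sum>i<cdim TYPE('l). lie_coord i l *\<^sub>C br (?e i) (?e j)) = br l (?e j)" for j
    proof -
      have "br l (?e j) = br (\<Sum>i<cdim TYPE('l). lie_coord i l *\<^sub>C ?e i) (?e j)"
        by (simp add: lie_basis_expansion finite_dim)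
      then show ?thesis by (simp add: clin.linear_sum[OF br_linear_left] br_simps)
    qed
    moreover have "(\<Sum>i<cdim TYPE('l). \<Sum>j<cdim TYPE('l). lie_coord i l *\<^sub>C ext_mult (br (?e i) (?e j)) (annihilate j u))
       = (\<Sum>j<cdim TYPE('l). ext_mult (\<Sum>i<cdim TYPE('l). lie_coord i l *\<^sub>C br (?e i) (?e j)) (annihilate j u))"
      by (subst sum.swap) (simp add: ext_left)
    ultimately show ?thesis by (simp add: ad_wedge_def)
  qed
  have "(\<Sum>i<cdim TYPE('l). \<Sum>j<cdim TYPE('l). ext_mult (br (?e i) (?e j)) (annihilate j (annihilate i (ext_mult l u))))
      = ad_wedge l u + (\<Sum>i<cdim TYPE('l). \<Sum>j<cdim TYPE('l). lie_coord j l *\<^sub>C ext_mult (br (?e j) (?e i)) (annihilate i u))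
        - ext_mult l (\<Sum>i<cdim TYPE('l). \<Sum>j<cdim TYPE('l). ext_mult (br (?e i) (?e j)) (annihilate j (annihilate i u)))"
    by (simp add: 2 sum.distrib sum_subtractf 3)
  also have "(\<Sum>i<cdim TYPE('l). \<Sum>j<cdim TYPE('l). lie_coord j l *\<^sub>C ext_mult (br (?e j) (?e i)) (annihilate i u)) = ad_wedge l u" (is "?X = _")
    by (subst sum.swap) (rule 3)
  finally have "(1 / 2) *\<^sub>C (\<Sum>i<cdim TYPE('l). \<Sum>j<cdim TYPE('l). ext_mult (br (?e i) (?e j)) (annihilate j (annihilate i (ext_mult l u))))
      = (1 / 2) *\<^sub>C (ad_wedge l u + ad_wedge l u) - ext_mult l ((1 / 2) *\<^sub>C (\<Sum>i<cdim TYPE('l). \<Sum>j<cdim TYPE('l). ext_mult (br (?e i) (?e j)) (annihilate j (annihilate i u))))"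
    by (simp only: cvec.scale_right_diff_distrib ext_mult_linear)
  moreover have "(1 / 2 :: complex) *\<^sub>C (v + v) = v" for v :: "nat set \<Rightarrow> 'x"
    by (simp add: scaleC_add_right scaleC_one flip: scaleC_add_left)
  ultimately have 4: "(1 / 2) *\<^sub>C (\<Sum>i<cdim TYPE('l). \<Sum>j<cdim TYPE('l). ext_mult (br (?e i) (?e j)) (annihilate j (annihilate i (ext_mult l u))))
      = ad_wedge l u - ext_mult l ((1 / 2) *\<^sub>C (\<Sum>i<cdim TYPE('l). \<Sum>j<cdim TYPE('l). ext_mult (br (?e i) (?e j)) (annihilate j (annihilate i u))))"
    by metis
  show ?thesis
    unfolding boundary_def 1 4 act_def by (simp add: algebra_simps)
qed

end

section \<open>Wedge products as iterated exterior multiplication\<close>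

definition single :: "nat set \<Rightarrow> 'x::zero \<Rightarrow> nat set \<Rightarrow> 'x"
  where "single S x = (\<lambda>T. if T = S then x else 0)"

lemma sorted_list_of_set_nth_less_iff:
  fixes S :: "nat set"
  assumes "finite S" "j < card S" "k < card S"
  shows "sorted_list_of_set S ! j < sorted_list_of_set S ! k \<longleftrightarrow> j < k"
proof -
  have s: "sorted_wrt (<) (sorted_list_of_set S)" "length (sorted_list_of_set S) = card S"
    by simp_all
  show ?thesis
    using sorted_wrt_nth_less[OF s(1)] s(2) assms by (metis linorder_neqE_nat order_less_asym order_less_irrefl)
qed

lemma bij_betw_sorted_list_of_set:
  fixes S :: "nat set"
  assumes "finite S"
  shows "bij_betw (\<lambda>k. sorted_list_of_set S ! k) {..<card S} S"
  using bij_betw_nth[of "sorted_list_of_set S" "{..<card S}" S] assms by simp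

lemma wsign_sorted_list:
  assumes "finite S" "k < card S"
  shows "wsign (sorted_list_of_set S ! k) S = (-1) ^ k"
proof -
  let ?s = "\<lambda>k. sorted_list_of_set S ! k"
  have "{j \<in> S. j < ?s k} = ?s ` {..<k}"
  proof (intro equalityI subsetI)
    fix j assume j: "j \<in> {j \<in> S. j < ?s k}"
    then obtain i where "i < card S" "j = ?s i"
      using bij_betw_imp_surj_on[OF bij_betw_sorted_list_of_set[OF assms(1)]] by blast
    then show "j \<in> ?s ` {..<k}"
      using j sorted_list_of_set_nth_less_iff[OF assms(1) _ assms(2)] by auto
  next
    fix j assume "j \<in> ?s ` {..<k}"
    then show "j \<in> {j \<in> S. j < ?s k}"
      using assms sorted_list_of_set_nth_less_iff[OF assms(1) _ assms(2)]
        bij_betw_apply[OF bij_betw_sorted_list_of_set[OF assms(1)]] by auto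
  qed
  moreover have "inj_on ?s {..<k}"
    using bij_betw_sorted_list_of_set[OF assms(1)] assms(2)
    by (auto simp: bij_betw_def intro: inj_on_subset)
  ultimately show ?thesis
    by (simp add: wsign_def card_image)
qed

lemma sorted_list_of_set_remove_nth:
  fixes S :: "nat set"
  assumes "finite S" "k < card S" "j < card S - 1"
  shows "sorted_list_of_set (S - {sorted_list_of_set S ! k}) ! j
       = sorted_list_of_set S ! (if j < k then j else Suc j)"
proof -
  let ?s = "sorted_list_of_set S"
  let ?r = "take k ?s @ drop (Suc k) ?s"
  have d: "?s = take k ?s @ ?s ! k # drop (Suc k) ?s"
    using assms by (simp add: id_take_nth_drop)
  have ss: "sorted_wrt (<) (take k ?s @ ?s ! k # drop (Suc k) ?s)"
    unfolding d[symmetric] by simp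
  have dd: "distinct (take k ?s @ ?s ! k # drop (Suc k) ?s)"
    unfolding d[symmetric] by simp
  have "sorted_wrt (<) ?r"
    using ss by (simp add: sorted_wrt_append)
  moreover have "set ?r = S - {?s ! k}"
  proof -
    have "set ?s = insert (?s ! k) (set ?r)"
      by (subst d) (simp only: set_append list.set, blast)
    moreover have "?s ! k \<notin> set ?r"
      using dd by auto
    ultimately show ?thesis using assms(1) by auto
  qed
  ultimately have "sorted_list_of_set (S - {?s ! k}) = ?r"
    by (metis sorted_list_of_set.idem_if_sorted_distinct strict_sorted_iff)
  then show ?thesis
    using assms by (auto simp: nth_append min_def)
qed

text \<open>
  Recognising the coefficients of a wedge product as determinants makes Laplace expansion available.
\<close>

lemma wedge_coefficient_det:
  "(\<Sum>\<pi> | \<pi> permutes {..<length ls}. of_int (sign \<pi>) *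
      (\<Prod>j<length ls. lie_coord (sorted_list_of_set S ! \<pi> j) (ls ! j)))
   = Determinant.det (Matrix.mat (length ls) (length ls)
      (\<lambda>(i, j). lie_coord (sorted_list_of_set S ! j) (ls ! i)))"
proof -
  have "(\<Prod>j<length ls. lie_coord (sorted_list_of_set S ! \<pi> j) (ls ! j))
     = (\<Prod>i = 0..<length ls. Matrix.mat (length ls) (length ls)
      (\<lambda>(i, j). lie_coord (sorted_list_of_set S ! j) (ls ! i)) $$ (i, \<pi> i))"
    if "\<pi> permutes {..<length ls}" for \<pi>
  proof (rule prod.cong)
    show "lie_coord (sorted_list_of_set S ! \<pi> i) (ls ! i) = Matrix.mat (length ls) (length ls)
      (\<lambda>(i, j). lie_coord (sorted_list_of_set S ! j) (ls ! i)) $$ (i, \<pi> i)"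
      if "i \<in> {0..<length ls}" for i
      using that permutes_in_image[OF \<open>\<pi> permutes {..<length ls}\<close>, of i] by simp
  qed auto
  then show ?thesis
    unfolding Determinant.det_def by (auto simp: atLeast0LessThan intro!: sum.cong)
qed

lemma wedge_outside: "S \<notin> wedge_index TYPE('l) (length ls) \<Longrightarrow> wedge x (ls :: 'l::complex_vector list) S = 0"
  by (simp add: wedge_def)

lemma wedge_Nil: "wedge x ([] :: 'l::complex_vector list) = single {} x"
proof (rule ext)
  fix S :: "nat set"
  have "S \<in> wedge_index TYPE('l) 0 \<longleftrightarrow> S = {}"
    using finite_subset[of S] by (auto simp: wedge_index_def card_eq_0_iff)
  then show "wedge x ([] :: 'l list) S = single {} x S"
    by (simp add: wedge_def single_def scaleC_one)
qed

lemma wedge_index_remove: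
  assumes "i \<in> S" "i < cdim TYPE('l::complex_vector)"
  shows "S - {i} \<in> wedge_index TYPE('l) p \<longleftrightarrow> S \<in> wedge_index TYPE('l) (Suc p)"
proof (cases "finite S")
  case True
  then show ?thesis
    using assms card_Suc_Diff1[OF True assms(1)] by (auto simp: wedge_index_def)
next
  case False
  then have "\<not> S \<subseteq> {..<cdim TYPE('l)}" "\<not> S - {i} \<subseteq> {..<cdim TYPE('l)}"
    using finite_subset[of S "{..<cdim TYPE('l)}"] finite_subset[of "S - {i}" "{..<cdim TYPE('l)}"] by auto
  then show ?thesis by (auto simp: wedge_index_def)
qed

text \<open>
  Laplace expansion along the row of \<open>l\<close>: its signs are those of the creation operators.
\<close>

lemma wedge_Cons: "wedge x (l # ls) = ext_mult l (wedge x (ls :: 'l::complex_vector list))"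
proof (rule ext)
  fix S :: "nat set"
  let ?p = "length ls"
  let ?n = "cdim TYPE('l)"
  let ?s = "sorted_list_of_set S"
  have R: "ext_mult l (wedge x ls) S
      = (\<Sum>i<?n. if i \<in> S then (lie_coord i l * wsign i S) *\<^sub>C wedge x ls (S - {i}) else 0)"
    by (auto simp: ext_mult_def pointwise create_def scaleC_scaleC intro!: sum.cong)
  show "wedge x (l # ls) S = ext_mult l (wedge x ls) S"
  proof (cases "S \<in> wedge_index TYPE('l) (Suc ?p)")
    case False
    have "wedge x ls (S - {i}) = 0" if "i < ?n" "i \<in> S" for i
      using that False by (intro wedge_outside) (simp add: wedge_index_remove)
    then show ?thesis
      using wedge_outside[of S "l # ls" x] False unfolding R by (simp cong: if_cong)
  next
    case True
    then have S: "S \<subseteq> {..<?n}" "card S = Suc ?p" "finite S"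
      using finite_subset[of S "{..<?n}"] by (auto simp: wedge_index_def)
    let ?A = "\<lambda>ls S. Matrix.mat (length ls) (length ls)
      (\<lambda>(i, j). lie_coord (sorted_list_of_set S ! j) ((ls :: 'l list) ! i))"
    have index: "S - {?s ! k} \<in> wedge_index TYPE('l) ?p" if "k < Suc ?p" for k
      using S that bij_betw_apply[OF bij_betw_sorted_list_of_set[OF S(3)]]
      by (auto simp: wedge_index_def)
    have minor: "mat_delete (?A (l # ls) S) 0 k = ?A ls (S - {?s ! k})" if "k < Suc ?p" for k
      using that S sorted_list_of_set_remove_nth[OF S(3)]
      by (intro eq_matI) (auto simp: mat_delete_def)
    have W: "wedge x ls (S - {?s ! k}) = Determinant.det (?A ls (S - {?s ! k})) *\<^sub>C x"
      if "k < Suc ?p" for k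
      unfolding wedge_def wedge_coefficient_det if_P[OF index[OF that]] ..
    have "wedge x (l # ls) S = Determinant.det (?A (l # ls) S) *\<^sub>C x"
      using True unfolding wedge_def wedge_coefficient_det by simp
    also have "Determinant.det (?A (l # ls) S)
      = (\<Sum>k<Suc ?p. ?A (l # ls) S $$ (0, k) * cofactor (?A (l # ls) S) 0 k)"
      by (rule laplace_expansion_row) auto
    also have "\<dots> = (\<Sum>k<Suc ?p. lie_coord (?s ! k) l * wsign (?s ! k) S * Determinant.det (?A ls (S - {?s ! k})))"
    proof (intro sum.cong refl)
      fix k assume "k \<in> {..<Suc ?p}"
      then have k: "k < Suc ?p" by simp
      have "?A (l # ls) S $$ (0, k) = lie_coord (?s ! k) l" using k by simp
      moreover have "cofactor (?A (l # ls) S) 0 k = wsign (?s ! k) S * Determinant.det (?A ls (S - {?s ! k}))"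
        unfolding cofactor_def minor[OF k] using k S by (simp only: wsign_sorted_list add_0)
      ultimately show "?A (l # ls) S $$ (0, k) * cofactor (?A (l # ls) S) 0 k
          = lie_coord (?s ! k) l * wsign (?s ! k) S * Determinant.det (?A ls (S - {?s ! k}))"
        by (simp only: mult.assoc)
    qed
    also have "\<dots> *\<^sub>C x = (\<Sum>k<Suc ?p. (lie_coord (?s ! k) l * wsign (?s ! k) S) *\<^sub>C wedge x ls (S - {?s ! k}))"
      unfolding cvec.scale_sum_left
      by (intro sum.cong refl) (simp only: W scaleC_scaleC lessThan_iff)
    also have "\<dots> = (\<Sum>i\<in>S. (lie_coord i l * wsign i S) *\<^sub>C wedge x ls (S - {i}))"
      using sum.reindex_bij_betw[OF bij_betw_sorted_list_of_set[OF S(3)],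
          of "\<lambda>i. (lie_coord i l * wsign i S) *\<^sub>C wedge x ls (S - {i})"] S(2) by simp
    also have "\<dots> = ext_mult l (wedge x ls) S"
      unfolding R using S(1) by (intro sum.mono_neutral_cong_left) auto
    finally show ?thesis .
  qed
qed

lemma clinear_wedge: "clinear (\<lambda>x. wedge x ls)"
proof (induction ls)
  case Nil
  show ?case by (rule clinearI) (auto simp: wedge_Nil single_def pointwise coeffwise_apply fun_eq_iff)
next
  case (Cons l ls)
  show ?case
    by (rule clinearI) (simp_all only: wedge_Cons clin.linear_add[OF Cons] clin.linear_scale[OF Cons] ext_mult_linear)
qed

lemmas wedge_zero [simp] = clin.linear_0[OF clinear_wedge]

lemma coeffwise_wedge:
  assumes "clinear T"
  shows "coeffwise T (wedge x ls) = wedge (T x) ls"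
proof (induction ls)
  case Nil
  show ?case
    by (auto simp: wedge_Nil single_def pointwise coeffwise_apply fun_eq_iff clin.linear_0[OF assms])
qed (simp only: wedge_Cons coeffwise_ext_mult[OF assms])

lemma ext_mult_basis:
  assumes "cfinite_dim TYPE('l::complex_vector)" "i < cdim TYPE('l)"
  shows "ext_mult (lie_basis i :: 'l) u = create i u"
proof -
  have "ext_mult (lie_basis i :: 'l) u = (\<Sum>j<cdim TYPE('l). if j = i then create j u else 0)"
    unfolding ext_mult_def using assms
    by (intro sum.cong) (auto simp: lie_coord_basis scaleC_one)
  then show ?thesis using assms(2) by simp
qed

lemma create_single: "i \<notin> S \<Longrightarrow> create i (single S x) = single (insert i S) (wsign i S *\<^sub>C x)"
  using wsign_remove[of i "insert i S" i]
  by (auto simp: create_def single_def pointwise coeffwise_apply fun_eq_iff)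

lemma wedge_basis_list_single:
  assumes "cfinite_dim TYPE('l::complex_vector)" "S \<subseteq> {..<cdim TYPE('l)}"
  shows "wedge x (basis_list S :: 'l list) = single S x"
proof -
  have "sorted_wrt (<) is \<Longrightarrow> set is \<subseteq> {..<cdim TYPE('l)} \<Longrightarrow>
     wedge x (map lie_basis is :: 'l list) = single (set is) x" for "is"
  proof (induction "is")
    case (Cons i "is")
    have "{j \<in> set is. j < i} = {}" using Cons.prems(1) by auto
    then have "wsign i (set is) = 1" by (simp only: wsign_def card.empty power_0)
    moreover have "i \<notin> set is" using Cons.prems(1) by auto
    ultimately show ?case
      using Cons assms(1) by (simp add: wedge_Cons ext_mult_basis create_single scaleC_one)
  qed (simp add: wedge_Nil)
  moreover have "finite S" using assms(2) finite_subset by blast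
  ultimately show ?thesis
    using assms(2) by (simp add: basis_list_def)
qed

lemma finite_wedge_index: "finite (wedge_index TYPE('l::complex_vector) p)"
  unfolding wedge_index_def by (rule finite_subset[of _ "Pow {..<cdim TYPE('l)}"]) auto

lemma koszul_space_expansion:
  assumes "cfinite_dim TYPE('l::complex_vector)" "u \<in> koszul_space TYPE('l) p"
  shows "u = (\<Sum>S\<in>wedge_index TYPE('l) p. wedge (u S) (basis_list S :: 'l list))"
proof
  fix T
  have "wedge (u S) (basis_list S :: 'l list) = single S (u S)" if "S \<in> wedge_index TYPE('l) p" for S
    using that assms(1) by (intro wedge_basis_list_single) (auto simp: wedge_index_def)
  then have "(\<Sum>S\<in>wedge_index TYPE('l) p. wedge (u S) (basis_list S :: 'l list)) T
     = (\<Sum>S\<in>wedge_index TYPE('l) p. if T = S then u S else 0)"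
    by (simp add: pointwise single_def)
  also have "\<dots> = u T"
    using assms(2) finite_wedge_index[where 'l='l] by (auto simp: koszul_space_def)
  finally show "u T = (\<Sum>S\<in>wedge_index TYPE('l) p. wedge (u S) (basis_list S :: 'l list)) T" by simp
qed

lemma koszul_space_linear:
  "0 \<in> koszul_space TYPE('l::complex_vector) p"
  "u \<in> koszul_space TYPE('l) p \<Longrightarrow> v \<in> koszul_space TYPE('l) p \<Longrightarrow> u + v \<in> koszul_space TYPE('l) p"
  "u \<in> koszul_space TYPE('l) p \<Longrightarrow> v \<in> koszul_space TYPE('l) p \<Longrightarrow> u - v \<in> koszul_space TYPE('l) p"
  "u \<in> koszul_space TYPE('l) p \<Longrightarrow> c *\<^sub>C u \<in> koszul_space TYPE('l) p"
  by (simp_all add: pointwise koszul_space_def)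

lemma subspace_koszul_space: "cvec.subspace (koszul_space TYPE('l::complex_vector) p)"
  by (rule cvec.subspaceI) (simp_all add: koszul_space_linear)

lemma koszul_space_sum:
  "(\<And>a. a \<in> A \<Longrightarrow> F a \<in> koszul_space TYPE('l::complex_vector) p) \<Longrightarrow> sum F A \<in> koszul_space TYPE('l) p"
  by (induction A rule: infinite_finite_induct) (auto simp: koszul_space_linear)

lemma create_koszul_space:
  assumes "u \<in> koszul_space TYPE('l::complex_vector) p" "i < cdim TYPE('l)"
  shows "create i u \<in> koszul_space TYPE('l) (Suc p)"
  unfolding koszul_space_def
proof (intro CollectI allI impI)
  fix S assume S: "S \<notin> wedge_index TYPE('l) (Suc p)"
  have "S - {i} \<notin> wedge_index TYPE('l) p" if "i \<in> S"
    using S that assms(2) by (simp add: wedge_index_remove)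
  then show "create i u S = 0"
    using assms(1) by (simp add: create_def koszul_space_def)
qed

lemma annihilate_koszul_space:
  assumes "u \<in> koszul_space TYPE('l::complex_vector) (Suc p)"
  shows "annihilate i u \<in> koszul_space TYPE('l) p"
  unfolding koszul_space_def
proof (intro CollectI allI impI)
  fix S assume S: "S \<notin> wedge_index TYPE('l) p"
  have "insert i S \<notin> wedge_index TYPE('l) (Suc p)" if "i \<notin> S"
    using S that finite_subset[of S "{..<cdim TYPE('l)}"]
    by (auto simp: wedge_index_def)
  then show "annihilate i u S = 0"
    using assms(1) by (simp add: annihilate_def pointwise koszul_space_def)
qed

lemma annihilate_koszul_space_0:
  assumes "u \<in> koszul_space TYPE('l::complex_vector) 0"
  shows "annihilate i u = 0"
proof
  fix S
  have "insert i S \<notin> wedge_index TYPE('l) 0"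
    using finite_subset[of "insert i S" "{..<cdim TYPE('l)}"]
    by (auto simp: wedge_index_def card_eq_0_iff)
  then show "annihilate i u S = 0 S"
    using assms by (simp add: annihilate_def pointwise koszul_space_def)
qed

lemma ext_mult_koszul_space:
  "u \<in> koszul_space TYPE('l::complex_vector) p \<Longrightarrow> ext_mult (l :: 'l) u \<in> koszul_space TYPE('l) (Suc p)"
  unfolding ext_mult_def by (intro koszul_space_sum koszul_space_linear create_koszul_space) auto

lemma coeffwise_koszul_space:
  "u \<in> koszul_space TYPE('l::complex_vector) p \<Longrightarrow> T 0 = 0 \<Longrightarrow> coeffwise T u \<in> koszul_space TYPE('l) p"
  by (simp add: pointwise coeffwise_apply koszul_space_def)

lemma wedge_koszul_space: "wedge x ls \<in> koszul_space TYPE('l::complex_vector) (length (ls :: 'l list))"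
  by (simp add: koszul_space_def wedge_outside)

section \<open>The Koszul complex in terms of the boundary operator\<close>

lemma omit_Cons [simp]:
  "omit {0} (l # ls) = ls"
  "omit {Suc k} (l # ls) = l # omit {k} ls"
  "omit {0, Suc j} (l # ls) = omit {j} ls"
  "omit {Suc i, Suc j} (l # ls) = l # omit {i, j} ls"
proof -
  have "{j. j \<noteq> k} = - {k}" for k :: nat by auto
  moreover have "{k. k \<noteq> i \<and> k \<noteq> j} = - {i, j}" for i j :: nat by auto
  moreover have "{j :: nat. True} = UNIV" by auto
  ultimately show "omit {0} (l # ls) = ls" "omit {Suc k} (l # ls) = l # omit {k} ls"
    "omit {0, Suc j} (l # ls) = omit {j} ls" "omit {Suc i, Suc j} (l # ls) = l # omit {i, j} ls"
    by (simp_all add: omit_def nths_Cons nths_all)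
qed

context finite_lie_algebra
begin

lemma ad_wedge_wedge_Nil [simp]: "ad_wedge l (wedge x ([] :: 'l list)) = 0"
  using annihilate_koszul_space_0[OF wedge_koszul_space[of x "[] :: 'l list", simplified]]
  by (simp add: ad_wedge_def)

text \<open>
  The brackets of the Koszul formula in which a fixed element \<open>l\<close> takes part add up to the derivation
  \<open>ad_wedge l\<close>; the sign comes from moving \<open>[l, l\<^sub>j]\<close> to the front.
\<close>

lemma ad_wedge_wedge:
  "ad_wedge l (wedge x ls) = (\<Sum>j<length ls. (-1) ^ j *\<^sub>C wedge x (br l (ls ! j) # omit {j} ls))"
proof (induction ls)
  case (Cons m ls)
  have "wedge x (br l (ls ! j) # m # ks) = - ext_mult m (wedge x (br l (ls ! j) # ks))" for j ks
    by (simp only: wedge_Cons ext_mult_anticommute[of "br l (ls ! j)" m])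
  then have *: "(\<Sum>j<length (m # ls). (-1) ^ j *\<^sub>C wedge x (br l ((m # ls) ! j) # omit {j} (m # ls)))
     = wedge x (br l m # ls) + ext_mult m (\<Sum>j<length ls. (-1) ^ j *\<^sub>C wedge x (br l (ls ! j) # omit {j} ls))"
    by (simp add: sum.lessThan_Suc_shift scaleC_one del: sum.lessThan_Suc)
  have "ad_wedge l (wedge x (m # ls)) = wedge x (br l m # ls)
      + ext_mult m (\<Sum>j<length ls. (-1) ^ j *\<^sub>C wedge x (br l (ls ! j) # omit {j} ls))"
    by (simp only: wedge_Cons[of x m ls] ad_wedge_ext_mult Cons.IH wedge_Cons[of x "br l m" ls])
  then show ?case
    using * by simp
qed simp

lemma ad_wedge_koszul_space:
  assumes "u \<in> koszul_space TYPE('l) p"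
  shows "ad_wedge l u \<in> koszul_space TYPE('l) p"
proof (cases p)
  case 0
  then show ?thesis
    using annihilate_koszul_space_0[of u, where 'l='l] assms by (simp add: ad_wedge_def koszul_space_linear)
next
  case (Suc q)
  then show ?thesis
    unfolding ad_wedge_def using assms
    by (auto intro!: koszul_space_sum ext_mult_koszul_space annihilate_koszul_space)
qed

text \<open>
  By the derivation rule every application of \<open>ad_wedge l\<close> goes to \<open>m\<close> or to \<open>w\<close>, and among \<open>a + b\<close>
  applications at least \<open>a\<close> go to \<open>m\<close> or at least \<open>b\<close> go to \<open>w\<close>.
\<close>

lemma ad_wedge_nilpotent_ext_mult:
  fixes w :: "nat set \<Rightarrow> 'x::complex_vector"
  shows "(br l ^^ a) m = 0 \<Longrightarrow> (ad_wedge l ^^ b) w = 0 \<Longrightarrow> (ad_wedge l ^^ (a + b)) (ext_mult m w) = 0"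
proof (induction "a + b" arbitrary: a b m w)
  case 0
  then show ?case by simp
next
  case (Suc c)
  have zero: "(ad_wedge l ^^ k) (0 :: nat set \<Rightarrow> 'x) = 0" for k
    by (induction k) simp_all
  have add: "(ad_wedge l ^^ k) (v + w) = (ad_wedge l ^^ k) v + (ad_wedge l ^^ k) w"
    for k and v w :: "nat set \<Rightarrow> 'x"
    by (induction k) simp_all
  have "a = 0 \<Longrightarrow> ext_mult m w = 0" "b = 0 \<Longrightarrow> ext_mult m w = 0"
    using Suc.prems by (simp_all add: ext_left)
  moreover have "(ad_wedge l ^^ (a + b)) (ext_mult m w) = 0" if "a = Suc a'" "b = Suc b'" for a' b'
  proof -
    have 1: "(ad_wedge l ^^ c) (ext_mult (br l m) w) = 0"
      using Suc.hyps(1)[of a' b "br l m" w] Suc.hyps(2) Suc.prems that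
      by (simp add: funpow_swap1)
    have 2: "(ad_wedge l ^^ c) (ext_mult m (ad_wedge l w)) = 0"
      using Suc.hyps(1)[of a b' m "ad_wedge l w"] Suc.hyps(2) Suc.prems that
      by (simp add: funpow_swap1)
    have "(ad_wedge l ^^ (a + b)) (ext_mult m w) = (ad_wedge l ^^ c) (ad_wedge l (ext_mult m w))"
      unfolding Suc.hyps(2)[symmetric] by (simp only: funpow_Suc_right o_apply)
    then show ?thesis
      by (simp add: ad_wedge_ext_mult add 1 2)
  qed
  ultimately show ?case
    using zero by (metis not0_implies_Suc)
qed

text \<open>
  Each of the \<open>p\<close> factors absorbs fewer than \<open>c\<close> applications; the additional one annihilates elements
  of degree \<open>0\<close>.
\<close>

lemma ad_wedge_nilpotent:
  fixes u :: "nat set \<Rightarrow> 'x::complex_banach"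
  assumes "\<And>m. (br l ^^ c) m = 0" and "u \<in> koszul_space TYPE('l) p"
  shows "(ad_wedge l ^^ (c * p + 1)) u = 0"
proof -
  have *: "(ad_wedge l ^^ (c * length ls + 1)) (wedge x ls) = 0" for x :: 'x and ls :: "'l list"
  proof (induction ls)
    case (Cons m ls)
    then show ?case
      using ad_wedge_nilpotent_ext_mult[OF assms(1) Cons.IH] by (simp add: wedge_Cons add.assoc)
  qed simp
  have len: "length (basis_list S :: 'l list) = p" if "S \<in> wedge_index TYPE('l) p" for S
    using that by (auto simp: basis_list_def wedge_index_def)
  show ?thesis
    by (subst koszul_space_expansion[OF finite_dim assms(2)], subst clin.linear_sum[OF clinear_funpow[OF clinear_ad_wedge]])
      (use * len in \<open>auto intro!: sum.neutral\<close>)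
qed

end

lemma sum_triangle_shift:
  "(\<Sum>j<Suc n. \<Sum>i<j. F i j) = (\<Sum>j<n. F 0 (Suc j) + (\<Sum>i<j. F (Suc i) (Suc j)))"
  for F :: "nat \<Rightarrow> nat \<Rightarrow> 'a::comm_monoid_add"
  by (subst sum.lessThan_Suc_shift) (simp add: sum.lessThan_Suc_shift del: sum.lessThan_Suc)

context finite_lie_representation
begin

lemma boundary_koszul_space_0: "u \<in> koszul_space TYPE('l) 0 \<Longrightarrow> boundary u = 0"
  by (simp add: boundary_def annihilate_koszul_space_0)

lemma boundary_koszul_space:
  assumes "u \<in> koszul_space TYPE('l) (Suc p)"
  shows "boundary u \<in> koszul_space TYPE('l) p"
proof -
  have "ext_mult m (annihilate j (annihilate i u)) \<in> koszul_space TYPE('l) p" for m :: 'l and i j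
  proof (cases p)
    case 0
    then show ?thesis
      using annihilate_koszul_space_0[OF annihilate_koszul_space[OF assms, unfolded 0]]
      by (simp add: koszul_space_linear)
  next
    case (Suc q)
    then show ?thesis
      using assms by (auto intro!: ext_mult_koszul_space annihilate_koszul_space)
  qed
  then show ?thesis
    unfolding boundary_def using assms
    by (intro koszul_space_linear koszul_space_sum coeffwise_koszul_space annihilate_koszul_space)
      (auto simp: rep_simps)
qed

lemma boundary_wedge_Nil [simp]: "boundary (wedge x ([] :: 'l list)) = 0"
  using wedge_koszul_space[of x "[] :: 'l list"] by (simp add: boundary_koszul_space_0)

lemma act_wedge_Nil [simp]: "act l (wedge x ([] :: 'l list)) = wedge (\<rho> l x) ([] :: 'l list)"
  unfolding act_def by (simp only: coeffwise_wedge[OF clinear_rep] ad_wedge_wedge_Nil add_0_right)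

text \<open>
  Both sides obey the same commutation rule with \<open>ext_mult\<close>, by the Jacobi identity, so the claim
  reduces to degree \<open>0\<close>, where it is the homomorphism property of the representation.
\<close>

lemma act_bracket_wedge:
  "act (br l m) (wedge x ls) = act l (act m (wedge x ls)) - act m (act l (wedge x (ls :: 'l list)))"
proof (induction ls)
  case Nil
  show ?case
    by (simp add: rep_br clin.linear_diff[OF clinear_wedge])
next
  case (Cons k ls)
  then show ?case
    by (simp add: wedge_Cons act_ext_mult br_br[of l m k] ext_left)
qed

text \<open>
  By Cartan's formula the commutator of \<open>act l\<close> with \<open>boundary\<close> anticommutes with every \<open>ext_mult k\<close>; as it
  vanishes in degree \<open>0\<close>, it vanishes.
\<close>

lemma act_boundary_wedge: "act l (boundary (wedge x ls)) = boundary (act l (wedge x (ls :: 'l list)))"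
proof (induction ls)
  case (Cons k ls)
  then show ?case
    by (simp add: wedge_Cons act_ext_mult boundary_ext_mult act_bracket_wedge)
qed simp

text \<open>
  By Cartan's formula and \<open>act_boundary_wedge\<close> the square of the boundary commutes with every
  \<open>ext_mult k\<close>, and it vanishes in degree \<open>0\<close>.
\<close>

lemma boundary_boundary_wedge: "boundary (boundary (wedge x (ls :: 'l list))) = 0"
proof (induction ls)
  case (Cons k ls)
  then show ?case
    by (simp add: wedge_Cons boundary_ext_mult act_boundary_wedge)
qed simp

lemma act_boundary: "u \<in> koszul_space TYPE('l) p \<Longrightarrow> act l (boundary u) = boundary (act l u)"
  by (subst (1 2) koszul_space_expansion[OF finite_dim], assumption+) (simp add: act_boundary_wedge)

lemma boundary_boundary: "u \<in> koszul_space TYPE('l) p \<Longrightarrow> boundary (boundary u) = 0"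
  by (subst koszul_space_expansion[OF finite_dim], assumption) (simp add: boundary_boundary_wedge)

text \<open>
  Splitting off the first factor \<open>l\<close>, the terms in which \<open>l\<close> is applied or bracketed add up to \<open>act l\<close>, and
  the others to \<open>- ext_mult l\<close> of the formula for the remaining factors. This is the recursion that
  Cartan's formula prescribes for the boundary.
\<close>

lemma koszul_formula_eq_boundary: "koszul_formula br \<rho> x ls = boundary (wedge x ls)"
proof (induction ls)
  case Nil
  show ?case by (simp add: fun_eq_iff pointwise koszul_formula_def)
next
  case (Cons l ls)
  let ?f = "\<lambda>ls. \<Sum>k<length ls. (-1) ^ k *\<^sub>C wedge (\<rho> (ls ! k) x) (omit {k} ls)"
  let ?g = "\<lambda>ls. \<Sum>j<length ls. \<Sum>i<j. (-1) ^ (i + j + 1) *\<^sub>C wedge x (br (ls ! i) (ls ! j) # omit {i, j} ls)"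
  have formula: "koszul_formula br \<rho> x ls = ?f ls + ?g ls" for ls
    by (simp add: fun_eq_iff pointwise koszul_formula_def)
  have f: "?f (l # ls) = wedge (\<rho> l x) ls - ext_mult l (?f ls)"
    by (simp add: sum.lessThan_Suc_shift scaleC_one wedge_Cons sum_negf del: sum.lessThan_Suc)
  have swap: "wedge x (br (ls ! i) (ls ! j) # l # ks) = - ext_mult l (wedge x (br (ls ! i) (ls ! j) # ks))" for i j ks
    by (simp only: wedge_Cons ext_mult_anticommute[of "br (ls ! i) (ls ! j)" l])
  let ?G = "\<lambda>i j. (-1) ^ (i + j + 1) *\<^sub>C wedge x (br ((l # ls) ! i) ((l # ls) ! j) # omit {i, j} (l # ls))"
  have shift: "?g (l # ls) = (\<Sum>j<length ls. ?G 0 (Suc j) + (\<Sum>i<j. ?G (Suc i) (Suc j)))"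
    unfolding length_Cons by (rule sum_triangle_shift)
  have g: "?g (l # ls) = ad_wedge l (wedge x ls) - ext_mult l (?g ls)"
    unfolding shift by (simp add: swap ad_wedge_wedge sum.distrib sum_negf)
  have "koszul_formula br \<rho> x (l # ls) = ?f (l # ls) + ?g (l # ls)"
    by (rule formula)
  also have "\<dots> = (wedge (\<rho> l x) ls - ext_mult l (?f ls)) + (ad_wedge l (wedge x ls) - ext_mult l (?g ls))"
    by (simp only: f g)
  also have "\<dots> = act l (wedge x ls) - ext_mult l (?f ls + ?g ls)"
    unfolding act_def coeffwise_wedge[OF clinear_rep] ext_mult_linear by (simp only: algebra_simps)
  also have "?f ls + ?g ls = boundary (wedge x ls)"
    by (simp only: Cons.IH[symmetric] formula)
  finally show ?case
    by (simp only: wedge_Cons boundary_ext_mult)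
qed

lemma koszul_d_eq_boundary:
  assumes "u \<in> koszul_space TYPE('l) p"
  shows "koszul_d br \<rho> p u = boundary u"
proof -
  have "koszul_d br \<rho> p u = boundary (\<Sum>S\<in>wedge_index TYPE('l) p. wedge (u S) (basis_list S :: 'l list))"
    by (simp add: fun_eq_iff pointwise koszul_d_def koszul_formula_eq_boundary)
  then show ?thesis
    by (simp flip: koszul_space_expansion[OF finite_dim assms])
qed

lemma koszul_range_eq: "koszul_range br \<rho> p = boundary ` koszul_space TYPE('l) p"
  unfolding koszul_range_def by (rule image_cong) (simp_all add: koszul_d_eq_boundary)

lemma koszul_kernel_eq: "koszul_kernel br \<rho> p = {u \<in> koszul_space TYPE('l) p. boundary u = 0}"
  unfolding koszul_kernel_def by (auto simp: koszul_d_eq_boundary zero_fun_def)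

lemma homology_nonzero_iff:
  "homology_nonzero br \<rho> p \<longleftrightarrow>
    (\<exists>u\<in>koszul_space TYPE('l) p. boundary u = 0 \<and> u \<notin> boundary ` koszul_space TYPE('l) (Suc p))"
proof -
  let ?R = "boundary ` koszul_space TYPE('l) (Suc p)"
  let ?K = "{u \<in> koszul_space TYPE('l) p. boundary u = 0}"
  have R: "0 \<in> ?R" "\<And>u v. u \<in> ?R \<Longrightarrow> v \<in> ?R \<Longrightarrow> u + v \<in> ?R" "\<And>u v. u \<in> ?R \<Longrightarrow> v \<in> ?R \<Longrightarrow> u - v \<in> ?R"
    using clin.linear_subspace_image[OF clinear_boundary subspace_koszul_space[where 'l='l and p="Suc p"]]
    by (simp_all only: cvec.subspace_0 cvec.subspace_add cvec.subspace_diff)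
  have eq: "koszul_homology br \<rho> p = (\<lambda>u. (\<lambda>v. u + v) ` ?R) ` ?K"
    unfolding koszul_homology_def koszul_range_eq koszul_kernel_eq plus_fun_def by simp
  have coset: "(\<lambda>v. u + v) ` ?R = ?R \<longleftrightarrow> u \<in> ?R" for u
  proof
    assume "(\<lambda>v. u + v) ` ?R = ?R"
    then show "u \<in> ?R" using R(1) by (metis add.right_neutral imageI)
  next
    assume u: "u \<in> ?R"
    show "(\<lambda>v. u + v) ` ?R = ?R"
    proof (intro equalityI subsetI)
      fix w assume "w \<in> ?R"
      then have "w - u \<in> ?R" "w = u + (w - u)" using R(3) u by auto
      then show "w \<in> (\<lambda>v. u + v) ` ?R" by blast
    next
      fix w assume "w \<in> (\<lambda>v. u + v) ` ?R"
      then obtain v where "v \<in> ?R" "w = u + v" by (rule imageE)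
      then show "w \<in> ?R" using R(2)[OF u] by simp
    qed
  qed
  have "0 \<in> ?K" by (simp add: koszul_space_linear)
  have singleton: "g ` A = {r} \<longleftrightarrow> (\<forall>u\<in>A. g u = r)" if "a \<in> A"
    for g :: "(nat set \<Rightarrow> 'x) \<Rightarrow> (nat set \<Rightarrow> 'x) set" and A a r
    using that by blast
  have "homology_nonzero br \<rho> p \<longleftrightarrow> \<not> (\<forall>u\<in>?K. u \<in> ?R)"
    unfolding homology_nonzero_def eq koszul_range_eq singleton[OF \<open>0 \<in> ?K\<close>] coset ..
  then show ?thesis by (simp add: Bex_def)
qed

end

section \<open>Invertible summands, top and bottom degree\<close>

text \<open>
  If \<open>v\<close> is in the kernel of \<open>S + A\<close>, so is \<open>A v\<close>, and \<open>A v\<close> is killed by a smaller power of \<open>A\<close>.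
\<close>

lemma nilpotent_perturbation_injective:
  fixes S A :: "'v::complex_vector \<Rightarrow> 'v"
  assumes "clinear S" "clinear A" and G: "\<And>v. v \<in> G \<Longrightarrow> A v \<in> G"
    and commute: "\<And>v. v \<in> G \<Longrightarrow> S (A v) = A (S v)"
    and inj: "\<And>v. v \<in> G \<Longrightarrow> S v = 0 \<Longrightarrow> v = 0"
  shows "v \<in> G \<Longrightarrow> S v + A v = 0 \<Longrightarrow> (A ^^ k) v = 0 \<Longrightarrow> v = 0"
proof (induction k arbitrary: v)
  case (Suc k)
  have "S (A v) + A (A v) = A (S v + A v)"
    using commute[OF Suc.prems(1)] by (simp add: clin.linear_add[OF assms(2)])
  then have "A v = 0"
    using Suc.IH[of "A v"] Suc.prems G
    by (simp add: funpow_swap1 clin.linear_0[OF assms(2)])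
  then show ?case
    using inj Suc.prems by simp
qed simp

text \<open>
  A solution \<open>v\<close> of \<open>S v = u\<close> leaves the error \<open>- A v\<close>, which is killed by a smaller power of \<open>A\<close> than \<open>u\<close>;
  so the correction terms come to an end.
\<close>

lemma nilpotent_perturbation_surjective:
  fixes S A :: "'v::complex_vector \<Rightarrow> 'v"
  assumes "clinear S" "clinear A" and "cvec.subspace G" and G: "\<And>v. v \<in> G \<Longrightarrow> A v \<in> G"
    and commute: "\<And>v. v \<in> G \<Longrightarrow> S (A v) = A (S v)"
    and inj: "\<And>v. v \<in> G \<Longrightarrow> S v = 0 \<Longrightarrow> v = 0"
    and surj: "\<And>u. u \<in> G \<Longrightarrow> \<exists>v\<in>G. S v = u"
  shows "u \<in> G \<Longrightarrow> (A ^^ k) u = 0 \<Longrightarrow> \<exists>v\<in>G. S v + A v = u"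
proof (induction k arbitrary: u)
  case 0
  then show ?case
    using cvec.subspace_0[OF assms(3)]
    by (intro bexI[of _ 0]) (simp_all add: clin.linear_0[OF assms(1)] clin.linear_0[OF assms(2)])
next
  case (Suc k)
  obtain v where v: "v \<in> G" "S v = u" using surj Suc.prems(1) by blast
  have G_pow: "(A ^^ j) v \<in> G" for j
    by (induction j) (simp_all add: v G)
  have "S ((A ^^ j) v) = (A ^^ j) u" for j
  proof (induction j)
    case (Suc j)
    then show ?case using commute[OF G_pow[of j]] by simp
  qed (simp add: v)
  then have "(A ^^ Suc k) v = 0"
    using inj[OF G_pow] Suc.prems(2) by metis
  then have "(A ^^ k) (- A v) = 0"
    by (simp add: clin.linear_neg[OF clinear_funpow[OF assms(2)]] funpow_swap1)
  moreover have "- A v \<in> G"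
    using assms(3) G v by (simp add: cvec.subspace_neg)
  ultimately obtain w where w: "w \<in> G" "S w + A w = - A v"
    using Suc.IH by blast
  then have "S (v + w) + A (v + w) = u"
    using v by (simp add: clin.linear_add[OF assms(1)] clin.linear_add[OF assms(2)] algebra_simps)
  then show ?case
    using v w cvec.subspace_add[OF assms(3)] by blast
qed

definition valued_in :: "'x set \<Rightarrow> (nat set \<Rightarrow> 'x) set"
  where "valued_in V = {u. \<forall>S. u S \<in> V}"

lemma subspace_valued_in: "cvec.subspace V \<Longrightarrow> cvec.subspace (valued_in V)"
  by (auto simp: cvec.subspace_def valued_in_def pointwise)

lemma create_valued_in: "cvec.subspace V \<Longrightarrow> u \<in> valued_in V \<Longrightarrow> create i u \<in> valued_in V"
  by (auto simp: valued_in_def create_def cvec.subspace_scale cvec.subspace_0)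

lemma annihilate_valued_in: "cvec.subspace V \<Longrightarrow> u \<in> valued_in V \<Longrightarrow> annihilate i u \<in> valued_in V"
  by (auto simp: valued_in_def annihilate_def cvec.subspace_scale cvec.subspace_0)

lemma ext_mult_valued_in: "cvec.subspace V \<Longrightarrow> u \<in> valued_in V \<Longrightarrow> ext_mult l u \<in> valued_in V"
  unfolding ext_mult_def
  by (intro cvec.subspace_sum cvec.subspace_scale create_valued_in subspace_valued_in)

lemma (in finite_lie_algebra) ad_wedge_valued_in:
  "cvec.subspace V \<Longrightarrow> u \<in> valued_in V \<Longrightarrow> ad_wedge l u \<in> valued_in V"
  unfolding ad_wedge_def
  by (intro cvec.subspace_sum ext_mult_valued_in annihilate_valued_in subspace_valued_in)

context finite_lie_representation
begin

lemma boundary_valued_in: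
  assumes "cvec.subspace V" "\<And>m x. x \<in> V \<Longrightarrow> \<rho> m x \<in> V" "u \<in> valued_in V"
  shows "boundary u \<in> valued_in V"
proof -
  have "coeffwise (\<rho> m) v \<in> valued_in V" if "v \<in> valued_in V" for m v
    using that assms(2) by (simp add: valued_in_def coeffwise_apply)
  then show ?thesis
    unfolding boundary_def using assms
    by (intro cvec.subspace_add cvec.subspace_sum cvec.subspace_scale ext_mult_valued_in
        annihilate_valued_in subspace_valued_in) (auto intro: annihilate_valued_in)
qed

text \<open>
  On cycles and chains with values in \<open>V\<close>, the action of \<open>l\<close> is the invertible operator \<open>\<rho> l\<close> perturbed by the
  nilpotent derivation \<open>ad_wedge l\<close>, hence bijective. Write a cycle as \<open>u = act l v\<close>. Then \<open>act l\<close> kills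
  \<open>boundary v\<close>, so \<open>v\<close> is a cycle too, and Cartan's formula says that \<open>u\<close> is the boundary of
  \<open>ext_mult l v\<close>.
\<close>

lemma exact_on_invertible_part:
  assumes V: "cvec.subspace V" "\<And>m x. x \<in> V \<Longrightarrow> \<rho> m x \<in> V"
    and inj: "\<And>x. x \<in> V \<Longrightarrow> \<rho> l x = 0 \<Longrightarrow> x = 0"
    and surj: "\<And>y. y \<in> V \<Longrightarrow> \<exists>x\<in>V. \<rho> l x = y"
    and nilpotent: "\<And>m. (br l ^^ c) m = 0"
    and u: "u \<in> koszul_space TYPE('l) p" "u \<in> valued_in V" "boundary u = 0"
  shows "u \<in> boundary ` koszul_space TYPE('l) (Suc p)"
proof -
  define G where "G q = koszul_space TYPE('l) q \<inter> valued_in V" for q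
  have G: "cvec.subspace (G q)" for q
    unfolding G_def by (intro cvec.subspace_inter subspace_koszul_space subspace_valued_in V)
  have ad_G: "ad_wedge l v \<in> G q" if "v \<in> G q" for v q
    using that V by (simp add: G_def ad_wedge_koszul_space ad_wedge_valued_in)
  have comm: "coeffwise (\<rho> l) (ad_wedge l v) = ad_wedge l (coeffwise (\<rho> l) v)" for v
    by (rule coeffwise_ad_wedge[OF clinear_rep])
  have injG: "v = 0" if "v \<in> G q" "coeffwise (\<rho> l) v = 0" for v q
  proof
    fix S
    have "\<rho> l (v S) = 0" using fun_cong[OF that(2), of S] by (simp add: coeffwise_apply pointwise)
    then show "v S = 0 S" using that(1) inj by (simp add: G_def valued_in_def pointwise)
  qed
  have surjG: "\<exists>v\<in>G q. coeffwise (\<rho> l) v = w" if w: "w \<in> G q" for w q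
  proof -
    obtain g where g: "\<And>y. y \<in> V \<Longrightarrow> g y \<in> V \<and> \<rho> l (g y) = y"
      using surj by metis
    have "g 0 = 0" using g[of 0] inj cvec.subspace_0[OF V(1)] by blast
    then have "coeffwise g w \<in> G q" "coeffwise (\<rho> l) (coeffwise g w) = w"
      using w g by (auto simp: G_def valued_in_def coeffwise_apply koszul_space_def fun_eq_iff)
    then show ?thesis by blast
  qed
  have "u \<in> G p" using u by (simp add: G_def)
  then have "\<exists>v\<in>G p. coeffwise (\<rho> l) v + ad_wedge l v = u"
    using ad_wedge_nilpotent[OF nilpotent u(1)]
    by (rule nilpotent_perturbation_surjective[OF clinear_coeffwise[OF clinear_rep] clinear_ad_wedge G, rotated 4])
      (rule comm | erule ad_G surjG | erule (1) injG)+
  then obtain v where v: "v \<in> G p" "act l v = u"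
    unfolding act_def by blast
  have vK: "v \<in> koszul_space TYPE('l) p" using v(1) by (simp add: G_def)
  have "boundary v = 0"
  proof (cases p)
    case 0
    then show ?thesis using vK by (simp add: boundary_koszul_space_0)
  next
    case (Suc q)
    have "boundary v \<in> koszul_space TYPE('l) q"
      using vK Suc by (simp add: boundary_koszul_space)
    moreover have "boundary v \<in> valued_in V"
      using boundary_valued_in[OF V] v(1) by (simp add: G_def)
    moreover have "act l (boundary v) = 0"
      using act_boundary[OF vK] v(2) u(3) by simp
    ultimately have "boundary v \<in> G q" "coeffwise (\<rho> l) (boundary v) + ad_wedge l (boundary v) = 0"
      by (auto simp: G_def act_def)
    then show ?thesis
      using ad_wedge_nilpotent[OF nilpotent \<open>boundary v \<in> koszul_space TYPE('l) q\<close>]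
      by (rule nilpotent_perturbation_injective[OF clinear_coeffwise[OF clinear_rep] clinear_ad_wedge, rotated 3])
        (rule comm | erule ad_G | erule (1) injG)+
  qed
  then have "u = boundary (ext_mult l v)"
    by (simp add: boundary_ext_mult v)
  moreover have "ext_mult l v \<in> koszul_space TYPE('l) (Suc p)"
    using vK by (rule ext_mult_koszul_space)
  ultimately show ?thesis by blast
qed

lemma koszul_space_above: "u \<in> koszul_space TYPE('l) (Suc (cdim TYPE('l))) \<Longrightarrow> u = 0"
proof
  fix S assume u: "u \<in> koszul_space TYPE('l) (Suc (cdim TYPE('l)))"
  have "S \<notin> wedge_index TYPE('l) (Suc (cdim TYPE('l)))"
    using card_mono[of "{..<cdim TYPE('l)}" S] by (auto simp: wedge_index_def)
  then show "u S = 0 S" using u by (simp add: koszul_space_def pointwise)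
qed

text \<open>
  On the top exterior power a derivation acts as its trace.
\<close>

lemma ad_wedge_top:
  "ad_wedge l (single {..<cdim TYPE('l)} x)
    = (\<Sum>j<cdim TYPE('l). lie_coord j (br l (lie_basis j))) *\<^sub>C single {..<cdim TYPE('l)} x"
  for x :: 'x
proof
  fix S
  let ?N = "{..<cdim TYPE('l)}"
  let ?u = "single ?N x"
  have K: "?u \<in> koszul_space TYPE('l) (cdim TYPE('l))"
    by (auto simp: koszul_space_def single_def wedge_index_def)
  show "ad_wedge l ?u S = ((\<Sum>j<cdim TYPE('l). lie_coord j (br l (lie_basis j))) *\<^sub>C ?u) S"
  proof (cases "S = ?N")
    case False
    have "S \<notin> wedge_index TYPE('l) (cdim TYPE('l))"
      using False card_subset_eq[of ?N S] by (auto simp: wedge_index_def)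
    then show ?thesis
      using False ad_wedge_koszul_space[OF K, of l] by (simp add: koszul_space_def single_def pointwise)
  next
    case True
    have "create i (annihilate j ?u) ?N = (if i = j then x else 0)" if "i \<in> ?N" "j \<in> ?N" for i j
      using that wsign_remove[of i ?N i]
      by (auto simp: create_def annihilate_def single_def scaleC_scaleC scaleC_one insert_absorb)
    then have "ext_mult (br l (lie_basis j)) (annihilate j ?u) ?N
        = (\<Sum>i<cdim TYPE('l). if i = j then lie_coord i (br l (lie_basis j)) *\<^sub>C x else 0)"
      if "j \<in> ?N" for j
      unfolding ext_mult_def pointwise using that by (intro sum.cong) auto
    then have "ad_wedge l ?u ?N = (\<Sum>j<cdim TYPE('l). lie_coord j (br l (lie_basis j)) *\<^sub>C x)"
      by (simp add: ad_wedge_def pointwise)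
    then show ?thesis
      using True by (simp add: cvec.scale_sum_left pointwise single_def)
  qed
qed

text \<open>
  The traces of the nilpotent maps \<open>ad l\<close> vanish, so every \<open>l\<close> acts as zero on \<open>x \<otimes> e\<^sub>0 \<and> \<dots> \<and> e\<^bsub>n-1\<^esub>\<close>. By
  Cartan's formula the boundary of this element is then killed by every \<open>ext_mult l\<close>, and in degree
  \<open>n - 1\<close> only zero is. There are no nonzero chains in degree \<open>n + 1\<close> whose boundary it could be.
\<close>

lemma top_homology_nonzero:
  assumes nilpotent: "\<And>l m. (br l ^^ c) m = 0" and x: "x \<noteq> 0" "\<And>l. \<rho> l x = 0"
  shows "homology_nonzero br \<rho> (cdim TYPE('l))"
proof -
  let ?n = "cdim TYPE('l)"
  let ?u = "single {..<?n} x"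
  have K: "?u \<in> koszul_space TYPE('l) ?n"
    by (auto simp: koszul_space_def single_def wedge_index_def)
  have u: "?u \<noteq> 0"
    using x(1) by (auto simp: fun_eq_iff single_def pointwise)
  have ad: "ad_wedge l ?u = 0" for l
  proof -
    let ?a = "\<Sum>j<?n. lie_coord j (br l (lie_basis j))"
    have pow: "(ad_wedge l ^^ k) ?u = ?a ^ k *\<^sub>C ?u" for k
      by (induction k) (simp_all add: scaleC_one ad_wedge_top scaleC_scaleC mult.commute)
    have "?a ^ (c * ?n + 1) *\<^sub>C ?u = 0"
      unfolding pow[symmetric] by (rule ad_wedge_nilpotent[OF nilpotent K])
    then have "?a = 0"
      using u by (metis cvec.scale_eq_0_iff power_not_zero)
    then show ?thesis by (simp add: ad_wedge_top)
  qed
  have "coeffwise (\<rho> l) ?u = 0" for l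
    by (auto simp: fun_eq_iff coeffwise_apply single_def x pointwise rep_simps)
  then have ext: "ext_mult l (boundary ?u) = 0" for l :: 'l
    using boundary_ext_mult[of l ?u] koszul_space_above[OF ext_mult_koszul_space[OF K, of l]] ad[of l]
    by (simp add: act_def)
  have "boundary ?u = 0"
  proof (cases ?n)
    case 0
    then show ?thesis using K by (simp add: boundary_koszul_space_0)
  next
    case (Suc q)
    have b: "boundary ?u \<in> koszul_space TYPE('l) q"
      using K unfolding Suc by (rule boundary_koszul_space)
    have "boundary ?u S = 0" if S: "S \<in> wedge_index TYPE('l) q" for S
    proof -
      have "S \<subseteq> {..<?n}" "card S = q"
        using S by (simp_all add: wedge_index_def)
      moreover have "S \<noteq> {..<?n}"
        using \<open>card S = q\<close> Suc by (metis card_lessThan n_not_Suc_n)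
      ultimately obtain i where i: "i < ?n" "i \<notin> S" by blast
      have "create i (boundary ?u) (insert i S) = 0"
        using ext[of "lie_basis i"] i(1) by (simp add: ext_mult_basis finite_dim pointwise)
      then have "wsign i (insert i S) *\<^sub>C boundary ?u S = 0"
        using i(2) by (simp add: create_def)
      then show ?thesis by (simp add: wsign_def)
    qed
    then show ?thesis
      using b by (auto simp: fun_eq_iff koszul_space_def pointwise)
  qed
  moreover have "?u \<notin> boundary ` koszul_space TYPE('l) (Suc ?n)"
  proof
    assume "?u \<in> boundary ` koszul_space TYPE('l) (Suc ?n)"
    then obtain v where "v \<in> koszul_space TYPE('l) (Suc ?n)" "?u = boundary v" by blast
    then show False using koszul_space_above[of v] u by simp
  qed
  ultimately show ?thesis
    unfolding homology_nonzero_iff using K by blast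
qed

text \<open>
  In degree \<open>0\<close> boundaries have their value in \<open>V\<close>, and every \<open>y \<otimes> 1\<close> is a cycle.
\<close>

lemma bottom_homology_nonzero:
  assumes V: "cvec.subspace V" "V \<noteq> UNIV" "\<And>l x. \<rho> l x \<in> V"
  shows "homology_nonzero br \<rho> 0"
proof -
  obtain y where y: "y \<notin> V" using V(2) by blast
  let ?u = "single {} y"
  have K: "?u \<in> koszul_space TYPE('l) 0"
    by (auto simp: koszul_space_def single_def wedge_index_def)
  have "boundary v {} \<in> V" if "v \<in> koszul_space TYPE('l) (Suc 0)" for v
  proof -
    have "annihilate j (annihilate i v) = 0" for i j
      using annihilate_koszul_space_0[OF annihilate_koszul_space[OF that]] .
    then have "boundary v {} = (\<Sum>i<cdim TYPE('l). \<rho> (lie_basis i) (annihilate i v {}))"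
      by (simp add: boundary_def pointwise coeffwise_apply)
    then show ?thesis
      using V by (simp add: cvec.subspace_sum)
  qed
  then have "?u \<notin> boundary ` koszul_space TYPE('l) (Suc 0)"
    using y by (auto simp: single_def dest: fun_cong[of _ _ "{}"])
  then show ?thesis
    unfolding homology_nonzero_iff using K boundary_koszul_space_0[OF K] by blast
qed

end

section \<open>Closed ranges\<close>

lemma closed_koszul_space: "closed (koszul_space TYPE('l::complex_vector) p :: (nat set \<Rightarrow> 'x::complex_banach) set)"
proof -
  have "koszul_space TYPE('l) p = (\<Inter>S\<in>- wedge_index TYPE('l) p. {u :: nat set \<Rightarrow> 'x. u S = 0})"
    by (auto simp: koszul_space_def)
  moreover have "closed {u :: nat set \<Rightarrow> 'x. u S = 0}" for S
    by (intro closed_Collect_eq continuous_on_product_coordinates continuous_on_const)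
  ultimately show ?thesis by auto
qed

context finite_lie_representation
begin

lemma continuous_boundary: "continuous_on UNIV (\<lambda>u. boundary u S)"
proof -
  have ann: "continuous_on UNIV (\<lambda>u. annihilate i (F u) S)"
    if "\<And>S. continuous_on UNIV (\<lambda>u. F u S)" for F :: "(nat set \<Rightarrow> 'x) \<Rightarrow> nat set \<Rightarrow> 'x" and i S
    using that by (cases "i \<in> S") (simp_all add: annihilate_def continuous_on_scaleC)
  have cre: "continuous_on UNIV (\<lambda>u. create i (F u) S)"
    if "\<And>S. continuous_on UNIV (\<lambda>u. F u S)" for F :: "(nat set \<Rightarrow> 'x) \<Rightarrow> nat set \<Rightarrow> 'x" and i S
    using that by (cases "i \<in> S") (simp_all add: create_def continuous_on_scaleC)
  have rep: "continuous_on UNIV (\<lambda>u. \<rho> l (F u S))"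
    if "\<And>S. continuous_on UNIV (\<lambda>u. F u S)" for F :: "(nat set \<Rightarrow> 'x) \<Rightarrow> nat set \<Rightarrow> 'x" and l S
    by (rule bounded_linear.continuous_on[OF bounded_clinear_imp_bounded_linear[OF rep_bounded] that])
  show ?thesis
    unfolding boundary_def ext_mult_def pointwise coeffwise_apply
    by (intro continuous_on_add continuous_on_sum continuous_on_scaleC rep ann cre continuous_on_product_coordinates)
qed

text \<open>
  Exactness turns the range into a kernel, and the boundary is continuous in each coefficient.
\<close>

lemma closed_koszul_range:
  assumes "\<And>q. p = Suc q \<Longrightarrow> \<not> homology_nonzero br \<rho> q"
  shows "closed (koszul_range br \<rho> p)"
proof (cases p)
  case 0
  have "koszul_range br \<rho> p = {0}"
    unfolding koszul_range_eq 0 using boundary_koszul_space_0 koszul_space_linear(1) by force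
  also have "{0} = (\<Inter>S. {u :: nat set \<Rightarrow> 'x. u S = 0})"
    by (auto simp: fun_eq_iff pointwise)
  finally show ?thesis
    by (auto intro!: closed_INT closed_Collect_eq continuous_on_product_coordinates)
next
  case (Suc q)
  have "koszul_range br \<rho> p = koszul_space TYPE('l) q \<inter> {u. boundary u = 0}"
  proof -
    have "\<And>u. u \<in> koszul_space TYPE('l) q \<Longrightarrow> boundary u = 0 \<Longrightarrow> u \<in> boundary ` koszul_space TYPE('l) (Suc q)"
      using assms Suc unfolding homology_nonzero_iff by blast
    then show ?thesis
      unfolding koszul_range_eq Suc by (auto simp: boundary_koszul_space boundary_boundary)
  qed
  also have "{u. boundary u = 0} = (\<Inter>S. {u. boundary u S = 0})"
    by (auto simp: fun_eq_iff pointwise)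
  finally show ?thesis
    by (auto intro!: closed_Int closed_koszul_space closed_INT closed_Collect_eq continuous_boundary)
qed

end

section \<open>Riesz theory of compact operators\<close>

lemma infdist_approximation:
  assumes "M \<noteq> {}" "0 < e"
  shows "\<exists>y\<in>M. dist x y < infdist x M + e"
proof (rule ccontr)
  assume "\<not> ?thesis"
  then have "infdist x M + e \<le> (INF y\<in>M. dist x y)"
    using assms(1) by (intro cINF_greatest) (auto simp: not_less)
  then show False
    using assms by (simp add: infdist_notempty)
qed

text \<open>
  Riesz's lemma. The unit vector is given as a multiple of \<open>x - y\<close> so that it visibly lies in each subspace
  that contains \<open>x\<close> and \<open>M\<close>.
\<close>

lemma riesz_almost_orthogonal:
  fixes x :: "'x::complex_banach"
  assumes "cvec.subspace M" "closed M" "x \<notin> M"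
  shows "\<exists>c. \<exists>y\<in>M. norm (c *\<^sub>C (x - y)) = 1 \<and>
    (\<forall>m\<in>M. 1 / 2 \<le> norm (c *\<^sub>C (x - y) - m))"
proof -
  have "M \<noteq> {}" using cvec.subspace_0[OF assms(1)] by blast
  then have d: "0 < infdist x M"
    using infdist_pos_not_in_closed[OF assms(2) _ assms(3)] by blast
  then have "\<exists>y\<in>M. dist x y < infdist x M + infdist x M"
    using \<open>M \<noteq> {}\<close> by (intro infdist_approximation)
  then obtain y where y: "y \<in> M" "norm (x - y) < 2 * infdist x M"
    by (auto simp: dist_norm)
  define r where "r = norm (x - y)"
  have r: "0 < r" using y(1) assms(3) by (auto simp: r_def)
  define c where "c = complex_of_real (1 / r)"
  have c: "cmod c = 1 / r" using r by (simp add: c_def norm_divide)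
  have "1 / 2 \<le> norm (c *\<^sub>C (x - y) - m)" if "m \<in> M" for m
  proof -
    have "y + complex_of_real r *\<^sub>C m \<in> M"
      using that y(1) assms(1) by (simp add: cvec.subspace_add cvec.subspace_scale)
    then have "infdist x M \<le> norm (x - (y + complex_of_real r *\<^sub>C m))"
      using infdist_le[of _ M x] by (metis dist_norm)
    moreover have "c *\<^sub>C (x - y) - m = c *\<^sub>C (x - (y + complex_of_real r *\<^sub>C m))"
      using r by (simp add: c_def cvec.scale_right_diff_distrib cvec.scale_right_distrib scaleC_scaleC
          scaleC_one algebra_simps flip: of_real_mult)
    ultimately have "norm (c *\<^sub>C (x - y) - m) \<ge> 1 / r * infdist x M"
      using r by (simp add: norm_scaleC c divide_right_mono)
    moreover have "1 / r * infdist x M \<ge> 1 / 2"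
      using y(2) r by (simp add: r_def field_simps)
    ultimately show ?thesis by linarith
  qed
  moreover have "norm (c *\<^sub>C (x - y)) = 1"
    using r by (simp add: norm_scaleC c r_def)
  ultimately show ?thesis using y(1) by blast
qed

lemma compact_operator_subsequence:
  fixes T :: "'x::complex_banach \<Rightarrow> 'y::complex_banach"
  assumes "compact_operator T" and "\<And>n :: nat. norm (x n) \<le> B"
  obtains r l where "strict_mono (r :: nat \<Rightarrow> nat)" "(\<lambda>n. T (x (r n))) \<longlonglongrightarrow> l"
proof -
  have lin: "clinear T" and compact: "compact (closure (T ` cball 0 1))"
    using assms(1) by (simp_all add: compact_operator_def bounded_clinear_def)
  define b where "b = complex_of_real (max B 1)"
  have b: "b \<noteq> 0" "cmod b = max B 1" by (auto simp: b_def)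
  have "norm (inverse b *\<^sub>C x n) = norm (x n) / max B 1" for n
    by (simp only: norm_scaleC norm_inverse b divide_inverse mult.commute)
  then have "inverse b *\<^sub>C x n \<in> cball 0 1" for n
    using order_trans[OF assms(2)[of n] max.cobounded1[of B 1]] by simp
  then have "T (inverse b *\<^sub>C x n) \<in> closure (T ` cball 0 1)" for n
    using closure_subset[of "T ` cball 0 1"] by (meson imageI subsetD)
  moreover have "seq_compact (closure (T ` cball 0 1))"
    using compact by (simp add: compact_eq_seq_compact_metric)
  ultimately obtain l r where r: "strict_mono (r :: nat \<Rightarrow> nat)" "((\<lambda>n. T (inverse b *\<^sub>C x n)) \<circ> r) \<longlonglongrightarrow> l"
    by (metis seq_compactE)
  have "bounded_linear ((*\<^sub>C) b :: 'y \<Rightarrow> 'y)"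
    by (rule bounded_clinear_imp_bounded_linear[OF bounded_clinear_scaleC])
  from bounded_linear.tendsto[OF this r(2)]
  have "(\<lambda>n. T (x (r n))) \<longlonglongrightarrow> b *\<^sub>C l"
    using b(1) by (simp add: o_def clin.linear_scale[OF lin] scaleC_scaleC scaleC_one)
  with r(1) show ?thesis by (rule that)
qed

locale riesz_operator =
  fixes T :: "'x::complex_banach \<Rightarrow> 'x" and \<mu> :: complex and S :: "'x \<Rightarrow> 'x"
  assumes compact_T: "compact_operator T" and \<mu>: "\<mu> \<noteq> 0"
    and S_def: "S = (\<lambda>x. T x - \<mu> *\<^sub>C x)"
begin

lemma bounded_clinear_T: "bounded_clinear T"
  using compact_T unfolding compact_operator_def by blast

lemma clinear_S: "clinear S"
proof -
  have "clinear T" using bounded_clinear_T unfolding bounded_clinear_def by blast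
  then show ?thesis
    by (intro clinearI) (simp_all add: S_def clin.linear_add clin.linear_scale
        cvec.scale_right_distrib cvec.scale_right_diff_distrib scaleC_scaleC mult.commute)
qed

lemma bounded_linear_S: "bounded_linear S"
  unfolding S_def
  by (intro bounded_linear_sub bounded_clinear_imp_bounded_linear bounded_clinear_T bounded_clinear_scaleC)

lemma clinear_pow: "clinear (S ^^ k)"
  by (rule clinear_funpow[OF clinear_S])

lemma continuous_pow: "continuous_on UNIV (S ^^ k)"
proof (induction k)
  case (Suc k)
  show ?case
    unfolding funpow.simps o_def
    by (rule continuous_on_compose2[OF linear_continuous_on[OF bounded_linear_S] Suc subset_UNIV])
qed simp

text \<open>
  The vector \<open>x\<close> is recovered as \<open>(T x - S x) / \<mu>\<close>.
\<close>

lemma scaled_limit: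
  assumes "(\<lambda>n :: nat. T (x n)) \<longlonglongrightarrow> a" "(\<lambda>n. S (x n)) \<longlonglongrightarrow> b"
  shows "\<exists>w. x \<longlonglongrightarrow> w"
proof -
  have "bounded_linear ((*\<^sub>C) (inverse \<mu>) :: 'x \<Rightarrow> 'x)"
    by (rule bounded_clinear_imp_bounded_linear[OF bounded_clinear_scaleC])
  from bounded_linear.tendsto[OF this tendsto_diff[OF assms]]
  have "x \<longlonglongrightarrow> inverse \<mu> *\<^sub>C (a - b)"
    using \<mu> by (simp add: S_def scaleC_scaleC scaleC_one)
  then show ?thesis by blast
qed

text \<open>
  Since \<open>T (z i) - T (z j) = \<mu> z i + (S (z i) - T (z j))\<close> and the last summand lies in \<open>M i\<close>, the images \<open>T (z i)\<close>
  stay \<open>\<bar>\<mu>\<bar> / 2\<close> apart, against compactness. The relation \<open>R\<close> lets the same argument serve increasing chains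
  (kernels) and decreasing chains (ranges).
\<close>

lemma no_riesz_chain:
  assumes M: "\<And>i :: nat. cvec.subspace (M i)" and z: "\<And>i. norm (z i) = 1"
    and far: "\<And>i m. m \<in> M i \<Longrightarrow> 1 / 2 \<le> norm (z i - m)"
    and chain: "\<And>i j. R i j \<Longrightarrow> S (z i) - T (z j) \<in> M i"
    and total: "\<And>i j. i < j \<Longrightarrow> R i j \<or> R j i"
  shows False
proof -
  obtain r l where r: "strict_mono r" "(\<lambda>n. T (z (r n))) \<longlonglongrightarrow> l"
    using compact_operator_subsequence[OF compact_T, of z 1] z by auto
  have separated: "cmod \<mu> / 2 \<le> dist (T (z i)) (T (z j))" if "R i j" for i j
  proof -
    have "- inverse \<mu> *\<^sub>C (S (z i) - T (z j)) \<in> M i"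
      using chain[OF that] M cvec.subspace_scale by blast
    from far[OF this] have "1 / 2 \<le> norm (inverse \<mu> *\<^sub>C (\<mu> *\<^sub>C z i + (S (z i) - T (z j))))"
      using \<mu> by (simp add: cvec.scale_right_distrib scaleC_scaleC scaleC_one)
    also have "\<mu> *\<^sub>C z i + (S (z i) - T (z j)) = T (z i) - T (z j)"
      by (simp add: S_def)
    finally have "1 / 2 \<le> inverse (cmod \<mu>) * dist (T (z i)) (T (z j))"
      by (simp only: norm_scaleC norm_inverse dist_norm)
    then show ?thesis
      using \<mu> by (simp add: field_simps)
  qed
  have "Cauchy (\<lambda>n. T (z (r n)))"
    using r(2) by (rule LIMSEQ_imp_Cauchy)
  then obtain N where N: "\<And>m n. m \<ge> N \<Longrightarrow> n \<ge> N \<Longrightarrow> dist (T (z (r m))) (T (z (r n))) < cmod \<mu> / 2"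
    using \<mu> unfolding Cauchy_def by (meson half_gt_zero zero_less_norm_iff)
  have "r N < r (Suc N)" using r(1) by (simp add: strict_mono_def)
  then have "R (r N) (r (Suc N)) \<or> R (r (Suc N)) (r N)" by (rule total)
  then show False
    using separated N[of N "Suc N"] N[of "Suc N" N] by (meson Suc_n_not_le_n le_refl nat_le_linear not_le)
qed

text \<open>
  Otherwise Riesz's lemma gives unit vectors in \<open>ker S\<^bsup>m+1\<^esup>\<close> far from \<open>ker S\<^bsup>m\<^esup>\<close>. The operator \<open>S\<close> lowers the index,
  and \<open>T = S + \<mu>\<close>, so these form a forbidden chain.
\<close>

lemma kernels_stabilize: "\<exists>m. \<forall>x. (S ^^ Suc m) x = 0 \<longrightarrow> (S ^^ m) x = 0"
proof (rule ccontr)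
  assume "\<not> ?thesis"
  then obtain x where x: "\<And>m. (S ^^ Suc m) (x m) = 0" "\<And>m. (S ^^ m) (x m) \<noteq> 0"
    by metis
  define M where "M m = {x. (S ^^ m) x = 0}" for m
  have M: "cvec.subspace (M m)" for m
    unfolding M_def by (rule clin.linear_subspace_kernel[OF clinear_pow])
  have closed: "closed (M m)" for m
    unfolding M_def by (intro closed_Collect_eq continuous_pow continuous_on_const)
  have mono: "M j \<subseteq> M i" if "j \<le> i" for i j
  proof
    fix v assume v: "v \<in> M j"
    have "(S ^^ (i - j + j)) v = 0"
      using v unfolding funpow_add by (simp add: M_def clin.linear_0[OF clinear_pow])
    then show "v \<in> M i" using that by (simp add: M_def)
  qed
  have S_M: "S v \<in> M m" if "v \<in> M (Suc m)" for v m
    using that unfolding M_def by (simp add: funpow_swap1)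
  have "\<exists>z. z \<in> M (Suc m) \<and> norm z = 1 \<and> (\<forall>v\<in>M m. 1 / 2 \<le> norm (z - v))" for m
  proof -
    have out: "x m \<notin> M m" using x(2) by (simp add: M_def)
    obtain c y
      where cy: "y \<in> M m" "norm (c *\<^sub>C (x m - y)) = 1"
      "\<forall>v\<in>M m. 1 / 2 \<le> norm (c *\<^sub>C (x m - y) - v)"
      using riesz_almost_orthogonal[OF M closed out] by blast
    have "x m \<in> M (Suc m)" "y \<in> M (Suc m)" using x(1) cy(1) mono[of m "Suc m"] by (auto simp: M_def)
    then have "c *\<^sub>C (x m - y) \<in> M (Suc m)"
      by (intro cvec.subspace_scale cvec.subspace_diff M)
    with cy show ?thesis by blast
  qed
  then have "\<exists>z. \<forall>m. z m \<in> M (Suc m) \<and> norm (z m) = 1 \<and> (\<forall>v\<in>M m. 1 / 2 \<le> norm (z m - v))"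
    by (intro choice allI)
  then obtain z where "\<forall>m. z m \<in> M (Suc m) \<and> norm (z m) = 1 \<and> (\<forall>v\<in>M m. 1 / 2 \<le> norm (z m - v))" ..
  then have z: "\<And>m. z m \<in> M (Suc m)" "\<And>m. norm (z m) = 1"
    "\<And>m v. v \<in> M m \<Longrightarrow> 1 / 2 \<le> norm (z m - v)" by blast+
  have chain: "S (z i) - T (z j) \<in> M i" if "j < i" for i j
  proof -
    have "z j \<in> M i" using z(1)[of j] mono[of "Suc j" i] that by auto
    moreover have "S (z j) \<in> M i" using S_M[OF z(1)] mono[of j i] that by auto
    moreover have "T (z j) = S (z j) + \<mu> *\<^sub>C z j" by (simp add: S_def)
    ultimately have "T (z j) \<in> M i"
      using M by (simp add: cvec.subspace_add cvec.subspace_scale)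
    then show ?thesis
      using S_M[OF z(1)] M by (simp add: cvec.subspace_diff)
  qed
  show False
    by (rule no_riesz_chain[where R = "\<lambda>i j. j < i" and M = M and z = z])
      (rule M z(2) | erule z(3) | erule chain | simp)+
qed

text \<open>
  Otherwise there are unit vectors far from the kernel that \<open>S\<close> maps to a null sequence; by compactness of
  \<open>T\<close> a subsequence converges, and its limit lies in the kernel.
\<close>

lemma bounded_below_modulo_kernel:
  assumes M: "cvec.subspace M" "closed M"
  shows "\<exists>c. \<forall>x\<in>M. infdist x {x \<in> M. S x = 0} \<le> c * norm (S x)"
proof (rule ccontr)
  let ?K = "{x \<in> M. S x = 0}"
  assume "\<not> ?thesis"
  then have "\<forall>n :: nat. \<exists>x. x \<in> M \<and> real n * norm (S x) < infdist x ?K"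
    by (auto simp: not_le)
  then have "\<exists>x. \<forall>n :: nat. x n \<in> M \<and> real n * norm (S (x n)) < infdist (x n) ?K"
    by (rule choice)
  then obtain x where x: "\<And>n :: nat. x n \<in> M" "\<And>n. real n * norm (S (x n)) < infdist (x n) ?K"
    by blast
  have K: "cvec.subspace ?K"
    using cvec.subspace_inter[OF M(1) clin.linear_subspace_kernel[OF clinear_S]] by (simp add: Int_def)
  have "closed {x. S x = 0}"
    using continuous_pow[of 1] by (intro closed_Collect_eq continuous_on_const) simp
  then have closedK: "closed ?K"
    using closed_Int[OF M(2), of "{x. S x = 0}"] by (simp add: Int_def)
  have "\<exists>z\<in>M. norm z = 1 \<and> (\<forall>v\<in>?K. 1 / 2 \<le> norm (z - v)) \<and> real n * norm (S z) \<le> 1" for n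
  proof -
    have "x n \<notin> ?K"
    proof
      assume "x n \<in> ?K"
      then have "infdist (x n) ?K = 0" by simp
      moreover have "0 \<le> real n * norm (S (x n))" by simp
      ultimately show False using x(2)[of n] by linarith
    qed
    from riesz_almost_orthogonal[OF K closedK this] obtain c y
      where cy: "y \<in> ?K" "norm (c *\<^sub>C (x n - y)) = 1"
      "\<forall>v\<in>?K. 1 / 2 \<le> norm (c *\<^sub>C (x n - y) - v)"
      by blast
    have "S (c *\<^sub>C (x n - y)) = c *\<^sub>C S (x n)"
      using cy(1) by (simp add: clin.linear_scale[OF clinear_S] clin.linear_diff[OF clinear_S])
    then have "real n * norm (S (c *\<^sub>C (x n - y))) = cmod c * (real n * norm (S (x n)))"
      by (simp add: norm_scaleC)
    also have "\<dots> \<le> cmod c * norm (x n - y)"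
      using x(2)[of n] infdist_le[OF cy(1), of "x n"]
      by (intro mult_left_mono) (simp_all add: dist_norm)
    also have "\<dots> = 1" using cy(2) by (simp add: norm_scaleC)
    finally have "real n * norm (S (c *\<^sub>C (x n - y))) \<le> 1" .
    moreover have "c *\<^sub>C (x n - y) \<in> M"
      using x(1) cy(1) M(1) by (auto intro!: cvec.subspace_scale cvec.subspace_diff)
    ultimately show ?thesis using cy by blast
  qed
  then have "\<exists>z. \<forall>n :: nat. z n \<in> M \<and> norm (z n) = 1 \<and>
      (\<forall>v\<in>?K. 1 / 2 \<le> norm (z n - v)) \<and> real n * norm (S (z n)) \<le> 1"
    by (intro choice allI) (simp only: Bex_def)
  then obtain z where "\<forall>n :: nat. z n \<in> M \<and> norm (z n) = 1 \<and>
      (\<forall>v\<in>?K. 1 / 2 \<le> norm (z n - v)) \<and> real n * norm (S (z n)) \<le> 1" ..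
  then have z: "\<And>n. z n \<in> M" "\<And>n. norm (z n) = 1"
    "\<And>n v. v \<in> ?K \<Longrightarrow> 1 / 2 \<le> norm (z n - v)" "\<And>n. real n * norm (S (z n)) \<le> 1"
    by blast+
  obtain r l where r: "strict_mono r" "(\<lambda>n. T (z (r n))) \<longlonglongrightarrow> l"
    using compact_operator_subsequence[OF compact_T, of z 1] z(2) by auto
  have "(\<lambda>n. S (z n)) \<longlonglongrightarrow> 0"
  proof (rule Lim_null_comparison)
    show "\<forall>\<^sub>F n in sequentially. norm (S (z n)) \<le> inverse (real n)"
      using z(4) by (intro eventually_sequentiallyI[of 1]) (simp add: field_simps)
    show "(\<lambda>n. inverse (real n)) \<longlonglongrightarrow> 0" by (rule lim_inverse_n)
  qed
  then have Sz: "(\<lambda>n. S (z (r n))) \<longlonglongrightarrow> 0"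
    using LIMSEQ_subseq_LIMSEQ[OF _ r(1)] by (auto simp: o_def)
  obtain w where w: "(\<lambda>n. z (r n)) \<longlonglongrightarrow> w"
    using scaled_limit[OF r(2) Sz] by blast
  have "w \<in> M" using closed_sequentially[OF M(2) _ w] z(1) by blast
  moreover have "S w = 0"
    using LIMSEQ_unique[OF bounded_linear.tendsto[OF bounded_linear_S w] Sz] .
  ultimately have "1 / 2 \<le> norm (z (r n) - w)" for n
    using z(3) by blast
  moreover have "(\<lambda>n. norm (z (r n) - w)) \<longlonglongrightarrow> 0"
    using w by (simp add: LIM_zero tendsto_norm_zero)
  ultimately have "1 / 2 \<le> (0 :: real)"
    by (intro LIMSEQ_le_const) auto
  then show False by simp
qed

text \<open>
  Preimages of a convergent sequence can be chosen bounded, so that compactness of \<open>T\<close> applies to them.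
  Allowing any closed subspace \<open>M\<close> makes the statement applicable to the ranges of all powers of \<open>S\<close>.
\<close>

lemma closed_image:
  assumes M: "cvec.subspace M" "closed M"
  shows "closed (S ` M)"
  unfolding closed_sequential_limits
proof (intro allI impI, elim conjE)
  fix y l assume y: "\<forall>n :: nat. y n \<in> S ` M" "y \<longlonglongrightarrow> l"
  let ?K = "{x \<in> M. S x = 0}"
  obtain c where c: "\<And>x. x \<in> M \<Longrightarrow> infdist x ?K \<le> c * norm (S x)"
    using bounded_below_modulo_kernel[OF M] by blast
  have "0 \<in> ?K" using M(1) by (simp add: cvec.subspace_0 clin.linear_0[OF clinear_S])
  have "\<exists>x\<in>M. S x = y n \<and> norm x \<le> c * norm (y n) + 1" for n
  proof -
    obtain x where x: "x \<in> M" "S x = y n" using y(1) by (metis imageE)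
    have "\<exists>k\<in>?K. dist x k < infdist x ?K + 1"
      using \<open>0 \<in> ?K\<close> by (intro infdist_approximation) auto
    then obtain k where k: "k \<in> ?K" "norm (x - k) < infdist x ?K + 1"
      by (auto simp: dist_norm)
    then have "norm (x - k) \<le> c * norm (y n) + 1"
      using c[OF x(1)] x(2) by simp
    moreover have "x - k \<in> M" "S (x - k) = y n"
      using x k M(1) by (auto simp: cvec.subspace_diff clin.linear_diff[OF clinear_S])
    ultimately show ?thesis by blast
  qed
  then have "\<exists>x. \<forall>n. x n \<in> M \<and> S (x n) = y n \<and> norm (x n) \<le> c * norm (y n) + 1"
    by (intro choice allI) (simp only: Bex_def)
  then obtain x where "\<forall>n. x n \<in> M \<and> S (x n) = y n \<and> norm (x n) \<le> c * norm (y n) + 1" ..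
  then have x: "\<And>n. x n \<in> M" "\<And>n. S (x n) = y n" "\<And>n. norm (x n) \<le> c * norm (y n) + 1"
    by blast+
  have "Bseq y" using y(2) by (rule convergent_imp_Bseq[OF convergentI])
  then obtain B where B: "\<And>n. norm (y n) \<le> B" by (auto simp: Bseq_def)
  have "norm (x n) \<le> \<bar>c\<bar> * B + 1" for n
  proof -
    have "c * norm (y n) \<le> \<bar>c\<bar> * B" using B[of n] by (intro mult_mono) auto
    then show ?thesis using x(3)[of n] by linarith
  qed
  then obtain r a where r: "strict_mono r" "(\<lambda>n. T (x (r n))) \<longlonglongrightarrow> a"
    using compact_operator_subsequence[OF compact_T] by blast
  have Sx: "(\<lambda>n. S (x (r n))) \<longlonglongrightarrow> l"
    using LIMSEQ_subseq_LIMSEQ[OF y(2) r(1)] x(2) by (simp add: o_def)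
  obtain w where w: "(\<lambda>n. x (r n)) \<longlonglongrightarrow> w"
    using scaled_limit[OF r(2) Sx] by blast
  have "w \<in> M" using closed_sequentially[OF M(2) _ w] x(1) by blast
  moreover have "S w = l"
    using LIMSEQ_unique[OF bounded_linear.tendsto[OF bounded_linear_S w] Sx] .
  ultimately show "l \<in> S ` M" by blast
qed

text \<open>
  As for the kernels, now with unit vectors in the range of \<open>S\<^bsup>m\<^esup>\<close> far from the range of \<open>S\<^bsup>m+1\<^esup>\<close>, which is
  closed.
\<close>

lemma ranges_stabilize: "\<exists>m. range (S ^^ m) \<subseteq> range (S ^^ Suc m)"
proof (rule ccontr)
  assume "\<not> ?thesis"
  then have "\<forall>m. \<exists>y. y \<in> range (S ^^ m) \<and> y \<notin> range (S ^^ Suc m)"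
    by blast
  then have "\<exists>x. \<forall>m. x m \<in> range (S ^^ m) \<and> x m \<notin> range (S ^^ Suc m)"
    by (rule choice)
  then obtain x where x: "\<And>m. x m \<in> range (S ^^ m)" "\<And>m. x m \<notin> range (S ^^ Suc m)"
    by blast
  define M where "M m = range (S ^^ m)" for m
  have M_Suc: "M (Suc m) = S ` M m" for m
    by (auto simp: M_def)
  have M: "cvec.subspace (M m)" for m
    unfolding M_def by (rule clin.linear_subspace_image[OF clinear_pow]) simp
  have closed: "closed (M m)" for m
  proof (induction m)
    case (Suc m)
    then show ?case unfolding M_Suc by (rule closed_image[OF M])
  qed (simp add: M_def)
  have mono: "M i \<subseteq> M j" if "j \<le> i" for i j
  proof -
    have "S ^^ i = S ^^ j \<circ> S ^^ (i - j)" using that by (simp flip: funpow_add)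
    then show ?thesis unfolding M_def by auto
  qed
  have "\<exists>z. z \<in> M m \<and> norm z = 1 \<and> (\<forall>v\<in>M (Suc m). 1 / 2 \<le> norm (z - v))" for m
  proof -
    have out: "x m \<notin> M (Suc m)" using x(2) unfolding M_def .
    obtain c y
      where cy: "y \<in> M (Suc m)" "norm (c *\<^sub>C (x m - y)) = 1"
      "\<forall>v\<in>M (Suc m). 1 / 2 \<le> norm (c *\<^sub>C (x m - y) - v)"
      using riesz_almost_orthogonal[OF M closed out] by blast
    have "x m \<in> M m" "y \<in> M m" using x(1) cy(1) mono[of m "Suc m"] by (auto simp: M_def)
    then have "c *\<^sub>C (x m - y) \<in> M m"
      by (intro cvec.subspace_scale cvec.subspace_diff M)
    with cy show ?thesis by blast
  qed
  then have "\<exists>z. \<forall>m. z m \<in> M m \<and> norm (z m) = 1 \<and> (\<forall>v\<in>M (Suc m). 1 / 2 \<le> norm (z m - v))"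
    by (intro choice allI)
  then obtain z where "\<forall>m. z m \<in> M m \<and> norm (z m) = 1 \<and> (\<forall>v\<in>M (Suc m). 1 / 2 \<le> norm (z m - v))" ..
  then have z: "\<And>m. z m \<in> M m" "\<And>m. norm (z m) = 1"
    "\<And>m v. v \<in> M (Suc m) \<Longrightarrow> 1 / 2 \<le> norm (z m - v)" by blast+
  have chain: "S (z i) - T (z j) \<in> M (Suc i)" if "i < j" for i j
  proof -
    have S: "S (z k) \<in> M (Suc k)" for k using z(1) unfolding M_Suc by blast
    have "z j \<in> M (Suc i)" using z(1)[of j] mono[of "Suc i" j] that by auto
    moreover have "S (z j) \<in> M (Suc i)" using S[of j] mono[of "Suc i" "Suc j"] that by auto
    moreover have "T (z j) = S (z j) + \<mu> *\<^sub>C z j" by (simp add: S_def)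
    ultimately have "T (z j) \<in> M (Suc i)"
      using M by (simp add: cvec.subspace_add cvec.subspace_scale)
    then show ?thesis
      using S M by (simp add: cvec.subspace_diff)
  qed
  show False
    by (rule no_riesz_chain[where R = "(<)" and M = "\<lambda>i. M (Suc i)" and z = z])
      (rule M z(2) | erule z(3) | erule chain | simp)+
qed

end

section \<open>The Fitting decomposition\<close>

context riesz_operator
begin

text \<open>
  Once kernels and ranges are stable from \<open>k\<close> on, \<open>S\<^bsup>k\<^esup> x = S\<^bsup>2k\<^esup> w\<close> has a solution \<open>w\<close>, and \<open>x - S\<^bsup>k\<^esup> w\<close> is the component
  of \<open>x\<close> in the kernel of \<open>S\<^bsup>k\<^esup>\<close>; it is unique because kernel and range of \<open>S\<^bsup>k\<^esup>\<close> meet in zero only.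
\<close>

lemma fitting_decomposition:
  obtains P k where "clinear P" "\<And>x. (S ^^ k) (P x) = 0" "\<And>x. x - P x \<in> range (S ^^ k)"
    "\<And>x. (S ^^ k) x = 0 \<Longrightarrow> P x = x" "\<And>x. x \<in> range (S ^^ k) \<Longrightarrow> P x = 0"
    "\<And>j x. (S ^^ j) x = 0 \<Longrightarrow> (S ^^ k) x = 0" "\<And>j. range (S ^^ k) \<subseteq> range (S ^^ j)"
proof -
  obtain m1 where m1: "\<And>x. (S ^^ Suc m1) x = 0 \<Longrightarrow> (S ^^ m1) x = 0"
    using kernels_stabilize by blast
  obtain m2 where m2: "range (S ^^ m2) \<subseteq> range (S ^^ Suc m2)"
    using ranges_stabilize by blast
  define k where "k = max m1 m2"
  have pow_add: "(S ^^ (i + j)) x = (S ^^ i) ((S ^^ j) x)" for i j x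
    by (simp add: funpow_add)
  have pow_0: "(S ^^ j) 0 = 0" for j
    by (rule clin.linear_0[OF clinear_pow])
  have ker1: "(S ^^ (m1 + j)) x = 0 \<Longrightarrow> (S ^^ m1) x = 0" for j x
  proof (induction j)
    case (Suc j)
    have "(S ^^ Suc m1) ((S ^^ j) x) = 0"
      using Suc.prems by (simp flip: pow_add add: add.commute)
    from m1[OF this] show ?case using Suc.IH by (simp add: pow_add)
  qed simp
  have ker: "(S ^^ k) x = 0" if "(S ^^ j) x = 0" for j x
  proof -
    have "(S ^^ (m1 + j)) x = 0" using that by (simp add: pow_add pow_0)
    then have "(S ^^ m1) x = 0" by (rule ker1)
    moreover have "(S ^^ k) x = (S ^^ (k - m1)) ((S ^^ m1) x)"
      by (simp flip: pow_add add: k_def)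
    ultimately show ?thesis by (simp add: pow_0)
  qed
  have ran1: "range (S ^^ m2) \<subseteq> range (S ^^ (m2 + j))" for j
  proof (induction j)
    case (Suc j)
    show ?case
    proof
      fix y assume "y \<in> range (S ^^ m2)"
      then obtain x where x: "y = (S ^^ (m2 + j)) x" using Suc by blast
      obtain w where w: "(S ^^ m2) x = (S ^^ Suc m2) w" using m2 by blast
      have "y = (S ^^ j) ((S ^^ m2) x)" unfolding x by (simp flip: pow_add add: add.commute)
      also have "\<dots> = (S ^^ (j + Suc m2)) w" unfolding w pow_add ..
      also have "j + Suc m2 = m2 + Suc j" by simp
      finally show "y \<in> range (S ^^ (m2 + Suc j))" by blast
    qed
  qed simp
  have ran: "range (S ^^ k) \<subseteq> range (S ^^ j)" for j
  proof
    fix y assume "y \<in> range (S ^^ k)"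
    then obtain x where "y = (S ^^ (m2 + (k - m2))) x" by (auto simp: k_def)
    then have "y \<in> range (S ^^ m2)" by (simp add: pow_add)
    then obtain w where "y = (S ^^ (j + m2)) w" using ran1[of j] by (auto simp: add.commute)
    then show "y \<in> range (S ^^ j)" by (simp add: pow_add)
  qed
  have disjoint: "x = 0" if x: "(S ^^ k) x = 0" "x \<in> range (S ^^ k)" for x
  proof -
    obtain w where w: "x = (S ^^ k) w" using x(2) by blast
    have "(S ^^ (k + k)) w = 0" using x(1) w by (simp add: pow_add)
    then have "(S ^^ k) w = 0" by (rule ker)
    then show ?thesis using w by simp
  qed
  have "\<exists>y. (S ^^ k) y = 0 \<and> x - y \<in> range (S ^^ k)" for x
  proof -
    have "(S ^^ k) x \<in> range (S ^^ (k + k))" using ran[of "k + k"] by blast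
    then obtain w where w: "(S ^^ k) x = (S ^^ k) ((S ^^ k) w)" by (auto simp: pow_add)
    then have "(S ^^ k) (x - (S ^^ k) w) = 0"
      by (simp add: clin.linear_diff[OF clinear_pow])
    then show ?thesis by (intro exI[of _ "x - (S ^^ k) w"]) simp
  qed
  then obtain P where P: "\<And>x. (S ^^ k) (P x) = 0" "\<And>x. x - P x \<in> range (S ^^ k)"
    by metis
  have R: "cvec.subspace (range (S ^^ k))"
    by (rule clin.linear_subspace_image[OF clinear_pow]) simp
  have unique: "P x = y" if "(S ^^ k) y = 0" "x - y \<in> range (S ^^ k)" for x y
  proof -
    have "(S ^^ k) (P x - y) = 0"
      using that P by (simp add: clin.linear_diff[OF clinear_pow])
    moreover have "P x - y \<in> range (S ^^ k)"
      using cvec.subspace_diff[OF R that(2) P(2)[of x]] by simp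
    ultimately have "P x - y = 0" by (rule disjoint)
    then show ?thesis by simp
  qed
  have lin: "clinear P"
  proof (rule clinearI)
    show "P (x + y) = P x + P y" for x y
      using cvec.subspace_add[OF R P(2)[of x] P(2)[of y]]
      by (intro unique) (simp_all add: P clin.linear_add[OF clinear_pow] algebra_simps)
    show "P (c *\<^sub>C x) = c *\<^sub>C P x" for c x
      using cvec.subspace_scale[OF R P(2)[of x], of c]
      by (intro unique) (simp_all add: P clin.linear_scale[OF clinear_pow] cvec.scale_right_diff_distrib)
  qed
  have on_ker: "P x = x" if "(S ^^ k) x = 0" for x
    using that cvec.subspace_0[OF R] by (intro unique) simp_all
  have on_ran: "P x = 0" if "x \<in> range (S ^^ k)" for x
    using that by (intro unique) (simp_all add: pow_0)
  show ?thesis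
    by (rule that[OF lin P on_ker on_ran ker ran])
qed

end

section \<open>Compact operators cannot span an infinite-dimensional space\<close>

text \<open>
  Adding one vector \<open>a\<close> at positive distance from a closed subspace, the coefficient of \<open>a\<close> is bounded by
  the norm, so the coefficients of a convergent sequence converge.
\<close>

lemma closed_span_finite:
  fixes F :: "'x::complex_banach set"
  assumes "finite F"
  shows "closed (cvec.span F)"
  using assms
proof (induction F)
  case empty
  show ?case by simp
next
  case (insert a F)
  show ?case
  proof (cases "a \<in> cvec.span F")
    case True
    then have "cvec.span (insert a F) = cvec.span F" by (rule cvec.span_redundant)
    then show ?thesis using insert by simp
  next
    case False
    have "cvec.span F \<noteq> {}" using cvec.span_zero by blast
    then have d: "0 < infdist a (cvec.span F)"
      using infdist_pos_not_in_closed[OF insert.IH _ False] by blast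
    have bound: "cmod c * infdist a (cvec.span F) \<le> norm (m + c *\<^sub>C a)" if m: "m \<in> cvec.span F" for c m
    proof (cases "c = 0")
      case False
      have "- inverse c *\<^sub>C m \<in> cvec.span F" using m by (rule cvec.span_scale)
      then have "infdist a (cvec.span F) \<le> norm (a - (- inverse c *\<^sub>C m))"
        using infdist_le[of _ "cvec.span F" a] by (metis dist_norm)
      then have "cmod c * infdist a (cvec.span F) \<le> norm (c *\<^sub>C (a - (- inverse c *\<^sub>C m)))"
        by (simp only: norm_scaleC mult_left_mono norm_ge_zero)
      also have "c *\<^sub>C (a - (- inverse c *\<^sub>C m)) = m + c *\<^sub>C a"
        using False by (simp add: cvec.scale_right_distrib scaleC_scaleC scaleC_one)
      finally show ?thesis .
    qed simp
    show ?thesis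
      unfolding closed_sequential_limits
    proof (intro allI impI, elim conjE)
      fix x l assume x: "\<forall>n :: nat. x n \<in> cvec.span (insert a F)" "x \<longlonglongrightarrow> l"
      then have "\<forall>n. \<exists>c. x n - c *\<^sub>C a \<in> cvec.span F"
        using cvec.span_breakdown_eq by blast
      then obtain c where c: "\<And>n. x n - c n *\<^sub>C a \<in> cvec.span F" by metis
      have "Cauchy c"
      proof (rule metric_CauchyI)
        fix e :: real assume "0 < e"
        then have "0 < e * infdist a (cvec.span F)" using d by simp
        then obtain N where N: "\<And>m n. m \<ge> N \<Longrightarrow> n \<ge> N \<Longrightarrow> dist (x m) (x n) < e * infdist a (cvec.span F)"
          using LIMSEQ_imp_Cauchy[OF x(2)] unfolding Cauchy_def by blast
        have "dist (c m) (c n) < e" if "m \<ge> N" "n \<ge> N" for m n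
        proof -
          have "(x m - c m *\<^sub>C a) - (x n - c n *\<^sub>C a) \<in> cvec.span F"
            by (intro cvec.span_diff c)
          from bound[OF this, of "c m - c n"]
          have "cmod (c m - c n) * infdist a (cvec.span F) \<le> norm (x m - x n)"
            by (simp add: cvec.scale_left_diff_distrib)
          also have "\<dots> < e * infdist a (cvec.span F)"
            using N[OF that] by (simp add: dist_norm)
          finally show ?thesis using d by (simp add: dist_norm)
        qed
        then show "\<exists>M. \<forall>m\<ge>M. \<forall>n\<ge>M. dist (c m) (c n) < e" by blast
      qed
      then obtain b where b: "c \<longlonglongrightarrow> b" using Cauchy_convergent_iff convergent_def by blast
      have "norm (c n *\<^sub>C a - b *\<^sub>C a) = norm (c n - b) * norm a" for n
        by (simp add: norm_scaleC flip: cvec.scale_left_diff_distrib)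
      moreover have "(\<lambda>n. norm (c n - b) * norm a) \<longlonglongrightarrow> 0"
        using b by (intro tendsto_mult_left_zero) (simp add: LIM_zero tendsto_norm_zero)
      ultimately have "(\<lambda>n. norm (c n *\<^sub>C a - b *\<^sub>C a)) \<longlonglongrightarrow> 0"
        by (simp only:)
      then have "(\<lambda>n. c n *\<^sub>C a - b *\<^sub>C a) \<longlonglongrightarrow> 0"
        by (rule tendsto_norm_zero_cancel)
      then have "(\<lambda>n. c n *\<^sub>C a) \<longlonglongrightarrow> b *\<^sub>C a"
        by (rule LIM_zero_cancel)
      then have "(\<lambda>n. x n - c n *\<^sub>C a) \<longlonglongrightarrow> l - b *\<^sub>C a"
        by (intro tendsto_diff x(2))
      then have "l - b *\<^sub>C a \<in> cvec.span F"
        by (rule closed_sequentially[OF insert.IH c])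
      then show "l \<in> cvec.span (insert a F)"
        using cvec.span_breakdown_eq by blast
    qed
  qed
qed

text \<open>
  The span of a finite \<open>1/4\<close>-net of the unit ball is closed; if it were proper, Riesz's lemma would give a
  unit vector at distance at least \<open>1/2\<close> from the net.
\<close>

lemma locally_compact_imp_finite_dim:
  assumes "compact (cball (0 :: 'x::complex_banach) 1)"
  shows "cfinite_dim TYPE('x)"
proof -
  have "cball (0 :: 'x) 1 \<subseteq> (\<Union>f\<in>cball 0 1. ball f (1 / 4))" by force
  then obtain F where F: "F \<subseteq> cball (0 :: 'x) 1" "finite F" "cball 0 1 \<subseteq> (\<Union>f\<in>F. ball f (1 / 4))"
    using compactE_image[OF assms, of "cball 0 1" "\<lambda>f. ball f (1 / 4)"] by (metis open_ball)
  have "cvec.span F = UNIV"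
  proof (rule ccontr)
    assume "cvec.span F \<noteq> UNIV"
    then obtain x where "x \<notin> cvec.span F" by blast
    from riesz_almost_orthogonal[OF cvec.subspace_span closed_span_finite[OF F(2)] this]
    obtain z where z: "norm z = 1" "\<forall>m\<in>cvec.span F. 1 / 2 \<le> norm (z - m)" by blast
    then have "z \<in> cball 0 1" by simp
    then obtain f where "f \<in> F" "dist f z < 1 / 4" using F(3) by auto
    then show False
      using z(2) cvec.span_base[of f F] by (auto simp: dist_norm norm_minus_commute)
  qed
  then show ?thesis
    unfolding cfinite_dim_def using F(2) by blast
qed

lemma interior_compact_imp_finite_dim:
  fixes K :: "'x::complex_banach set"
  assumes "compact K" "interior K \<noteq> {}"
  shows "cfinite_dim TYPE('x)"
proof -
  obtain y where "y \<in> interior K" using assms(2) by blast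
  then obtain r where r: "0 < r" "cball y r \<subseteq> K"
    by (auto simp: mem_interior_cball)
  have "compact (cball y r)"
    using compact_Int_closed[OF assms(1) closed_cball[of y r]] r(2) by (simp add: Int_absorb1)
  then have "compact ((\<lambda>x. (1 / r) *\<^sub>R (x - y)) ` cball y r)"
    by (intro compact_continuous_image continuous_intros)
  moreover have "(\<lambda>x. (1 / r) *\<^sub>R (x - y)) ` cball y r = cball 0 1"
  proof (intro equalityI subsetI)
    fix z assume "z \<in> cball (0 :: 'x) 1"
    then have "y + r *\<^sub>R z \<in> cball y r" "z = (1 / r) *\<^sub>R ((y + r *\<^sub>R z) - y)"
      using r(1) by (simp_all add: dist_norm mult_left_le)
    then show "z \<in> (\<lambda>x. (1 / r) *\<^sub>R (x - y)) ` cball y r" by blast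
  qed (use r(1) in \<open>auto simp: dist_norm norm_minus_commute\<close>)
  ultimately show ?thesis
    using locally_compact_imp_finite_dim by simp
qed

text \<open>
  If the sums exhausted \<open>X\<close>, then \<open>X\<close> would be the union of the integer multiples of the compact set \<open>C I\<close>
  of sums of vectors from the closures of the images of the unit ball, and by Baire's theorem one of these
  multiples would have interior points.
\<close>

lemma compact_operators_not_spanning:
  fixes T :: "'i \<Rightarrow> 'x::complex_banach \<Rightarrow> 'x"
  assumes "finite I" "\<And>i. i \<in> I \<Longrightarrow> compact_operator (T i)" "\<not> cfinite_dim TYPE('x)"
  shows "\<exists>y. \<forall>x. y \<noteq> (\<Sum>i\<in>I. T i (x i))"
proof (rule ccontr)
  assume "\<not> ?thesis"
  then have onto: "\<And>y. \<exists>x. y = (\<Sum>i\<in>I. T i (x i))" by blast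
  define C where "C J = {\<Sum>i\<in>J. w i | w. \<forall>i\<in>J. w i \<in> closure (T i ` cball 0 1)}" for J
  have "compact (C J)" if "J \<subseteq> I" for J
    using finite_subset[OF that assms(1)] that
  proof (induction J rule: finite_induct)
    case empty
    have "C {} = {0}" by (auto simp: C_def)
    then show ?case by simp
  next
    case (insert j J)
    have "C (insert j J) = {a + b | a b. a \<in> closure (T j ` cball 0 1) \<and> b \<in> C J}"
    proof (intro equalityI subsetI)
      fix y assume "y \<in> C (insert j J)"
      then obtain w where w: "y = (\<Sum>i\<in>insert j J. w i)" "\<forall>i\<in>insert j J. w i \<in> closure (T i ` cball 0 1)"
        unfolding C_def by blast
      then have "y = w j + (\<Sum>i\<in>J. w i)" "(\<Sum>i\<in>J. w i) \<in> C J" using insert.hyps by (auto simp: C_def)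
      then show "y \<in> {a + b | a b. a \<in> closure (T j ` cball 0 1) \<and> b \<in> C J}" using w(2) by blast
    next
      fix y assume "y \<in> {a + b | a b. a \<in> closure (T j ` cball 0 1) \<and> b \<in> C J}"
      then obtain a w where w: "y = a + (\<Sum>i\<in>J. w i)" "a \<in> closure (T j ` cball 0 1)"
        "\<forall>i\<in>J. w i \<in> closure (T i ` cball 0 1)"
        unfolding C_def by blast
      let ?w = "w(j := a)"
      have "(\<Sum>i\<in>J. ?w i) = (\<Sum>i\<in>J. w i)" using insert.hyps by (intro sum.cong) auto
      then have "y = (\<Sum>i\<in>insert j J. ?w i)" using w(1) insert.hyps by simp
      moreover have "\<forall>i\<in>insert j J. ?w i \<in> closure (T i ` cball 0 1)" using w by auto
      ultimately show "y \<in> C (insert j J)" unfolding C_def by blast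
    qed
    moreover have "compact (closure (T j ` cball 0 1))"
      using assms(2) insert.prems by (simp add: compact_operator_def)
    ultimately show ?case
      using compact_sums insert by auto
  qed
  then have compact: "compact (C I)" by simp
  let ?A = "\<lambda>m :: nat. (*\<^sub>R) (real m) ` C I"
  have compact_A: "compact (?A m)" for m
    using compact by (rule compact_scaling)
  have cover: "\<exists>m. y \<in> ?A m" for y
  proof -
    obtain x where x: "y = (\<Sum>i\<in>I. T i (x i))" using onto by blast
    obtain m :: nat where m: "(\<Sum>i\<in>I. norm (x i)) < real m" using reals_Archimedean2 by blast
    have "0 \<le> (\<Sum>i\<in>I. norm (x i))" by (simp add: sum_nonneg)
    then have m0: "0 < real m" using m by linarith
    \<comment> \<open>Dividing by \<open>m\<close> moves all the \<open>x i\<close> into the unit ball.\<close>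
    let ?w = "\<lambda>i. T i ((1 / real m) *\<^sub>R x i)"
    have lin: "T i (complex_of_real c *\<^sub>C v) = complex_of_real c *\<^sub>C T i v" if "i \<in> I" for i c v
      using assms(2)[OF that] by (simp add: compact_operator_def bounded_clinear_def clin.linear_scale)
    have "real m *\<^sub>R ?w i = T i (x i)" if "i \<in> I" for i
      using lin[OF that, of "1 / real m" "x i"] m0
      by (simp add: scaleR_scaleC scaleC_scaleC scaleC_one)
    then have "y = real m *\<^sub>R (\<Sum>i\<in>I. ?w i)"
      unfolding x scaleR_sum_right by (intro sum.cong) auto
    moreover have "?w i \<in> closure (T i ` cball 0 1)" if "i \<in> I" for i
    proof -
      have "norm (x i) \<le> (\<Sum>i\<in>I. norm (x i))" using that assms(1) by (intro member_le_sum) auto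
      then have "(1 / real m) *\<^sub>R x i \<in> cball 0 1" using m m0 by (simp add: field_simps)
      then show ?thesis
        using closure_subset[of "T i ` cball 0 1"] by (meson imageI subsetD)
    qed
    ultimately show ?thesis unfolding C_def by blast
  qed
  have "interior (?A m) = {}" for m
    using interior_compact_imp_finite_dim[OF compact_A] assms(3) by blast
  then have "interior (\<Union> (range ?A)) = {}"
    using Baire_category_alt[of "euclidean :: 'x topology" "range ?A"] compact_imp_closed[OF compact_A]
      completely_metrizable_space_euclidean by auto
  moreover have "\<Union> (range ?A) = UNIV"
    using cover by blast
  ultimately show False by simp
qed

section \<open>Splitting off generalised null spaces\<close>

context finite_lie_representation
begin

text \<open>
  As in \<open>ad_wedge_nilpotent_ext_mult\<close>, each application of \<open>\<rho> l\<close> to \<open>\<rho> m x\<close> goes to \<open>m\<close>, as \<open>ad l\<close>, or to \<open>x\<close>. So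
  generalised null spaces of \<open>\<rho> l\<close> are invariant under all \<open>\<rho> m\<close> with \<open>ad l\<close> nilpotent on \<open>m\<close>.
\<close>

lemma rep_pow_kernel:
  "(br l ^^ a) m = 0 \<Longrightarrow> (\<rho> l ^^ b) x = 0 \<Longrightarrow> (\<rho> l ^^ (a + b)) (\<rho> m x) = 0"
proof (induction "a + b" arbitrary: a b m x)
  case 0
  then show ?case by (simp add: rep_simps)
next
  case (Suc c)
  have pow_0: "(\<rho> l ^^ k) 0 = 0" for k
    by (rule clin.linear_0[OF clinear_funpow[OF clinear_rep]])
  have "a = 0 \<Longrightarrow> \<rho> m x = 0" "b = 0 \<Longrightarrow> \<rho> m x = 0"
    using Suc.prems clin.linear_0[OF clinear_rep_left] by (simp_all add: rep_simps)
  moreover have "(\<rho> l ^^ (a + b)) (\<rho> m x) = 0" if "a = Suc a'" "b = Suc b'" for a' b'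
  proof -
    have 1: "(\<rho> l ^^ c) (\<rho> (br l m) x) = 0"
      using Suc.hyps(1)[of a' b "br l m" x] Suc.hyps(2) Suc.prems that
      by (simp add: funpow_swap1)
    have 2: "(\<rho> l ^^ c) (\<rho> m (\<rho> l x)) = 0"
      using Suc.hyps(1)[of a b' m "\<rho> l x"] Suc.hyps(2) Suc.prems that
      by (simp add: funpow_swap1)
    have "(\<rho> l ^^ (a + b)) (\<rho> m x) = (\<rho> l ^^ c) (\<rho> l (\<rho> m x))"
      unfolding Suc.hyps(2)[symmetric] by (simp only: funpow_Suc_right o_apply)
    also have "\<rho> l (\<rho> m x) = \<rho> (br l m) x + \<rho> m (\<rho> l x)"
      by (simp add: rep_br)
    finally show ?thesis
      by (simp add: clin.linear_add[OF clinear_funpow[OF clinear_rep]] 1 2)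
  qed
  ultimately show ?case
    using pow_0 by (metis not0_implies_Suc)
qed

text \<open>
  For \<open>x = \<rho> l w\<close> one has \<open>\<rho> m x = \<rho> l (\<rho> m w) - \<rho> [l, m] w\<close>; induction on \<open>j\<close> handles the first term, and induction on
  the nilpotency degree of \<open>ad l\<close> at \<open>m\<close> the second.
\<close>

lemma rep_pow_range:
  assumes V: "\<And>x. x \<in> V \<Longrightarrow> \<exists>w\<in>V. x = \<rho> l w"
  shows "(br l ^^ a) m = 0 \<Longrightarrow> x \<in> V \<Longrightarrow> \<rho> m x \<in> range (\<rho> l ^^ j)"
proof (induction a arbitrary: m x j)
  case 0
  then have "\<rho> m x = (\<rho> l ^^ j) 0"
    using clin.linear_0[OF clinear_rep_left] clin.linear_0[OF clinear_funpow[OF clinear_rep]] by simp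
  then show ?case by (rule range_eqI)
next
  case (Suc a)
  show ?case
    using Suc.prems(2)
  proof (induction j arbitrary: x)
    case 0
    show ?case by simp
  next
    case (Suc j)
    obtain w where w: "w \<in> V" "x = \<rho> l w" using V Suc.prems by blast
    obtain y where y: "\<rho> m w = (\<rho> l ^^ j) y" using Suc.IH[OF w(1)] by blast
    have "(br l ^^ a) (br l m) = 0" using \<open>(br l ^^ Suc a) m = 0\<close> by (simp add: funpow_swap1)
    from \<open>\<And>m x j. (br l ^^ a) m = 0 \<Longrightarrow> x \<in> V \<Longrightarrow> \<rho> m x \<in> range (\<rho> l ^^ j)\<close>[OF this w(1), of "Suc j"]
    obtain z where z: "\<rho> (br l m) w = (\<rho> l ^^ Suc j) z" by blast
    have "\<rho> m x = \<rho> l (\<rho> m w) - \<rho> (br l m) w"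
      by (simp add: rep_br w(2))
    also have "\<dots> = (\<rho> l ^^ Suc j) (y - z)"
      by (simp add: y z clin.linear_diff[OF clinear_funpow[OF clinear_rep]] rep_simps)
    finally show ?case by (rule range_eqI)
  qed
qed

lemma boundary_coeffwise:
  assumes "clinear P" and "\<And>m x. P (\<rho> m x) = \<rho> m (P x)"
  shows "boundary (coeffwise P u) = coeffwise P (boundary u)"
proof -
  have "coeffwise P (coeffwise (\<rho> m) v) = coeffwise (\<rho> m) (coeffwise P v)" for m v
    by (simp add: fun_eq_iff coeffwise_apply assms(2))
  then show ?thesis
    by (simp add: boundary_def clin.linear_add[OF clinear_coeffwise[OF assms(1)]]
        clin.linear_sum[OF clinear_coeffwise[OF assms(1)]] clin.linear_scale[OF clinear_coeffwise[OF assms(1)]]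
        coeffwise_annihilate[OF assms(1)] coeffwise_ext_mult[OF assms(1)])
qed

text \<open>
  Every homology class has a representative with values in the range of \<open>P\<close>, and this range contains all
  joint null vectors of the representation. Fitting projections have this property, and it is stable
  under composition.
\<close>

definition splits_cycles :: "('x \<Rightarrow> 'x) \<Rightarrow> bool"
  where "splits_cycles P \<longleftrightarrow> clinear P \<and> (\<forall>m x. P (\<rho> m x) = \<rho> m (P x)) \<and>
    (\<forall>x. (\<forall>m. \<rho> m x = 0) \<longrightarrow> P x = x) \<and>
    (\<forall>p. \<forall>u\<in>koszul_space TYPE('l) p. boundary u = 0 \<longrightarrow>
       u - coeffwise P u \<in> boundary ` koszul_space TYPE('l) (Suc p))"

text \<open>
  Both Fitting summands are invariant under the representation, as \<open>ad l\<close> is nilpotent. So \<open>P\<close> maps cycles to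
  cycles, and \<open>u - P u\<close> is a cycle with values in the summand where \<open>\<rho> l\<close> is invertible and the complex is exact.
\<close>

lemma fitting_projection:
  assumes nilpotent: "\<And>m. (br l ^^ c) m = 0"
    and compact: "compact_operator (\<lambda>x. \<rho> l x + \<mu> *\<^sub>C x)" "\<mu> \<noteq> 0"
  shows "\<exists>P k. splits_cycles P \<and> (\<forall>x. (\<rho> l ^^ k) (P x) = 0)"
proof -
  interpret riesz_operator "\<lambda>x. \<rho> l x + \<mu> *\<^sub>C x" \<mu> "\<rho> l"
    by unfold_locales (simp_all add: compact)
  obtain P k where P: "clinear P" "\<And>x. (\<rho> l ^^ k) (P x) = 0" "\<And>x. x - P x \<in> range (\<rho> l ^^ k)"
    "\<And>x. (\<rho> l ^^ k) x = 0 \<Longrightarrow> P x = x" "\<And>x. x \<in> range (\<rho> l ^^ k) \<Longrightarrow> P x = 0"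
    and ker: "\<And>j x. (\<rho> l ^^ j) x = 0 \<Longrightarrow> (\<rho> l ^^ k) x = 0"
    and ran: "\<And>j. range (\<rho> l ^^ k) \<subseteq> range (\<rho> l ^^ j)"
    by (rule fitting_decomposition[OF that])
  let ?V = "range (\<rho> l ^^ k)"
  have V: "cvec.subspace ?V"
    by (rule clin.linear_subspace_image[OF clinear_funpow[OF clinear_rep]]) simp
  have surj: "\<exists>w\<in>?V. x = \<rho> l w" if "x \<in> ?V" for x
  proof -
    obtain w where "x = (\<rho> l ^^ Suc k) w" using ran[of "Suc k"] \<open>x \<in> ?V\<close> by blast
    then show ?thesis by (intro bexI[of _ "(\<rho> l ^^ k) w"]) simp_all
  qed
  have inv: "\<rho> m x \<in> ?V" if "x \<in> ?V" for m x
    using rep_pow_range[OF surj nilpotent that] .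
  have commute: "P (\<rho> m x) = \<rho> m (P x)" for m x
  proof -
    have "(\<rho> l ^^ k) (\<rho> m (P x)) = 0"
      using rep_pow_kernel[OF nilpotent P(2)] by (rule ker)
    then have "P (\<rho> m (P x)) = \<rho> m (P x)" by (rule P(4))
    moreover have "P (\<rho> m (x - P x)) = 0"
      by (rule P(5)[OF inv[OF P(3)]])
    moreover have "P (\<rho> m x) = P (\<rho> m (P x)) + P (\<rho> m (x - P x))"
      by (simp add: rep_simps clin.linear_diff[OF P(1)])
    ultimately show ?thesis by simp
  qed
  have "P x = x" if "\<forall>m. \<rho> m x = 0" for x
  proof (rule P(4), rule ker[of 1])
    show "(\<rho> l ^^ 1) x = 0" using that by simp
  qed
  moreover have "u - coeffwise P u \<in> boundary ` koszul_space TYPE('l) (Suc p)"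
    if u: "u \<in> koszul_space TYPE('l) p" "boundary u = 0" for p u
  proof (rule exact_on_invertible_part[OF V inv _ _ nilpotent])
    show "u - coeffwise P u \<in> koszul_space TYPE('l) p"
      using u(1) by (simp add: koszul_space_linear coeffwise_koszul_space clin.linear_0[OF P(1)])
    show "u - coeffwise P u \<in> valued_in ?V"
      by (simp add: valued_in_def pointwise coeffwise_apply P(3))
    show "boundary (u - coeffwise P u) = 0"
      by (simp add: u(2) boundary_coeffwise[OF P(1) commute] clin.linear_0[OF clinear_coeffwise[OF P(1)]])
    show "x = 0" if "x \<in> ?V" "\<rho> l x = 0" for x
    proof -
      have "(\<rho> l ^^ k) x = 0" by (rule ker[of 1]) (simp add: that)
      then show ?thesis using P(4,5) that(1) by metis
    qed
    show "\<exists>x\<in>?V. \<rho> l x = y" if "y \<in> ?V" for y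
      using surj[OF that] by metis
  qed
  ultimately have "splits_cycles P"
    unfolding splits_cycles_def using P(1) commute by blast
  then show ?thesis using P(2) by blast
qed

lemma splits_cycles_comp:
  assumes "splits_cycles P" "splits_cycles Q"
  shows "splits_cycles (P \<circ> Q)"
proof -
  have P: "clinear P" "\<And>m x. P (\<rho> m x) = \<rho> m (P x)" "\<And>x. \<forall>m. \<rho> m x = 0 \<Longrightarrow> P x = x"
    "\<And>p u. u \<in> koszul_space TYPE('l) p \<Longrightarrow> boundary u = 0 \<Longrightarrow>
       u - coeffwise P u \<in> boundary ` koszul_space TYPE('l) (Suc p)"
    using assms(1) unfolding splits_cycles_def by auto
  have Q: "clinear Q" "\<And>m x. Q (\<rho> m x) = \<rho> m (Q x)" "\<And>x. \<forall>m. \<rho> m x = 0 \<Longrightarrow> Q x = x"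
    "\<And>p u. u \<in> koszul_space TYPE('l) p \<Longrightarrow> boundary u = 0 \<Longrightarrow>
       u - coeffwise Q u \<in> boundary ` koszul_space TYPE('l) (Suc p)"
    using assms(2) unfolding splits_cycles_def by auto
  have "u - coeffwise (P \<circ> Q) u \<in> boundary ` koszul_space TYPE('l) (Suc p)"
    if u: "u \<in> koszul_space TYPE('l) p" "boundary u = 0" for p u
  proof -
    have "coeffwise Q u \<in> koszul_space TYPE('l) p"
      using u(1) by (rule coeffwise_koszul_space) (rule clin.linear_0[OF Q(1)])
    moreover have "boundary (coeffwise Q u) = 0"
      by (simp add: u(2) boundary_coeffwise[OF Q(1,2)] clin.linear_0[OF clinear_coeffwise[OF Q(1)]])
    ultimately have "coeffwise Q u - coeffwise P (coeffwise Q u) \<in> boundary ` koszul_space TYPE('l) (Suc p)"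
      by (rule P(4))
    then have "(u - coeffwise Q u) + (coeffwise Q u - coeffwise P (coeffwise Q u))
        \<in> boundary ` koszul_space TYPE('l) (Suc p)"
      by (intro cvec.subspace_add[OF clin.linear_subspace_image[OF clinear_boundary subspace_koszul_space]] Q(4) u)
    moreover have "(u - coeffwise Q u) + (coeffwise Q u - coeffwise P (coeffwise Q u)) = u - coeffwise (P \<circ> Q) u"
      by (simp add: fun_eq_iff pointwise coeffwise_apply)
    ultimately show ?thesis by simp
  qed
  moreover have "clinear (P \<circ> Q)"
    using Q(1) P(1) by (rule Vector_Spaces.linear_compose)
  ultimately show ?thesis
    unfolding splits_cycles_def using P(2,3) Q(2,3) by simp
qed

lemma commuting_pow:
  assumes "\<And>m x. P (\<rho> m x) = \<rho> m (P x)"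
  shows "P ((\<rho> l ^^ k) x) = (\<rho> l ^^ k) (P x)"
  by (induction k) (simp_all add: assms)

text \<open>
  The projections for the elements of \<open>A\<close> are composed one by one. A projection for a new element commutes
  with the representation and so preserves the generalised null spaces reached before.
\<close>

lemma joint_fitting_projection:
  assumes nilpotent: "\<And>l m. (br l ^^ c) m = 0"
    and good: "finite A" "\<And>l. l \<in> A \<Longrightarrow> \<exists>\<mu>. \<mu> \<noteq> 0 \<and> compact_operator (\<lambda>x. \<rho> l x + \<mu> *\<^sub>C x)"
  shows "\<exists>Q. splits_cycles Q \<and> (\<forall>l\<in>A. \<exists>k. \<forall>x. (\<rho> l ^^ k) (Q x) = 0)"
  using good
proof (induction A)
  case empty
  have "splits_cycles (\<lambda>x. x)"
    unfolding splits_cycles_def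
    by (auto simp: coeffwise_def koszul_space_linear image_iff intro!: clinearI bexI[of _ 0])
  then show ?case by blast
next
  case (insert l A)
  then obtain Q where Q: "splits_cycles Q" "\<And>a. a \<in> A \<Longrightarrow> \<exists>k. \<forall>x. (\<rho> a ^^ k) (Q x) = 0"
    by auto
  obtain \<mu> where \<mu>: "\<mu> \<noteq> 0" "compact_operator (\<lambda>x. \<rho> l x + \<mu> *\<^sub>C x)"
    using insert.prems by blast
  obtain P k where P: "splits_cycles P" "\<And>x. (\<rho> l ^^ k) (P x) = 0"
    using fitting_projection[OF nilpotent \<mu>(2,1)] by blast
  have "\<exists>k. \<forall>x. (\<rho> a ^^ k) ((P \<circ> Q) x) = 0" if a: "a \<in> insert l A" for a
  proof (cases "a = l")
    case True
    then show ?thesis using P(2) by auto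
  next
    case False
    then obtain j where j: "\<And>x. (\<rho> a ^^ j) (Q x) = 0" using Q(2) a by blast
    have P': "clinear P" "\<And>m x. P (\<rho> m x) = \<rho> m (P x)" using P(1) unfolding splits_cycles_def by auto
    have "(\<rho> a ^^ j) (P (Q x)) = P ((\<rho> a ^^ j) (Q x))" for x
      by (rule commuting_pow[OF P'(2), symmetric])
    then show ?thesis by (auto simp: j clin.linear_0[OF P'(1)])
  qed
  then show ?case using splits_cycles_comp[OF P(1) Q(1)] by blast
qed

end

section \<open>Engel's theorem along the lower central series\<close>

context finite_lie_algebra
begin

lemma subspace_lower_central: "cvec.subspace (lower_central br k)"
  by (cases k) simp_all

lemma br_lower_central: "y \<in> lower_central br k \<Longrightarrow> br x y \<in> lower_central br (Suc k)"
  by (auto intro: cvec.span_base)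

lemma br_lower_central': "x \<in> lower_central br k \<Longrightarrow> br x y \<in> lower_central br (Suc k)"
  using br_lower_central[of x k y] cvec.subspace_neg[OF subspace_lower_central[of "Suc k"]] br_skew[of x y]
  by metis

lemma lower_central_decreasing: "lower_central br (Suc k) \<subseteq> lower_central br k"
proof (induction k)
  case (Suc k)
  have "{br x y | x y. y \<in> lower_central br (Suc k)} \<subseteq> lower_central br (Suc k)"
    using br_lower_central Suc by blast
  then show ?case
    unfolding lower_central.simps(2)[of br "Suc k"]
    by (rule cvec.span_minimal[OF _ subspace_lower_central])
qed simp

lemma br_pow_lower_central: "(br l ^^ k) m \<in> lower_central br k"
proof (induction k)
  case (Suc k)
  then show ?case using br_lower_central by simp
qed simp

lemma finite_spanning_set: "\<exists>B. finite B \<and> lower_central br k = cvec.span B"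
proof -
  obtain F :: "'l set" where F: "finite F" "cvec.span F = UNIV"
    using finite_dim unfolding cfinite_dim_def by blast
  obtain B where B: "B \<subseteq> lower_central br k" "cvec.independent B" "lower_central br k \<subseteq> cvec.span B"
    using cvec.basis_exists[of "lower_central br k"] by metis
  have "finite B" using cvec.independent_span_bound[OF F(1) B(2)] F(2) by simp
  moreover have "cvec.span B \<subseteq> lower_central br k"
    using B(1) subspace_lower_central by (rule cvec.span_minimal)
  ultimately show ?thesis using B(3) by blast
qed

end

context finite_lie_representation
begin

lemma nilpotent_kernel:
  assumes "\<And>v. v \<in> W \<Longrightarrow> \<rho> h v \<in> W" and "v \<in> W" "v \<noteq> 0" "(\<rho> h ^^ j) v = 0"
  shows "\<exists>w\<in>W. w \<noteq> 0 \<and> \<rho> h w = 0"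
  using assms(2-)
proof (induction j arbitrary: v)
  case (Suc j)
  show ?case
  proof (cases "\<rho> h v = 0")
    case False
    then show ?thesis
      using Suc.IH[of "\<rho> h v"] Suc.prems assms(1) by (simp add: funpow_swap1)
  qed (use Suc.prems in blast)
qed simp

text \<open>
  Nakayama's argument: iterating \<open>N \<subseteq> U + \<rho> h N\<close> gives \<open>N \<subseteq> U + (\<rho> h)\<^bsup>j\<^esup> N = U\<close>.
\<close>

lemma nilpotent_cokernel:
  assumes U: "cvec.subspace U" "\<And>u. u \<in> U \<Longrightarrow> \<rho> h u \<in> U"
    and N: "\<And>x. x \<in> N \<Longrightarrow> (\<rho> h ^^ j) x = 0"
    and onto: "\<And>x. x \<in> N \<Longrightarrow> \<exists>u\<in>U. \<exists>y\<in>N. x = u + \<rho> h y"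
    and x: "x \<in> N"
  shows "x \<in> U"
proof -
  have "\<exists>u\<in>U. \<exists>y\<in>N. x = u + (\<rho> h ^^ i) y" for i
  proof (induction i)
    case 0
    show ?case using cvec.subspace_0[OF U(1)] x by (intro bexI[of _ 0] bexI[of _ x]) simp_all
  next
    case (Suc i)
    then obtain u y where u: "u \<in> U" "y \<in> N" "x = u + (\<rho> h ^^ i) y" by blast
    obtain u' y' where u': "u' \<in> U" "y' \<in> N" "y = u' + \<rho> h y'" using onto[OF u(2)] by blast
    have "(\<rho> h ^^ i) u' \<in> U" by (induction i) (simp_all add: u' U(2))
    then have "u + (\<rho> h ^^ i) u' \<in> U" using u(1) U(1) by (simp add: cvec.subspace_add)
    moreover have "x = (u + (\<rho> h ^^ i) u') + (\<rho> h ^^ Suc i) y'"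
      by (simp add: u(3) u'(3) clin.linear_add[OF clinear_funpow[OF clinear_rep]] funpow_swap1)
    ultimately show ?case using u'(2) by blast
  qed
  from this[of j] N show ?thesis by auto
qed

lemma rep_0_left [simp]: "\<rho> 0 x = 0"
  by (rule clin.linear_0[OF clinear_rep_left])

lemma rep_diff_left: "\<rho> (g - h) x = \<rho> g x - \<rho> h x"
  by (rule clin.linear_diff[OF clinear_rep_left])

lemma rep_swap: "\<rho> l (\<rho> m x) = \<rho> m (\<rho> l x) + \<rho> (br l m) x"
  by (simp add: rep_br)

end

text \<open>
  The spanning sets consist of differences of elements that act nilpotently on \<open>N\<close>: in the application to
  \<open>\<rho> - f\<close>, an element \<open>b\<close> on which the
  character \<open>f\<close> vanishes has no Fitting decomposition of its own, but it is the difference of two elements on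
  which \<open>f\<close> does not vanish.
\<close>

locale engel_module = finite_lie_representation br \<rho>
  for br :: "'l::complex_vector \<Rightarrow> 'l \<Rightarrow> 'l" and \<rho> :: "'l \<Rightarrow> 'x::complex_banach \<Rightarrow> 'x" +
  fixes N :: "'x set" and c :: nat
  assumes N: "cvec.subspace N" "\<And>m x. x \<in> N \<Longrightarrow> \<rho> m x \<in> N"
    and nontrivial: "\<exists>x\<in>N. x \<noteq> 0"
    and lower_central_0: "lower_central br c = {0}"
    and spanning: "\<And>k. \<exists>B. finite B \<and> lower_central br k = cvec.span B \<and>
      (\<forall>b\<in>B. \<exists>g h. b = g - h \<and> (\<exists>j. \<forall>x\<in>N. (\<rho> g ^^ j) x = 0) \<and> (\<exists>j. \<forall>x\<in>N. (\<rho> h ^^ j) x = 0))"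
begin

text \<open>
  Going up the lower central series from its last term, suppose that the vectors killed by its
  \<open>(k+1)\<close>-st term form a nonzero space \<open>V\<close>. On \<open>V\<close> the operators of the \<open>k\<close>-th term commute with all others, so
  the common kernel of finitely many of them can be found one by one. For an element
  \<open>b = g - h\<close> of the spanning set one passes to the kernel of the nilpotent operator \<open>h\<close> and then to that of \<open>g\<close>.
\<close>

lemma common_kernel: "\<exists>v\<in>N. v \<noteq> 0 \<and> (\<forall>l. \<rho> l v = 0)"
proof -
  have "k \<le> c \<Longrightarrow> \<exists>v\<in>N. v \<noteq> 0 \<and> (\<forall>l\<in>lower_central br k. \<rho> l v = 0)" for k
  proof (induction k rule: inc_induct)
    case base
    show ?case using nontrivial lower_central_0 by simp
  next
    case (step k)
    define V where "V = {v \<in> N. \<forall>l\<in>lower_central br (Suc k). \<rho> l v = 0}"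
    obtain B where B: "finite B" "lower_central br k = cvec.span B"
      "\<forall>b\<in>B. \<exists>g h. b = g - h \<and> (\<exists>j. \<forall>x\<in>N. (\<rho> g ^^ j) x = 0) \<and> (\<exists>j. \<forall>x\<in>N. (\<rho> h ^^ j) x = 0)"
      using spanning[of k] by blast
    have V_inv: "\<rho> m v \<in> V" if "v \<in> V" for m v
    proof -
      have "\<rho> l (\<rho> m v) = 0" if l: "l \<in> lower_central br (Suc k)" for l
      proof -
        have "br l m \<in> lower_central br (Suc k)"
          using br_lower_central'[OF l] lower_central_decreasing by blast
        then show ?thesis
          using \<open>v \<in> V\<close> l rep_swap[of l m v] by (simp add: V_def rep_simps del: lower_central.simps)
      qed
      then show ?thesis using that N(2) by (simp add: V_def del: lower_central.simps)
    qed
    have "B' \<subseteq> B \<Longrightarrow> \<exists>v\<in>V. v \<noteq> 0 \<and> (\<forall>b\<in>B'. \<rho> b v = 0)" if "finite B'" for B'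
      using that
    proof (induction B')
      case empty
      then show ?case using step.IH by (auto simp: V_def)
    next
      case (insert b B')
      define W where "W = {v \<in> V. \<forall>a\<in>B'. \<rho> a v = 0}"
      obtain g h i j where gh: "b = g - h" "\<forall>x\<in>N. (\<rho> g ^^ i) x = 0" "\<forall>x\<in>N. (\<rho> h ^^ j) x = 0"
        using B(3) insert.prems by blast
      have in_Lk: "a \<in> lower_central br k" if "a \<in> B" for a
        unfolding B(2) using that by (rule cvec.span_base)
      have kill: "\<rho> l v = 0" if "l \<in> lower_central br (Suc k)" "v \<in> V" for l v
        using that unfolding V_def by blast
      have W_inv: "\<rho> m v \<in> W" if v: "v \<in> W" for m v
      proof -
        have vV: "v \<in> V" using v by (simp add: W_def)
        have "\<rho> a (\<rho> m v) = 0" if a: "a \<in> B'" for a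
        proof -
          have "\<rho> (br a m) v = 0"
            using a insert.prems by (intro kill[OF br_lower_central'[OF in_Lk] vV]) blast
          then show ?thesis using v a rep_swap[of a m v] by (simp add: W_def rep_simps)
        qed
        then show ?thesis using V_inv[OF vV] by (simp add: W_def)
      qed
      obtain v where "v \<in> W" "v \<noteq> 0"
        using insert.IH insert.prems by (auto simp: W_def)
      moreover have "(\<rho> h ^^ j) v = 0" using \<open>v \<in> W\<close> gh(3) by (simp add: W_def V_def)
      ultimately obtain v1 where v1: "v1 \<in> W" "v1 \<noteq> 0" "\<rho> h v1 = 0"
        using nilpotent_kernel[of W h] W_inv by blast
      define W1 where "W1 = {v \<in> W. \<rho> h v = 0}"
      \<comment> \<open>\<open>g\<close> and \<open>h\<close> commute on \<open>V\<close>, because \<open>[h, g] = [h, b]\<close> lies in the next term of the series.\<close>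
      have "\<rho> g v \<in> W1" if v: "v \<in> W1" for v
      proof -
        have "br h g = br h b" by (simp add: gh(1) br_simps br_self)
        then have "\<rho> (br h g) v = 0"
          using v insert.prems by (intro kill) (simp_all add: br_lower_central in_Lk W1_def W_def del: lower_central.simps)
        then show ?thesis using v W_inv rep_swap[of h g v] by (simp add: W1_def rep_simps)
      qed
      moreover have "v1 \<in> W1" "(\<rho> g ^^ i) v1 = 0"
        using v1 gh(2) by (simp_all add: W1_def W_def V_def)
      ultimately obtain v2 where v2: "v2 \<in> W1" "v2 \<noteq> 0" "\<rho> g v2 = 0"
        using nilpotent_kernel[of W1 g v1 i] v1(2) by blast
      then have "\<rho> b v2 = 0" by (simp add: gh(1) rep_diff_left W1_def)
      then show ?case using v2 by (auto simp: W1_def W_def)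
    qed
    from this[OF B(1) subset_refl] obtain v where v: "v \<in> V" "v \<noteq> 0" "\<forall>b\<in>B. \<rho> b v = 0"
      by blast
    have "cvec.span B \<subseteq> {l. \<rho> l v = 0}"
      using v(3) by (intro cvec.span_minimal clin.linear_subspace_kernel[OF clinear_rep_left]) blast
    then show ?case
      using v(1,2) unfolding B(2) V_def by blast
  qed
  from this[of 0] show ?thesis by simp
qed

text \<open>
  The dual of \<open>common_kernel\<close>: modulo a proper invariant subspace \<open>U\<close> that contains the image of the
  \<open>(k+1)\<close>-st term, the operators of the \<open>k\<close>-th term commute with all others. Adding the image of one element
  \<open>b = g - h\<close> keeps \<open>U\<close> proper, since already adding the images of the nilpotent operators \<open>h\<close> and \<open>g\<close> does.
\<close>

lemma proper_image: "\<exists>U. cvec.subspace U \<and> U \<subseteq> N \<and> U \<noteq> N \<and> (\<forall>l. \<forall>x\<in>N. \<rho> l x \<in> U)"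
proof -
  define proper where "proper U \<longleftrightarrow> cvec.subspace U \<and> U \<subseteq> N \<and> U \<noteq> N \<and> (\<forall>m. \<forall>u\<in>U. \<rho> m u \<in> U)" for U
  have "k \<le> c \<Longrightarrow> \<exists>U. proper U \<and> (\<forall>l\<in>lower_central br k. \<forall>x\<in>N. \<rho> l x \<in> U)" for k
  proof (induction k rule: inc_induct)
    case base
    have "proper {0}"
      using N(1) nontrivial by (auto simp: proper_def cvec.subspace_0 rep_simps cvec.subspace_def)
    then show ?case using lower_central_0 by (intro exI[of _ "{0}"]) simp
  next
    case (step k)
    obtain B where B: "finite B" "lower_central br k = cvec.span B"
      "\<forall>b\<in>B. \<exists>g h. b = g - h \<and> (\<exists>j. \<forall>x\<in>N. (\<rho> g ^^ j) x = 0) \<and> (\<exists>j. \<forall>x\<in>N. (\<rho> h ^^ j) x = 0)"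
      using spanning[of k] by blast
    let ?P = "\<lambda>U A. proper U \<and> (\<forall>l\<in>lower_central br (Suc k). \<forall>x\<in>N. \<rho> l x \<in> U) \<and> (\<forall>b\<in>A. \<forall>x\<in>N. \<rho> b x \<in> U)"
    have "B' \<subseteq> B \<Longrightarrow> \<exists>U. ?P U B'" if "finite B'" for B'
      using that
    proof (induction B')
      case empty
      then show ?case using step.IH by auto
    next
      case (insert b B')
      have "B' \<subseteq> B" using insert.prems by blast
      from insert.IH[OF this] obtain U where "?P U B'" ..
      then have U: "proper U" "\<forall>l\<in>lower_central br (Suc k). \<forall>x\<in>N. \<rho> l x \<in> U" "\<forall>b\<in>B'. \<forall>x\<in>N. \<rho> b x \<in> U"
        by (blast+)
      have U_sub: "cvec.subspace U" "U \<subseteq> N" "\<And>m u. u \<in> U \<Longrightarrow> \<rho> m u \<in> U"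
        using U(1) unfolding proper_def by blast+
      obtain g h i j where gh: "b = g - h" "\<forall>x\<in>N. (\<rho> g ^^ i) x = 0" "\<forall>x\<in>N. (\<rho> h ^^ j) x = 0"
        using B(3) insert.prems by blast
      have b: "b \<in> lower_central br k"
        unfolding B(2) using insert.prems by (intro cvec.span_base) blast
      have kill: "\<rho> l x \<in> U" if "l \<in> lower_central br (Suc k)" "x \<in> N" for l x
        using that U(2) by blast
      define plus_image where "plus_image U l = {u + \<rho> l x | u x. u \<in> U \<and> x \<in> N}" for U l
      have sub: "cvec.subspace (plus_image U' l)" if "cvec.subspace U'" for U' l
      proof -
        have "plus_image U' l = {u + y | u y. u \<in> U' \<and> y \<in> \<rho> l ` N}"
          unfolding plus_image_def by blast
        then show ?thesis
          using cvec.subspace_sums[OF that clin.linear_subspace_image[OF clinear_rep N(1)]] by simp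
      qed
      obtain y where y: "y \<in> N" "y \<notin> U" using U(1) unfolding proper_def by blast
      have "\<exists>y\<in>N. y \<notin> plus_image U h"
      proof (rule ccontr)
        assume "\<not> ?thesis"
        then have "\<And>x. x \<in> N \<Longrightarrow> \<exists>u\<in>U. \<exists>y\<in>N. x = u + \<rho> h y" unfolding plus_image_def by blast
        from nilpotent_cokernel[OF U_sub(1,3) _ this y(1), where j = j] gh(3) y(2) show False by blast
      qed
      then obtain z where z: "z \<in> N" "z \<notin> plus_image U h" by blast
      \<comment> \<open>\<open>g\<close> and \<open>h\<close> commute modulo \<open>U\<close>, because \<open>[g, h] = [b, h]\<close> lies in the next term of the series.\<close>
      have inv1: "\<rho> g u \<in> plus_image U h" if u: "u \<in> plus_image U h" for u
      proof -
        obtain v x where v: "u = v + \<rho> h x" "v \<in> U" "x \<in> N" using u unfolding plus_image_def by blast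
        have "br g h = br b h" by (simp add: gh(1) br_simps br_self)
        then have "\<rho> (br g h) x \<in> U" using kill[OF br_lower_central'[OF b] v(3)] by simp
        then have "\<rho> g v + \<rho> (br g h) x \<in> U" using U_sub v(2) by (simp add: cvec.subspace_add)
        moreover have "\<rho> g u = (\<rho> g v + \<rho> (br g h) x) + \<rho> h (\<rho> g x)"
          by (simp add: v(1) rep_simps rep_swap[of g h])
        ultimately show ?thesis unfolding plus_image_def using N(2)[OF v(3)] by blast
      qed
      have "\<exists>y\<in>N. y \<notin> plus_image (plus_image U h) g"
      proof (rule ccontr)
        assume "\<not> ?thesis"
        then have "\<And>x. x \<in> N \<Longrightarrow> \<exists>u\<in>plus_image U h. \<exists>y\<in>N. x = u + \<rho> g y"
          unfolding plus_image_def[of "plus_image U h"] by blast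
        from nilpotent_cokernel[OF sub[OF U_sub(1)] inv1 _ this z(1), where j = i] gh(2) z(2) show False by blast
      qed
      moreover have "plus_image U b \<subseteq> plus_image (plus_image U h) g"
      proof
        fix u assume "u \<in> plus_image U b"
        then obtain v x where v: "u = v + \<rho> b x" "v \<in> U" "x \<in> N" unfolding plus_image_def by blast
        have "v + \<rho> h (- x) \<in> plus_image U h"
          unfolding plus_image_def using v(2) cvec.subspace_neg[OF N(1) v(3)] by blast
        moreover have "u = (v + \<rho> h (- x)) + \<rho> g x"
          by (simp add: v(1) gh(1) rep_diff_left rep_simps)
        ultimately show "u \<in> plus_image (plus_image U h) g"
          unfolding plus_image_def[of "plus_image U h"] using v(3) by blast
      qed
      ultimately have "plus_image U b \<noteq> N" by blast
      moreover have "plus_image U b \<subseteq> N"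
        unfolding plus_image_def using U_sub(2) N by (auto intro: cvec.subspace_add)
      moreover have "\<rho> m u \<in> plus_image U b" if u: "u \<in> plus_image U b" for m u
      proof -
        obtain v x where v: "u = v + \<rho> b x" "v \<in> U" "x \<in> N" using u unfolding plus_image_def by blast
        have "\<rho> (br m b) x \<in> U" by (rule kill[OF br_lower_central[OF b] v(3)])
        then have "\<rho> m v + \<rho> (br m b) x \<in> U" using U_sub v(2) by (simp add: cvec.subspace_add)
        moreover have "\<rho> m u = (\<rho> m v + \<rho> (br m b) x) + \<rho> b (\<rho> m x)"
          by (simp add: v(1) rep_simps rep_swap[of m b])
        ultimately show ?thesis unfolding plus_image_def using N(2)[OF v(3)] by blast
      qed
      ultimately have "proper (plus_image U b)"
        unfolding proper_def using sub[OF U_sub(1)] by blast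
      moreover have "U \<subseteq> plus_image U b"
      proof
        fix u assume "u \<in> U"
        moreover have "u = u + \<rho> b 0" by (simp add: rep_simps)
        ultimately show "u \<in> plus_image U b" unfolding plus_image_def using cvec.subspace_0[OF N(1)] by blast
      qed
      moreover have "\<rho> b x \<in> plus_image U b" if "x \<in> N" for x
      proof -
        have "\<rho> b x = 0 + \<rho> b x" by simp
        then show ?thesis unfolding plus_image_def using that cvec.subspace_0[OF U_sub(1)] by blast
      qed
      ultimately have "?P (plus_image U b) (insert b B')"
        using U(2,3) by blast
      then show ?case by blast
    qed
    from this[OF B(1) subset_refl] obtain U where U: "proper U" "\<forall>b\<in>B. \<forall>x\<in>N. \<rho> b x \<in> U"
      by blast
    have "cvec.span B \<subseteq> {l. \<rho> l x \<in> U}" if "x \<in> N" for x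
      using U that unfolding proper_def
      by (intro cvec.span_minimal clin.linear_subspace_linear_preimage[OF clinear_rep_left]) auto
    then show ?case
      using U(1) unfolding B(2) by blast
  qed
  from this[of 0] show ?thesis unfolding proper_def by auto
qed

end

section \<open>The joint spectra\<close>

context finite_lie_representation
begin

text \<open>
  The alternative is decided by the joint Fitting operator \<open>Q\<close> of finitely many elements off the kernel of \<open>f\<close>,
  chosen so that their differences contain spanning sets of all terms of the lower central series: either
  \<open>Q = 0\<close>, and every cycle is a boundary, or Engel's argument applies to the range of \<open>Q\<close>.
\<close>

lemma exact_or_eigenvector:
  assumes c: "lower_central br c = {0}"
    and good: "\<And>l. f l \<noteq> 0 \<Longrightarrow> compact_operator (\<lambda>x. \<rho> l x + f l *\<^sub>C x)"
    and f: "clinear f" "f l0 \<noteq> (0 :: complex)"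
  shows "(\<forall>p. \<not> homology_nonzero br \<rho> p) \<and> (\<forall>x. (\<forall>l. \<rho> l x = 0) \<longrightarrow> x = 0) \<or>
    (\<exists>x. x \<noteq> 0 \<and> (\<forall>l. \<rho> l x = 0)) \<and> homology_nonzero br \<rho> 0"
proof -
  have nilpotent: "(br l ^^ c) m = 0" for l m
    using br_pow_lower_central[where l = l and k = c and m = m] c by simp
  \<comment> \<open>Every \<open>b\<close> is the difference of \<open>b + a l\<^sub>0\<close> and \<open>a l\<^sub>0\<close>; one of \<open>a = 1\<close> and \<open>a = 2\<close> avoids the kernel of \<open>f\<close>.\<close>
  have "\<exists>g h. b = g - h \<and> f g \<noteq> 0 \<and> f h \<noteq> 0" for b
  proof -
    obtain a :: complex where a: "a \<noteq> 0" "f b + a * f l0 \<noteq> 0"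
    proof (cases "f b + f l0 = 0")
      case True
      have "f b + 2 * f l0 = (f b + f l0) + f l0" by simp
      also have "\<dots> = f l0" unfolding True by simp
      finally have "f b + 2 * f l0 \<noteq> 0" using f(2) by metis
      then show ?thesis by (rule that[rotated]) simp
    next
      case False
      then show ?thesis using that[of 1] by simp
    qed
    then show ?thesis
      using f by (intro exI[of _ "b + a *\<^sub>C l0"] exI[of _ "a *\<^sub>C l0"])
        (simp add: clin.linear_add clin.linear_scale scaleC_complex_def)
  qed
  then obtain g h where gh: "\<And>b. b = g b - h b" "\<And>b. f (g b) \<noteq> 0" "\<And>b. f (h b) \<noteq> 0"
    by metis
  obtain B where B: "\<And>k. finite (B k)" "\<And>k. lower_central br k = cvec.span (B k)"
    using finite_spanning_set by metis
  define A where "A = (\<Union>k<c. g ` B k \<union> h ` B k)"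
  have "finite A" using B(1) by (simp add: A_def)
  moreover have "\<exists>\<mu>. \<mu> \<noteq> 0 \<and> compact_operator (\<lambda>x. \<rho> l x + \<mu> *\<^sub>C x)" if "l \<in> A" for l
    using that gh(2,3) good by (intro exI[of _ "f l"]) (auto simp: A_def)
  ultimately have "\<exists>Q. splits_cycles Q \<and> (\<forall>l\<in>A. \<exists>k. \<forall>x. (\<rho> l ^^ k) (Q x) = 0)"
    by (rule joint_fitting_projection[OF nilpotent])
  then obtain Q where "splits_cycles Q \<and> (\<forall>l\<in>A. \<exists>k. \<forall>x. (\<rho> l ^^ k) (Q x) = 0)" ..
  then have Q: "splits_cycles Q" "\<And>l. l \<in> A \<Longrightarrow> \<exists>k. \<forall>x. (\<rho> l ^^ k) (Q x) = 0"
    by simp_all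
  have Q': "clinear Q" "\<And>m x. Q (\<rho> m x) = \<rho> m (Q x)" "\<And>x. (\<And>m. \<rho> m x = 0) \<Longrightarrow> Q x = x"
    "\<And>p u. u \<in> koszul_space TYPE('l) p \<Longrightarrow> boundary u = 0 \<Longrightarrow>
       u - coeffwise Q u \<in> boundary ` koszul_space TYPE('l) (Suc p)"
    using Q(1) unfolding splits_cycles_def by auto
  show ?thesis
  proof (cases "\<forall>x. Q x = 0")
    case True
    then have "coeffwise Q u = 0" for u
      by (simp add: fun_eq_iff coeffwise_apply pointwise)
    then have "u \<in> boundary ` koszul_space TYPE('l) (Suc p)"
      if "u \<in> koszul_space TYPE('l) p" "boundary u = 0" for p u
      using Q'(4)[OF that] by simp
    then show ?thesis
      unfolding homology_nonzero_iff using Q'(3) True by metis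
  next
    case False
    have span: "\<exists>B. finite B \<and> lower_central br k = cvec.span B \<and>
      (\<forall>b\<in>B. \<exists>g h. b = g - h \<and> (\<exists>j. \<forall>x\<in>range Q. (\<rho> g ^^ j) x = 0) \<and> (\<exists>j. \<forall>x\<in>range Q. (\<rho> h ^^ j) x = 0))" for k
    proof (cases "k < c")
      case True
      have nil: "\<exists>j. \<forall>x\<in>range Q. (\<rho> (g b) ^^ j) x = 0" "\<exists>j. \<forall>x\<in>range Q. (\<rho> (h b) ^^ j) x = 0" if "b \<in> B k" for b
        using Q(2)[of "g b"] Q(2)[of "h b"] that True by (auto simp: A_def)
      show ?thesis
      proof (intro exI[of _ "B k"] conjI ballI B)
        fix b assume b: "b \<in> B k"
        show "\<exists>g h. b = g - h \<and> (\<exists>j. \<forall>x\<in>range Q. (\<rho> g ^^ j) x = 0) \<and> (\<exists>j. \<forall>x\<in>range Q. (\<rho> h ^^ j) x = 0)"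
          by (intro exI[of _ "g b"] exI[of _ "h b"] conjI gh(1) nil[OF b])
      qed
    next
      case False
      then have "lower_central br k \<subseteq> lower_central br c"
        using lift_Suc_antimono_le[of "lower_central br" c k] lower_central_decreasing by simp
      then have "lower_central br k = cvec.span {}"
        using c cvec.subspace_0[OF subspace_lower_central[of k]] by auto
      then show ?thesis by (intro exI[of _ "{}"]) simp
    qed
    have N: "cvec.subspace (range Q)"
      by (rule clin.linear_subspace_image[OF Q'(1)]) simp
    interpret engel_module br \<rho> "range Q" c
    proof
      show "\<rho> m x \<in> range Q" if x: "x \<in> range Q" for m x
      proof -
        obtain y where "x = Q y" using x by blast
        then have "\<rho> m x = Q (\<rho> m y)" by (simp only: Q'(2))
        then show ?thesis by simp
      qed
      obtain x where "Q x \<noteq> 0" using False by (auto simp only:)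
      then show "\<exists>x\<in>range Q. x \<noteq> 0" by (intro bexI[of _ "Q x"]) simp_all
    qed (rule N c span)+
    obtain x where x: "x \<noteq> 0" "\<And>l. \<rho> l x = 0" using common_kernel by blast
    obtain U where U: "cvec.subspace U" "U \<subseteq> range Q" "U \<noteq> range Q" "\<And>l x. x \<in> range Q \<Longrightarrow> \<rho> l x \<in> U"
      using proper_image by blast
    have "homology_nonzero br \<rho> 0"
    proof (rule bottom_homology_nonzero)
      show "cvec.subspace {x. Q x \<in> U}"
        by (rule clin.linear_subspace_linear_preimage[OF Q'(1) U(1)])
      show "{x. Q x \<in> U} \<noteq> UNIV" using U(2,3) by auto
      show "\<rho> l x \<in> {x. Q x \<in> U}" for l x using U(4) by (simp add: Q'(2))
    qed
    then show ?thesis using x by blast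
  qed
qed

text \<open>
  The boundaries in degree \<open>0\<close> are the sums of images under the compact operators \<open>\<rho> e\<^sub>i\<close>, which form a proper
  subspace of the infinite-dimensional space \<open>X\<close>.
\<close>

lemma compact_bottom_homology_nonzero:
  assumes "\<not> cfinite_dim TYPE('x)" and compact: "\<And>l. compact_operator (\<rho> l)"
  shows "homology_nonzero br \<rho> 0"
proof -
  let ?V = "{\<Sum>i<cdim TYPE('l). \<rho> (lie_basis i) (x i) | x. True}"
  obtain y where y: "\<And>x. y \<noteq> (\<Sum>i<cdim TYPE('l). \<rho> (lie_basis i) (x i))"
    using compact_operators_not_spanning[of "{..<cdim TYPE('l)}" "\<lambda>i. \<rho> (lie_basis i)"] assms by blast
  show ?thesis
  proof (rule bottom_homology_nonzero)
    show "cvec.subspace ?V"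
    proof (rule cvec.subspaceI)
      show "0 \<in> ?V" by (auto simp: rep_simps intro!: exI[of _ "\<lambda>_. 0"])
    next
      fix u v assume "u \<in> ?V" "v \<in> ?V"
      then obtain x z where "u = (\<Sum>i<cdim TYPE('l). \<rho> (lie_basis i) (x i))"
        "v = (\<Sum>i<cdim TYPE('l). \<rho> (lie_basis i) (z i))" by blast
      then have "u + v = (\<Sum>i<cdim TYPE('l). \<rho> (lie_basis i) (x i + z i))"
        by (simp add: rep_simps sum.distrib)
      then show "u + v \<in> ?V" by (intro CollectI exI[of _ "\<lambda>i. x i + z i"]) simp
    next
      fix a u assume "u \<in> ?V"
      then obtain x where "u = (\<Sum>i<cdim TYPE('l). \<rho> (lie_basis i) (x i))" by blast
      then have "a *\<^sub>C u = (\<Sum>i<cdim TYPE('l). \<rho> (lie_basis i) (a *\<^sub>C x i))"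
        by (simp add: rep_simps cvec.scale_sum_right)
      then show "a *\<^sub>C u \<in> ?V" by (intro CollectI exI[of _ "\<lambda>i. a *\<^sub>C x i"]) simp
    qed
    show "?V \<noteq> UNIV"
    proof
      assume "?V = UNIV"
      then have "y \<in> ?V" by simp
      then show False using y by blast
    qed
    show "\<rho> l x \<in> ?V" for l x
    proof -
      have "\<rho> l x = \<rho> (\<Sum>i<cdim TYPE('l). lie_coord i l *\<^sub>C lie_basis i) x"
        by (simp add: lie_basis_expansion finite_dim)
      also have "\<dots> = (\<Sum>i<cdim TYPE('l). \<rho> (lie_basis i) (lie_coord i l *\<^sub>C x))"
        by (simp add: clin.linear_sum[OF clinear_rep_left] rep_scale rep_simps)
      finally show ?thesis by (intro CollectI exI[of _ "\<lambda>i. lie_coord i l *\<^sub>C x"]) simp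
    qed
  qed
qed

end

lemma finite_lie_representation_rep_minus:
  assumes "lie_representation br \<rho>" "cfinite_dim TYPE('l)" "f \<in> characters br"
  shows "finite_lie_representation br (rep_minus \<rho> f :: 'l::complex_vector \<Rightarrow> 'x::complex_banach \<Rightarrow> 'x)"
proof -
  interpret lie_representation br \<rho> by (rule assms(1))
  have f: "clinear f" "\<And>x y. f (br x y) = 0" using assms(3) by (auto simp: characters_def)
  have lin: "clinear (\<rho> l)" for l using rep_bounded unfolding bounded_clinear_def by blast
  show ?thesis
  proof
    show "bounded_clinear (rep_minus \<rho> f l)" for l
    proof -
      have "bounded_linear (\<lambda>x. \<rho> l x - f l *\<^sub>C x)"
        by (intro bounded_linear_sub bounded_clinear_imp_bounded_linear rep_bounded bounded_clinear_scaleC)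
      then have "\<exists>K. \<forall>x. norm (\<rho> l x - f l *\<^sub>C x) \<le> norm x * K"
        using bounded_linear.bounded by blast
      moreover have "clinear (\<lambda>x. \<rho> l x - f l *\<^sub>C x)"
        by (rule clinearI) (simp_all add: clin.linear_add[OF lin] clin.linear_scale[OF lin]
            cvec.scale_right_distrib cvec.scale_right_diff_distrib scaleC_scaleC mult.commute)
      ultimately show ?thesis by (simp add: bounded_clinear_def rep_minus_def)
    qed
    show "rep_minus \<rho> f (l + m) x = rep_minus \<rho> f l x + rep_minus \<rho> f m x" for l m x
      by (simp add: rep_minus_def rep_add clin.linear_add[OF f(1)] scaleC_add_left)
    show "rep_minus \<rho> f (a *\<^sub>C l) x = a *\<^sub>C rep_minus \<rho> f l x" for a l x
      by (simp add: rep_minus_def rep_scale clin.linear_scale[OF f(1)] scaleC_complex_def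
          cvec.scale_right_diff_distrib scaleC_scaleC)
    show "rep_minus \<rho> f (br l m) x
        = rep_minus \<rho> f l (rep_minus \<rho> f m x) - rep_minus \<rho> f m (rep_minus \<rho> f l x)" for l m x
      by (simp add: rep_minus_def rep_br f(2) clin.linear_diff[OF lin] clin.linear_scale[OF lin]
          cvec.scale_right_diff_distrib scaleC_scaleC mult.commute)
    show "cfinite_dim TYPE('l)" by (rule assms(2))
  qed
qed

theorem theorem3p1:
  fixes br :: "'l::complex_vector \<Rightarrow> 'l \<Rightarrow> 'l"
    and \<rho> :: "'l \<Rightarrow> 'x::complex_banach \<Rightarrow> 'x"
    and k :: nat
  assumes "\<not> cfinite_dim TYPE('x)"
    and "lie_algebra br"
    and "cfinite_dim TYPE('l)"
    and "lie_nilpotent br"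
    and "lie_representation br \<rho>"
    and "\<And>l. compact_operator (\<rho> l)"
    and "k \<le> cdim TYPE('l)"
  defines "E \<equiv> {\<lambda>_. 0} \<union>
      {f \<in> characters br. \<exists>x. x \<noteq> 0 \<and> (\<forall>l. \<rho> l x = f l *\<^sub>C x)}"
  shows "taylor_spectrum br \<rho> = E \<and>
    slodkowski_delta br \<rho> k \<union> {\<lambda>_. 0} = E \<and>
    slodkowski_pi br \<rho> k \<union> {\<lambda>_. 0} = E"
proof -
  let ?n = "cdim TYPE('l)"
  obtain c where c: "lower_central br c = {0}"
    using assms(4) unfolding lie_nilpotent_def by blast
  have rep: "finite_lie_representation br (rep_minus \<rho> f)" if "f \<in> characters br" for f
    using finite_lie_representation_rep_minus[OF assms(5,3) that] .
  have zero: "(\<lambda>_. 0) \<in> characters br"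
    by (auto simp: characters_def scaleC_complex_def intro!: clinearI)
  have eigen: "rep_minus \<rho> f l x = 0 \<longleftrightarrow> \<rho> l x = f l *\<^sub>C x" for f l x
    by (simp add: rep_minus_def)
  have rho: "rep_minus \<rho> (\<lambda>_. 0) = \<rho>"
    by (simp add: rep_minus_def fun_eq_iff)
  have zero_0: "(\<lambda>_. 0) \<in> sigma_p br \<rho> 0"
    using finite_lie_representation.compact_bottom_homology_nonzero[OF rep[OF zero] assms(1)]
      assms(6) zero by (simp add: rho sigma_p_def)
  have "f \<in> E \<and> f \<in> sigma_p br \<rho> 0 \<and> f \<in> sigma_p br \<rho> ?n \<or>
      f \<notin> E \<and> (\<forall>p. f \<notin> sigma_p br \<rho> p) \<and> (\<forall>p. closed (koszul_range br (rep_minus \<rho> f) p))"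
    if f: "f \<in> characters br" "f \<noteq> (\<lambda>_. 0)" for f
  proof -
    interpret finite_lie_representation br "rep_minus \<rho> f" by (rule rep[OF f(1)])
    have nilpotent: "(br l ^^ c) m = 0" for l m
      using br_pow_lower_central[where l = l and k = c and m = m] c by simp
    obtain l0 where l0: "f l0 \<noteq> 0" using f(2) by (auto simp: fun_eq_iff)
    have lin: "clinear f" using f(1) by (simp add: characters_def)
    have "compact_operator (\<lambda>x. rep_minus \<rho> f l x + f l *\<^sub>C x)" for l
      using assms(6)[of l] by (simp add: rep_minus_def)
    then have "(\<forall>p. \<not> homology_nonzero br (rep_minus \<rho> f) p) \<and> (\<forall>x. (\<forall>l. rep_minus \<rho> f l x = 0) \<longrightarrow> x = 0) \<or>
      (\<exists>x. x \<noteq> 0 \<and> (\<forall>l. rep_minus \<rho> f l x = 0)) \<and> homology_nonzero br (rep_minus \<rho> f) 0"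
      by (rule exact_or_eigenvector[OF c _ lin l0])
    then consider
      "\<forall>p. \<not> homology_nonzero br (rep_minus \<rho> f) p" "\<forall>x. (\<forall>l. rep_minus \<rho> f l x = 0) \<longrightarrow> x = 0"
      | x where "x \<noteq> 0" "\<forall>l. rep_minus \<rho> f l x = 0" "homology_nonzero br (rep_minus \<rho> f) 0"
      by blast
    then show ?thesis
    proof cases
      case 1
      then have "closed (koszul_range br (rep_minus \<rho> f) p)" for p
        by (intro closed_koszul_range) blast
      moreover have "f \<notin> E" using 1(2) f(2) by (auto simp: E_def eigen)
      ultimately show ?thesis using 1(1) by (simp add: sigma_p_def)
    next
      case (2 x)
      have "homology_nonzero br (rep_minus \<rho> f) ?n"
        by (rule top_homology_nonzero[OF nilpotent 2(1)]) (use 2(2) in blast)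
      moreover have "f \<in> E" using 2(1,2) f(1) by (auto simp: E_def eigen)
      ultimately show ?thesis using 2(3) f(1) by (simp add: sigma_p_def)
    qed
  qed
  note dichotomy = this
  have E: "(\<lambda>_. 0) \<in> E" "\<And>f. f \<in> E \<Longrightarrow> f \<in> characters br" using zero by (auto simp: E_def)
  have sigma: "\<And>f p. f \<in> sigma_p br \<rho> p \<Longrightarrow> f \<in> characters br" by (simp add: sigma_p_def)
  have in_E: "f \<in> E" if "f \<in> sigma_p br \<rho> p" for f p
    using dichotomy[OF sigma[OF that]] that E(1) by blast
  have out_E: "f \<in> sigma_p br \<rho> 0" "f \<noteq> (\<lambda>_. 0) \<Longrightarrow> f \<in> sigma_p br \<rho> ?n" if "f \<in> E" for f
    using dichotomy[OF E(2)[OF that]] that zero_0 by blast+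
  have "taylor_spectrum br \<rho> = E"
    unfolding taylor_spectrum_def using in_E out_E(1) by force
  moreover have "slodkowski_delta br \<rho> k \<union> {\<lambda>_. 0} = E"
    unfolding slodkowski_delta_def using in_E out_E(1) E(1) by force
  moreover have "slodkowski_pi br \<rho> k \<union> {\<lambda>_. 0} = E"
  proof (intro equalityI subsetI)
    fix f assume "f \<in> slodkowski_pi br \<rho> k \<union> {\<lambda>_. 0}"
    then consider "f = (\<lambda>_. 0)" | p where "f \<in> sigma_p br \<rho> p"
      | "f \<in> characters br" "\<not> closed (koszul_range br (rep_minus \<rho> f) (?n - k))"
      unfolding slodkowski_pi_def by blast
    then show "f \<in> E"
    proof cases
      case 3
      then show ?thesis using dichotomy[of f] E(1) by blast
    qed (use in_E E(1) in auto)
  next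
    fix f assume "f \<in> E"
    then show "f \<in> slodkowski_pi br \<rho> k \<union> {\<lambda>_. 0}"
      using out_E(2)[of f] unfolding slodkowski_pi_def by force
  qed
  ultimately show ?thesis by blast
qed

end
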